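(* For all integers $d \ge 3$ and $l, n > d$, $$\mathrm{ES}_d(l,n) \le \frac{l-d}{d!}\cdot 2^{O\left(\frac{dn}{\log_{(4)} n}\right)}.$$ That is, there exist constants $C>0$ and $n_0$ such that for all integers $d\ge 3$, $l>d$ and $n>d$ with $n\ge n_0$, one has $\mathrm{ES}_d(l,n)\le \frac{l-d}{d!}\cdot 2^{C d n/\log_{(4)} n}$.
   Context: Let $d\ge 2$. A finite set $P\subset\mathbb{R}^d$ with $|P|\ge d+1$ is in general position if no $d+1$ points of $P$ lie on a common $(d-1)$-dimensional (affine) hyperplane. $P$ is in convex position if $P$ is in general position and every point of $P$ is a vertex of the convex hull $\mathrm{conv}(P)$. For integers $n,l>d\ge 2$, $\mathrm{ES}_d(l,n)$ denotes the smallest integer $N$ such that every set of at least $N$ points in $\mathbb{R}^d$ contains either $l$ points lying on a common $(d-1)$-dimensional hyperplane or $n$ points in convex position. $\log_{(k)} n$ denotes the $k$-th iterated logarithm, i.e. $\log_{(1)} n=\log n$ and $\log_{(k+1)} n=\log(\log_{(k)} n)$; the $O(\cdot)$ refers to $n$ large enough for $\log_{(4)} n$ to be defined and positive. *)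

theory Defs
  imports "HOL-Analysis.Analysis" "HOL-Analysis.Finite_Function_Topology"
begin

text \<open>
  The dimension is a number to be quantified over inside formulas, so $d$-space is the subspace of
  those vectors of the real vector space \<^typ>\<open>nat \<Rightarrow>\<^sub>0 real\<close> that are supported on the coordinates
  below $d$. Convexity notions are then the library's; the library norm on this type is not used.
\<close>

type_synonym point = "nat \<Rightarrow>\<^sub>0 real"

definition Rd :: "nat \<Rightarrow> point set" where
  "Rd d = {x. Poly_Mapping.keys x \<subseteq> {..<d}}"

definition affine_hyperplane :: "nat \<Rightarrow> point set \<Rightarrow> bool" where
  "affine_hyperplane d H \<longleftrightarrow>
     (\<exists>a\<in>Rd d. \<exists>b. a \<noteq> 0 \<and>
        H = {x \<in> Rd d. (\<Sum>i<d. Poly_Mapping.lookup a i * Poly_Mapping.lookup x i) = b})"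

definition general_position :: "nat \<Rightarrow> point set \<Rightarrow> bool" where
  "general_position d P \<longleftrightarrow>
     P \<subseteq> Rd d \<and> finite P \<and> d + 1 \<le> card P \<and>
     \<not> (\<exists>Q H. Q \<subseteq> P \<and> card Q = d + 1 \<and> affine_hyperplane d H \<and> Q \<subseteq> H)"

definition convex_position :: "nat \<Rightarrow> point set \<Rightarrow> bool" where
  "convex_position d P \<longleftrightarrow>
     general_position d P \<and> (\<forall>p\<in>P. p extreme_point_of (convex hull P))"

definition ES_property :: "nat \<Rightarrow> nat \<Rightarrow> nat \<Rightarrow> nat \<Rightarrow> bool" where
  "ES_property d l n N \<longleftrightarrow>
     (\<forall>P. P \<subseteq> Rd d \<longrightarrow> infinite P \<or> N \<le> card P \<longrightarrow>
        (\<exists>Q H. Q \<subseteq> P \<and> card Q = l \<and> affine_hyperplane d H \<and> Q \<subseteq> H) \<or>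
        (\<exists>Q. Q \<subseteq> P \<and> card Q = n \<and> convex_position d Q))"

text \<open>
  Taking the infimum in \<^typ>\<open>enat\<close> makes the value \<open>\<infinity>\<close> if no number has the property, so that a
  finite upper bound includes the existence of the minimum.
\<close>

definition ES :: "nat \<Rightarrow> nat \<Rightarrow> nat \<Rightarrow> enat" where
  "ES d l n = (INF N \<in> {N. ES_property d l n N}. enat N)"

definition iterated_log :: "nat \<Rightarrow> real \<Rightarrow> real" where
  "iterated_log k x = (ln ^^ k) x"

end

theory Submission
  imports Defs "HOL-Real_Asymp.Real_Asymp"
begin

text \<open>
  A maximal subset \<open>Q\<close> in general position determines at most \<open>card Q choose d\<close> hyperplanes, and these cover
  the given set; this yields the factor \<open>(l - d) / fact d\<close> and reduces the problem to a set \<open>Q\<close> with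
  \<open>2 powr O(n / log log log log n)\<close> points. A generic projection then allows us to work in three dimensions.

  Ramsey's theorem for quadruples and an averaging argument produce many large clusters in which every
  transversal is ordered as on the moment curve. At a point of a middle cluster, a later selection of clusters
  is seen inside a cone with only four edges. The direction joining two points of the cluster can avoid this
  cone; then, projecting from a suitable edge, the planar cups-caps theorem gives either a cup of \<open>n\<close> points,
  or a cap of \<open>n / k\<close> points that is compatible with all other selected clusters. The directions do avoid one
  of two cones that meet only in the apex, namely the one whose left side is near and whose right side is far,
  or conversely. Hence a short recursion finds \<open>k\<close> clusters that all admit compatible caps among
  \<open>1 + (k + 1) ^ k\<close> clusters, and with \<open>k\<close> about the square of the fourfold logarithm of \<open>n\<close> the loss \<open>ln k / k\<close>
  in the exponent is small enough. The planar case offers no such choice of the centre of projection.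
\<close>

text \<open>Asking the planar theorem for \<open>n\<close> points in either case would cost about 4
  ^ n points. Asking for a cup of \<open>n\<close> points or a cap of only \<open>n / k\<close>
  costs exp (O (n * ln k / k)), and this pays off only if caps from \<open>k\<close> different
  clusters, each seen from its own centre of projection, can be united. For thresholds
  \<open>a < i < c\<close>, cluster \<open>i\<close> is only known to be compatible either with its
  near left and far right, or with its far left and near right; no single choice covers everything,
  which is why the clusters have to be selected from a much larger supply.

  The fourfold logarithm arises as follows. The Ramsey number for quadruples is a triple exponential
  of the number of positions, but only its logarithm has to be small against \<open>n\<close>, so it
  costs two logarithms. The number \<open>1 + (k + 1) ^ k\<close> of clusters costs one more, and a
  \<open>k\<close> polynomial in the fourfold logarithm fits below that.\<close>

lemma pigeonhole_fibre:
  assumes "finite A" "finite B" "f ` A \<subseteq> B" "A \<noteq> {}"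
  shows "\<exists>b\<in>B. card A \<le> card {a\<in>A. f a = b} * card B"
proof (rule ccontr)
  assume "\<not> ?thesis"
  then have lt: "card {a\<in>A. f a = b} * card B < card A" if "b \<in> B" for b
    using that by (auto simp: not_le)
  have ne: "B \<noteq> {}" using assms by auto
  have "A = (\<Union>b\<in>B. {a\<in>A. f a = b})" using assms(3) by auto
  then have "card A \<le> (\<Sum>b\<in>B. card {a\<in>A. f a = b})"
    using card_UN_le[OF assms(2), of "\<lambda>b. {a\<in>A. f a = b}"] by simp
  then have "card A * card B \<le> (\<Sum>b\<in>B. card {a\<in>A. f a = b} * card B)"
    by (simp add: mult_le_mono1 flip: sum_distrib_right)
  also have "\<dots> < (\<Sum>b\<in>B. card A)"
    by (rule sum_strict_mono) (use assms(2) ne lt in auto)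
  finally show False by (simp add: mult.commute)
qed

subsection \<open>Ramsey's theorem for uniform hypergraphs\<close>

text \<open>Two colours, because a quadruple of points will be coloured by the sign of its
  orientation.\<close>

definition ramsey_bound :: "nat \<Rightarrow> nat \<Rightarrow> nat \<Rightarrow> bool" where
  "ramsey_bound r m N \<longleftrightarrow>
     (\<forall>(V::nat set) (f::nat set \<Rightarrow> bool). finite V \<and> N \<le> card V \<longrightarrow>
        (\<exists>H\<subseteq>V. card H = m \<and> (\<exists>b. \<forall>T\<subseteq>H. card T = r \<longrightarrow> f T = b)))"

lemma ramsey_bound_1: "ramsey_bound 1 m (2 * m)"
  unfolding ramsey_bound_def
proof (intro allI impI)
  fix V :: "nat set" and f :: "nat set \<Rightarrow> bool"
  assume V: "finite V \<and> 2 * m \<le> card V"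
  let ?A = "\<lambda>b. {v\<in>V. f {v} = b}"
  have "card V = card (?A True \<union> ?A False)" by (rule arg_cong[of _ _ card]) auto
  also have "\<dots> \<le> card (?A True) + card (?A False)" by (rule card_Un_le)
  finally have "m \<le> card (?A True) \<or> m \<le> card (?A False)" using V by linarith
  then obtain b where "m \<le> card (?A b)" by blast
  then obtain H where H: "H \<subseteq> ?A b" "card H = m"
    by (meson obtain_subset_with_card_n)
  have "\<forall>T\<subseteq>H. card T = 1 \<longrightarrow> f T = b"
    using H(1) by (auto simp: card_1_singleton_iff)
  then show "\<exists>H\<subseteq>V. card H = m \<and> (\<exists>b. \<forall>T\<subseteq>H. card T = 1 \<longrightarrow> f T = b)"
    using H by blast
qed

text \<open>The Erdos-Rado notion: the colour of an \<open>r + 1\<close>-set depends on its first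
  \<open>r\<close> elements only. The last element may also come from \<open>S\<close>, the
  reservoir from which \<open>W\<close> is extended.\<close>

definition end_homogeneous :: "nat \<Rightarrow> (nat set \<Rightarrow> bool) \<Rightarrow> nat set \<Rightarrow> nat set \<Rightarrow> bool" where
  "end_homogeneous r f W S \<longleftrightarrow>
     (\<forall>T w w'. T \<subseteq> W \<and> card T = r \<and> w \<in> W \<union> S \<and> w' \<in> W \<union> S \<and>
        (\<forall>x\<in>T. x < w \<and> x < w') \<longrightarrow> f (insert w T) = f (insert w' T))"

text \<open>The least point of the reservoir moves to \<open>W\<close>, and the reservoir shrinks to
  the points with one frequent colour pattern on the sets formed from that point and
  \<open>r - 1\<close> earlier ones. There are at most \<open>2 ^ (n ^ (r - 1))\<close> patterns;
  the \<open>+ 1\<close> in the exponent gives each step a spare factor 2.\<close>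

lemma end_homogeneous_exists:
  fixes V :: "nat set" and f :: "nat set \<Rightarrow> bool"
  assumes V: "finite V" "2 ^ ((n ^ (r - 1) + 1) * n) \<le> card V" and r: "r \<ge> 1" and "t \<le> n"
  shows "\<exists>W S. W \<subseteq> V \<and> S \<subseteq> V \<and> card W = t \<and> (\<forall>x\<in>W. \<forall>y\<in>S. x < y) \<and>
           2 ^ ((n ^ (r - 1) + 1) * (n - t)) \<le> card S \<and> end_homogeneous r f W S"
  using \<open>t \<le> n\<close>
proof (induction t)
  case 0
  have "end_homogeneous r f {} V" using r unfolding end_homogeneous_def by auto
  then show ?case using V by (intro exI[of _ "{}"] exI[of _ V]) auto
next
  case (Suc t)
  then obtain W S where WS: "W \<subseteq> V" "S \<subseteq> V" "card W = t" "\<forall>x\<in>W. \<forall>y\<in>S. x < y"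
    "2 ^ ((n ^ (r - 1) + 1) * (n - t)) \<le> card S" "end_homogeneous r f W S" by auto
  define c where "c = n ^ (r - 1)"
  define X where "X = (2::nat) ^ ((c + 1) * (n - Suc t))"
  have finS: "finite S" and finW: "finite W" using WS V finite_subset by blast+
  have eq: "n - t = Suc (n - Suc t)" using Suc.prems by simp
  have Sge: "2 * 2 ^ c * X \<le> card S"
    using WS(5) unfolding eq c_def X_def by (simp add: power_add algebra_simps)
  have Xpos: "X \<ge> 1" unfolding X_def by simp
  have "2 ^ c * X \<ge> 1" using Xpos by simp
  then have "card S \<ge> 2" using Sge unfolding mult.assoc by linarith
  then have "S \<noteq> {}" by auto
  define v where "v = Min S"
  have v: "v \<in> S" "\<forall>y\<in>S - {v}. v < y"
    using finS \<open>S \<noteq> {}\<close> unfolding v_def by (auto simp: Min_less_iff order_less_le)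
  define \<T> where "\<T> = {T. T \<subseteq> W \<and> card T = r - 1}"
  define g where "g w = {T \<in> \<T>. f (insert w (insert v T))}" for w
  have finT: "finite \<T>" unfolding \<T>_def using finW by simp
  have "card \<T> = t choose (r - 1)" unfolding \<T>_def using n_subsets[OF finW] WS(3) by simp
  also have "\<dots> \<le> n ^ (r - 1)"
  proof (cases "r - 1 \<le> t")
    case True
    then show ?thesis using binomial_le_pow[OF True] Suc.prems
      by (meson Suc_leD le_trans power_mono zero_le)
  qed (simp add: binomial_eq_0)
  finally have cT: "card (Pow \<T>) \<le> 2 ^ c" using finT by (simp add: card_Pow c_def)
  have "card (S - {v}) \<ge> 1" using \<open>card S \<ge> 2\<close> v(1) finS by simp
  then have "S - {v} \<noteq> {}" by (metis card.empty not_one_le_zero)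
  moreover have "g ` (S - {v}) \<subseteq> Pow \<T>" unfolding g_def by auto
  ultimately obtain G where G: "G \<in> Pow \<T>"
    "card (S - {v}) \<le> card {w \<in> S - {v}. g w = G} * card (Pow \<T>)"
    using pigeonhole_fibre[of "S - {v}" "Pow \<T>" g] finS finT by auto
  define S' where "S' = {w \<in> S - {v}. g w = G}"
  have "card S - 1 \<le> card S' * 2 ^ c"
    using G(2) cT v(1) finS unfolding S'_def by (metis (no_types, lifting) card_Diff_singleton mult_le_mono2 order_trans)
  \<comment> \<open>The spare factor 2 pays for the point \<open>v\<close> that has left the
    reservoir.\<close>
  then have "2 * (X * 2 ^ c) \<le> card S' * 2 ^ c + 1" using Sge by (simp add: mult.commute mult.assoc)
  moreover have "X * 2 ^ c \<ge> 1" using Xpos by simp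
  ultimately have "X * 2 ^ c \<le> card S' * 2 ^ c" by linarith
  then have S'ge: "X \<le> card S'" by simp
  have S'sub: "S' \<subseteq> S" "v \<notin> S'" unfolding S'_def by auto
  have "v \<notin> W" using WS(4) v(1) by auto
  have hom: "end_homogeneous r f (insert v W) S'"
    unfolding end_homogeneous_def
  proof (intro allI impI, elim conjE)
    fix T w w'
    assume T: "T \<subseteq> insert v W" "card T = r" and w: "w \<in> insert v W \<union> S'" "w' \<in> insert v W \<union> S'"
      and lt: "\<forall>x\<in>T. x < w \<and> x < w'"
    show "f (insert w T) = f (insert w' T)"
    proof (cases "v \<in> T")
      case False
      then have "T \<subseteq> W" using T by auto
      moreover have "w \<in> W \<union> S" "w' \<in> W \<union> S" using w S'sub v(1) by auto
      ultimately show ?thesis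
        using WS(6)[unfolded end_homogeneous_def, rule_format, of T w w'] T(2) lt by simp
    next
      case True
      have "x \<in> S'" if "x \<in> insert v W \<union> S'" "v < x" for x
        using that WS(4) v(1) by fastforce
      then have wS: "w \<in> S'" "w' \<in> S'" using w lt True by auto
      have "T - {v} \<in> \<T>" unfolding \<T>_def using T True finW
        by (auto simp: card_Diff_singleton)
      moreover have "g w = g w'" using wS unfolding S'_def by auto
      ultimately have "f (insert w (insert v (T - {v}))) = f (insert w' (insert v (T - {v})))"
        unfolding g_def by (auto simp: set_eq_iff simp del: insert_Diff_single)
      then show ?thesis using True by (simp add: insert_absorb)
    qed
  qed
  have "\<forall>x\<in>insert v W. \<forall>y\<in>S'. x < y" using WS(4) S'sub v unfolding S'_def by auto
  moreover have "card (insert v W) = Suc t" using \<open>v \<notin> W\<close> finW WS(3) by simp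
  ultimately show ?case using hom S'ge S'sub WS(1,2) v(1) unfolding X_def c_def
    by (intro exI[of _ "insert v W"] exI[of _ S']) auto
qed

text \<open>After \<open>N\<close> steps the reservoir still has a point \<open>s\<close>. It can
  replace the last element of every \<open>Suc r\<close>-subset of \<open>W\<close>, so colouring
  \<open>T\<close> by \<open>f (insert s T)\<close> reduces the claim to \<open>r\<close>.\<close>

lemma ramsey_bound_Suc:
  assumes "ramsey_bound r m N" "r \<ge> 1"
  shows "ramsey_bound (Suc r) m (2 ^ ((N ^ (r - 1) + 1) * N))"
  unfolding ramsey_bound_def
proof (intro allI impI)
  fix V :: "nat set" and f :: "nat set \<Rightarrow> bool"
  assume V: "finite V \<and> 2 ^ ((N ^ (r - 1) + 1) * N) \<le> card V"
  then obtain W S where WS: "W \<subseteq> V" "S \<subseteq> V" "card W = N" "\<forall>x\<in>W. \<forall>y\<in>S. x < y"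
    "2 ^ ((N ^ (r - 1) + 1) * (N - N)) \<le> card S" "end_homogeneous r f W S"
    using end_homogeneous_exists[of V N r N f] assms(2) by auto
  have "S \<noteq> {}" using WS(5) by auto
  then obtain s where s: "s \<in> S" by auto
  have finW: "finite W" using WS V finite_subset by blast
  obtain H b where H: "H \<subseteq> W" "card H = m" "\<forall>T\<subseteq>H. card T = r \<longrightarrow> f (insert s T) = b"
    using assms(1)[unfolded ramsey_bound_def, rule_format, of W "\<lambda>T. f (insert s T)"] finW WS(3)
    by auto
  have "f T = b" if T: "T \<subseteq> H" "card T = Suc r" for T
  proof -
    have fT: "finite T" "T \<noteq> {}" using T(2) card.infinite by fastforce+
    define w where "w = Max T"
    have w: "w \<in> T" "\<forall>x\<in>T - {w}. x < w" using fT unfolding w_def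
      by (auto simp: less_le)
    have c: "card (T - {w}) = r" using w(1) T(2) fT by simp
    have "f (insert w (T - {w})) = f (insert s (T - {w}))"
    proof (rule WS(6)[unfolded end_homogeneous_def, rule_format], intro conjI)
      show "\<forall>x\<in>T - {w}. x < w \<and> x < s" using w s T(1) H(1) WS(4) by auto
    qed (use c w s T(1) H(1) in auto)
    also have "\<dots> = b" using H(3) c T(1) by (simp add: subset_iff)
    finally show ?thesis using w(1) by (simp add: insert_absorb)
  qed
  then show "\<exists>H\<subseteq>V. card H = m \<and> (\<exists>b. \<forall>T\<subseteq>H. card T = Suc r \<longrightarrow> f T = b)"
    using H WS(1) by (intro exI[of _ H]) auto
qed

text \<open>The values that \<open>ramsey_bound_Suc\<close> produces from \<open>2 * m\<close> for
  singletons: pairs need \<open>2 ^ (4 * m)\<close>, and this number takes the place of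
  \<open>N\<close> here.\<close>

definition ramsey3 :: "nat \<Rightarrow> nat" where
  "ramsey3 m = 2 ^ ((2 ^ (4 * m) + 1) * 2 ^ (4 * m))"

definition ramsey4 :: "nat \<Rightarrow> nat" where
  "ramsey4 m = 2 ^ ((ramsey3 m ^ 2 + 1) * ramsey3 m)"

lemma ramsey_bound_4: "ramsey_bound 4 m (ramsey4 m)"
proof -
  have "ramsey_bound 2 m (2 ^ (4 * m))"
    using ramsey_bound_Suc[OF ramsey_bound_1[of m]] by (simp flip: numeral_2_eq_2)
  from ramsey_bound_Suc[OF this] have "ramsey_bound 3 m (ramsey3 m)"
    by (simp add: ramsey3_def numeral_3_eq_3)
  from ramsey_bound_Suc[OF this] show ?thesis
    by (simp add: ramsey4_def)
qed

subsection \<open>Monotone subsequences for several orders\<close>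

text \<open>Relative to a set, because the sign of an orientation orders a cluster but not the whole
  space.\<close>

definition strict_order_on :: "'a set \<Rightarrow> ('a \<Rightarrow> 'a \<Rightarrow> bool) \<Rightarrow> bool" where
  "strict_order_on A r \<longleftrightarrow> (\<forall>x\<in>A. \<not> r x x) \<and> (\<forall>x\<in>A. \<forall>y\<in>A. x \<noteq> y \<longrightarrow> r x y \<or> r y x) \<and>
     (\<forall>x\<in>A. \<forall>y\<in>A. \<forall>z\<in>A. r x y \<longrightarrow> r y z \<longrightarrow> r x z)"

lemma strict_order_on_trans:
  assumes "strict_order_on A r" "x \<in> A" "y \<in> A" "z \<in> A" "r x y" "r y z"
  shows "r x z"
  using assms(1)[unfolded strict_order_on_def, THEN conjunct2, THEN conjunct2, rule_format, OF assms(2-6)] .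

lemma strict_order_on_irrefl: "strict_order_on A r \<Longrightarrow> x \<in> A \<Longrightarrow> \<not> r x x"
  unfolding strict_order_on_def by (elim conjE) (rule bspec)

lemma strict_order_on_total:
  assumes "strict_order_on A r" "x \<in> A" "y \<in> A" "x \<noteq> y"
  shows "r x y \<or> r y x"
  using assms(1)[unfolded strict_order_on_def, THEN conjunct2, THEN conjunct1, rule_format, OF assms(2-4)] .

lemma strict_order_on_subset:
  assumes r: "strict_order_on A r" and B: "B \<subseteq> A"
  shows "strict_order_on B r"
  unfolding strict_order_on_def
proof (intro conjI ballI impI)
  show "\<not> r x x" if "x \<in> B" for x using strict_order_on_irrefl[OF r] B that by auto
  show "r x y \<or> r y x" if "x \<in> B" "y \<in> B" "x \<noteq> y" for x y
    using strict_order_on_total[OF r _ _ that(3)] B that by auto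
  show "r x z" if "x \<in> B" "y \<in> B" "z \<in> B" "r x y" "r y z" for x y z
    using strict_order_on_trans[OF r _ _ _ that(4,5)] B that by auto
qed

lemma strict_order_on_asym:
  "strict_order_on A r \<Longrightarrow> x \<in> A \<Longrightarrow> y \<in> A \<Longrightarrow> r x y \<Longrightarrow> \<not> r y x"
  using strict_order_on_trans[of A r x y x] strict_order_on_irrefl[of A r x] by auto

definition same_or_reversed :: "'a set \<Rightarrow> ('a \<Rightarrow> 'a \<Rightarrow> bool) \<Rightarrow> ('a \<Rightarrow> 'a \<Rightarrow> bool) \<Rightarrow> bool" where
  "same_or_reversed Y r s \<longleftrightarrow>
     (\<forall>x\<in>Y. \<forall>y\<in>Y. r x y \<longleftrightarrow> s x y) \<or> (\<forall>x\<in>Y. \<forall>y\<in>Y. r x y \<longleftrightarrow> s y x)"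

lemma same_or_reversed_subset: "same_or_reversed Y r s \<Longrightarrow> Z \<subseteq> Y \<Longrightarrow> same_or_reversed Z r s"
  unfolding same_or_reversed_def subset_iff by auto

text \<open>Each point is labelled with the length of the longest chain ending there on which both
  orders agree. If no label reaches \<open>b\<close>, some label occurs at least \<open>b\<close>
  times, and points with equal labels are ordered oppositely, since otherwise a chain could be
  prolonged beyond its label.\<close>

lemma monotone_subset:
  assumes fin: "finite A" and r: "strict_order_on A r" and s: "strict_order_on A s"
    and card: "b\<^sup>2 \<le> card A"
  shows "\<exists>Y\<subseteq>A. card Y = b \<and> same_or_reversed Y r s"
proof (cases "b = 0")
  case True
  then show ?thesis by (intro exI[of _ "{}"]) (auto simp: same_or_reversed_def)
next
  case b0: False
  define chain where "chain C x \<longleftrightarrow> C \<subseteq> A \<and> x \<in> C \<and> (\<forall>y\<in>C. y = x \<or> r y x) \<and>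
    (\<forall>y\<in>C. \<forall>z\<in>C. r y z \<longleftrightarrow> s y z)" for C x
  define len where "len x = Max (card ` {C. chain C x})" for x
  have fc: "finite {C. chain C x}" for x
    by (rule finite_subset[of _ "Pow A"]) (use fin in \<open>auto simp: chain_def\<close>)
  have single: "chain {x} x" if "x \<in> A" for x
    using that r s unfolding chain_def strict_order_on_def by auto
  have len_ge: "card C \<le> len x" if "chain C x" for C x
    unfolding len_def using fc that by auto
  have len_ex: "\<exists>C. chain C x \<and> card C = len x" if "x \<in> A" for x
  proof -
    have "len x \<in> card ` {C. chain C x}" unfolding len_def
      by (rule Max_in) (use fc single[OF that] in auto)
    then show ?thesis by auto
  qed
  show ?thesis
  proof (cases "\<exists>x\<in>A. b \<le> len x")
    case True
    then obtain x where x: "x \<in> A" "b \<le> len x" by auto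
    then obtain C where C: "chain C x" "card C = len x" using len_ex by auto
    then obtain Y where Y: "Y \<subseteq> C" "card Y = b" using x by (metis obtain_subset_with_card_n)
    have "Y \<subseteq> A" using C Y unfolding chain_def by auto
    moreover have "\<forall>y\<in>C. \<forall>z\<in>C. r y z \<longleftrightarrow> s y z" using C unfolding chain_def by simp
    then have "\<forall>y\<in>Y. \<forall>z\<in>Y. r y z \<longleftrightarrow> s y z" using Y(1) by (meson subsetD)
    ultimately show ?thesis using Y unfolding same_or_reversed_def by auto
  next
    case False
    have ge1: "1 \<le> len x" if "x \<in> A" for x using len_ge[OF single[OF that]] by simp
    have "len ` A \<subseteq> {1..<b}" using False ge1 by (auto simp: not_le)
    moreover have "A \<noteq> {}" using card b0 by auto
    ultimately obtain l where l: "card A \<le> card {x\<in>A. len x = l} * card {1..<b}"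
      using pigeonhole_fibre[of A "{1..<b}" len] fin by auto
    define Z where "Z = {x\<in>A. len x = l}"
    have "b * b \<le> card Z * (b - 1)" using l card unfolding Z_def by (simp add: power2_eq_square)
    also have "\<dots> \<le> card Z * b" by simp
    finally have "b \<le> card Z" using b0 by simp
    then obtain Y where Y: "Y \<subseteq> Z" "card Y = b" by (meson obtain_subset_with_card_n)
    have no: "\<not> s x y" if xy: "x \<in> Y" "y \<in> Y" "r x y" for x y
    proof
      assume "s x y"
      have A: "x \<in> A" "y \<in> A" "len x = l" "len y = l" using xy Y unfolding Z_def by auto
      obtain C where C: "chain C x" "card C = len x" using len_ex[of x] A by auto
      have CA: "C \<subseteq> A" using C unfolding chain_def by auto
      have below: "r z y" "s z y" if "z \<in> C" for z
      proof -
        have "z = x \<or> (r z x \<and> s z x)" using that C(1) unfolding chain_def by metis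
        moreover have "z \<in> A" using that CA by auto
        ultimately show "r z y" "s z y"
          using strict_order_on_trans[OF r, of z x y] strict_order_on_trans[OF s, of z x y]
            A \<open>r x y\<close> \<open>s x y\<close> by auto
      qed
      have yC: "y \<notin> C" using below(1)[of y] r A unfolding strict_order_on_def by auto
      have nb: "\<not> r y z" "\<not> s y z" if "z \<in> C" for z
        using below[OF that] strict_order_on_asym[OF r, of z y] strict_order_on_asym[OF s, of z y]
          A that CA by auto
      have yy: "\<not> r y y" "\<not> s y y" using r s A unfolding strict_order_on_def by auto
      have "\<forall>z\<in>C. \<forall>w\<in>C. r z w \<longleftrightarrow> s z w" using C(1) unfolding chain_def by simp
      then have "chain (insert y C) y" unfolding chain_def
        using CA A below nb yy by auto
      then have "card (insert y C) \<le> l" using len_ge[of "insert y C" y] A by simp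
      moreover have "card (insert y C) = Suc (card C)" using yC finite_subset[OF CA fin] by simp
      ultimately show False using C A by simp
    qed
    have YA: "Y \<subseteq> A" using Y unfolding Z_def by auto
    have "\<forall>x\<in>Y. \<forall>y\<in>Y. r x y \<longleftrightarrow> s y x"
    proof (intro ballI)
      fix x y assume xy: "x \<in> Y" "y \<in> Y"
      show "r x y \<longleftrightarrow> s y x"
      proof (cases "x = y")
        case True
        then show ?thesis using r s xy YA unfolding strict_order_on_def by auto
      next
        case False
        then show ?thesis
          using no[of x y] no[of y x] xy YA strict_order_on_asym[OF r, of x y] strict_order_on_total[OF r, of x y]
            strict_order_on_asym[OF s, of x y] strict_order_on_total[OF s, of x y] by auto
      qed
    qed
    then show ?thesis using Y YA unfolding same_or_reversed_def by auto
  qed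
qed

text \<open>Each list entry costs a square root. Since all orders are compared with the one order
  \<open>r\<close>, any two of them are equal or reverse to each other on \<open>Y\<close>;
  \<open>edges_agree\<close> exploits this.\<close>

lemma monotone_subset_list:
  assumes "finite A" "strict_order_on A r" "\<forall>s\<in>set ss. strict_order_on A s"
    "b ^ (2 ^ length ss) \<le> card A"
  shows "\<exists>Y\<subseteq>A. card Y = b \<and> (\<forall>s\<in>set ss. same_or_reversed Y r s)"
  using assms
proof (induction ss arbitrary: A)
  case Nil
  then show ?case using obtain_subset_with_card_n[of b A] by auto
next
  case (Cons s ss)
  have "(b ^ (2 ^ length ss))\<^sup>2 \<le> card A" using Cons.prems(4)
    by (simp add: power_mult[symmetric] mult.commute)
  then obtain Z where Z: "Z \<subseteq> A" "card Z = b ^ (2 ^ length ss)" "same_or_reversed Z r s"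
    using monotone_subset[of A r s "b ^ (2 ^ length ss)"] Cons.prems(1-3) by fastforce
  obtain Y where "Y \<subseteq> Z" "card Y = b" "\<forall>s\<in>set ss. same_or_reversed Y r s"
    using Cons.IH[of Z] Z Cons.prems strict_order_on_subset[OF _ Z(1)] finite_subset[OF Z(1)]
    by auto
  then show ?case using Z same_or_reversed_subset by (intro exI[of _ Y]) auto
qed

subsection \<open>Selecting the clusters\<close>

text \<open>Induction on \<open>t\<close> in a window of \<open>(k + 1) ^ t\<close> positions,
  keeping goodness towards everything up to \<open>a\<close>. If some \<open>i\<close> is good
  towards \<open>{1..a}\<close> and the next \<open>q - 1\<close> positions, the recursion continues
  right of \<open>i\<close>; the members found there are good towards \<open>{1..i}\<close>, hence
  towards \<open>i\<close>. Otherwise the dichotomy makes each \<open>i\<close> with room for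
  \<open>q\<close> good towards the part of the window on its left and everything from
  \<open>i + q\<close> on, and then \<open>k\<close> positions with spacing \<open>q\<close> already
  form the wanted set.\<close>

lemma select_clusters:
  fixes good :: "nat \<Rightarrow> nat set \<Rightarrow> bool"
  assumes anti: "\<And>i W W'. good i W \<Longrightarrow> W' \<subseteq> W \<Longrightarrow> good i W'"
    and dich: "\<And>a i c. 1 \<le> a \<Longrightarrow> a < i \<Longrightarrow> i < c \<Longrightarrow> c \<le> m \<Longrightarrow>
      good i ({a<..<i} \<union> {c..m}) \<or> good i ({1..a} \<union> {i<..<c})"
    and m: "1 + (k + 1) ^ k \<le> m"
  shows "\<exists>S\<subseteq>{1..m}. card S = k \<and> (\<forall>i\<in>S. good i (S - {i}))"
proof (rule ccontr)
  assume no: "\<not> ?thesis"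
  have "\<exists>S\<subseteq>{a<..<h}. card S = t \<and> (\<forall>i\<in>S. good i ({1..a} \<union> (S - {i})))"
    if "1 \<le> a" "a + (k + 1) ^ t \<le> h" "h \<le> m" for a h t
    using that
  proof (induction t arbitrary: a h)
    case 0
    then show ?case by (intro exI[of _ "{}"]) auto
  next
    case (Suc t)
    define q where "q = (k + 1) ^ t"
    have q: "q \<ge> 1" unfolding q_def by simp
    have h: "a + k * q + q \<le> h" using Suc.prems(2) unfolding q_def by (simp add: algebra_simps)
    have "\<exists>i. a < i \<and> i + q \<le> h \<and> good i ({1..a} \<union> {i<..<i + q})"
    proof (rule ccontr)
      assume none: "\<not> ?thesis"
      have left: "good i ({a<..<i} \<union> {i + q..m})" if "a < i" "i + q \<le> h" for i
        using dich[of a i "i + q"] none that Suc.prems q by auto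
      define S where "S = (\<lambda>r. a + 1 + r * q) ` {..<k}"
      have step: "r * q + q \<le> r' * q" if "r < r'" for r r' :: nat
        using mult_le_mono1[of "Suc r" r' q] that by simp
      have inS: "a + 1 + r * q + q \<le> h" if "r < k" for r
        using step[OF that] h q by linarith
      have "inj_on (\<lambda>r. a + 1 + r * q) {..<k}" using q by (auto simp: inj_on_def)
      then have "card S = k" unfolding S_def by (simp add: card_image)
      moreover have "S \<subseteq> {1..m}" unfolding S_def using inS Suc.prems by fastforce
      moreover have "good i (S - {i})" if "i \<in> S" for i
      proof -
        obtain r where r: "r < k" "i = a + 1 + r * q" using \<open>i \<in> S\<close> unfolding S_def by auto
        have "good i ({a<..<i} \<union> {i + q..m})" using left[of i] inS[of r] r by auto
        moreover have "S - {i} \<subseteq> {a<..<i} \<union> {i + q..m}"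
        proof
          fix j assume j: "j \<in> S - {i}"
          then obtain r' where r': "r' < k" "j = a + 1 + r' * q" unfolding S_def by auto
          have "j \<le> m" using \<open>S \<subseteq> {1..m}\<close> j by auto
          consider "r' < r" | "r < r'" using j r r' by force
          then show "j \<in> {a<..<i} \<union> {i + q..m}"
          proof cases
            case 1
            then show ?thesis using r r' q by auto
          next
            case 2
            then have "r * q + q \<le> r' * q" by (rule step)
            then show ?thesis using r r' \<open>j \<le> m\<close> by auto
          qed
        qed
        ultimately show ?thesis using anti by blast
      qed
      ultimately show False using no by blast
    qed
    then obtain i where i: "a < i" "i + q \<le> h" "good i ({1..a} \<union> {i<..<i + q})" by blast
    obtain S where S: "S \<subseteq> {i<..<i + q}" "card S = t" "\<forall>j\<in>S. good j ({1..i} \<union> (S - {j}))"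
      using Suc.IH[of i "i + q"] i Suc.prems unfolding q_def by auto
    have fS: "finite S" "i \<notin> S" using S(1) finite_subset by auto
    have "good j ({1..a} \<union> (insert i S - {j}))" if "j \<in> insert i S" for j
    proof (cases "j = i")
      case True
      then show ?thesis using S(1) fS(2) unfolding True by (intro anti[OF i(3)]) auto
    next
      case False
      then have "good j ({1..i} \<union> (S - {j}))" using that S by auto
      moreover have "{1..a} \<union> (insert i S - {j}) \<subseteq> {1..i} \<union> (S - {j})"
        using i Suc.prems by auto
      ultimately show ?thesis using anti by blast
    qed
    moreover have "insert i S \<subseteq> {a<..<h}" using i S(1) q by auto
    moreover have "card (insert i S) = Suc t" using fS S by simp
    ultimately show ?case by (intro exI[of _ "insert i S"]) auto
  qed
  \<comment> \<open>The start \<open>a = 1\<close> gives up position 1, because \<open>dich\<close>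
    demands \<open>1 \<le> a\<close>; this is the summand 1 in the bound.\<close>
  from this[of 1 k m] m obtain S where S: "S \<subseteq> {1<..<m}" "card S = k"
    "\<forall>i\<in>S. good i ({1..1} \<union> (S - {i}))" by auto
  then have "\<forall>i\<in>S. good i (S - {i})" using anti by blast
  moreover have "S \<subseteq> {1..m}" using S(1) by auto
  ultimately show False using no S(2) by blast
qed

subsection \<open>Cups and caps\<close>

text \<open>Only consecutive triples occur, so that a list can be extended at either end by looking
  at one new triple; with \<open>p\<close> negated the same notion describes cups.\<close>

definition cap :: "('a \<Rightarrow> 'a \<Rightarrow> bool) \<Rightarrow> ('a \<Rightarrow> 'a \<Rightarrow> 'a \<Rightarrow> bool) \<Rightarrow> 'a list \<Rightarrow> bool" where
  "cap r p xs \<longleftrightarrow> sorted_wrt r xs \<and> (\<forall>i. i + 2 < length xs \<longrightarrow> p (xs ! i) (xs ! (i + 1)) (xs ! (i + 2)))"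

lemma cap_Cons:
  assumes "cap r p (y # z # xs)" "r x y" "p x y z" "\<forall>w\<in>set (z # xs). r x w"
  shows "cap r p (x # y # z # xs)"
  unfolding cap_def
proof (intro conjI allI impI)
  show "sorted_wrt r (x # y # z # xs)" using assms unfolding cap_def by auto
  fix i assume "i + 2 < length (x # y # z # xs)"
  then show "p ((x # y # z # xs) ! i) ((x # y # z # xs) ! (i + 1)) ((x # y # z # xs) ! (i + 2))"
    using assms(1,3) unfolding cap_def by (cases i) auto
qed

lemma cap_tl: "cap r p (x # xs) \<Longrightarrow> cap r p xs"
  unfolding cap_def by fastforce

lemma cap_snoc:
  assumes "cap r p (xs @ [x, y])" "p x y z" "\<forall>w\<in>set (xs @ [x, y]). r w z"
  shows "cap r p (xs @ [x, y, z])"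
  unfolding cap_def
proof (intro conjI allI impI)
  show "sorted_wrt r (xs @ [x, y, z])" using assms unfolding cap_def by (auto simp: sorted_wrt_append)
  fix i assume i: "i + 2 < length (xs @ [x, y, z])"
  have e: "xs @ [x, y, z] = (xs @ [x, y]) @ [z]" by simp
  show "p ((xs @ [x, y, z]) ! i) ((xs @ [x, y, z]) ! (i + 1)) ((xs @ [x, y, z]) ! (i + 2))"
  proof (cases "i = length xs")
    case True
    then show ?thesis using assms(2) by (simp add: nth_append)
  next
    case False
    then have "i + 2 < length (xs @ [x, y])" using i by simp
    moreover from this have "p ((xs @ [x, y]) ! i) ((xs @ [x, y]) ! (i + 1)) ((xs @ [x, y]) ! (i + 2))"
      using assms(1) unfolding cap_def by blast
    ultimately show ?thesis unfolding e by (simp add: nth_append del: append_assoc)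
  qed
qed

lemma sorted_list_exists:
  assumes "finite A" "strict_order_on A r"
  shows "\<exists>xs. set xs = A \<and> sorted_wrt r xs \<and> length xs = card A"
  using assms
proof (induction "card A" arbitrary: A)
  case 0
  then show ?case by (intro exI[of _ "[]"]) auto
next
  case (Suc n)
  have "\<exists>x\<in>A. \<forall>y\<in>A - {x}. r x y"
  proof -
    have "\<exists>x\<in>B. \<forall>y\<in>B - {x}. r x y" if "finite B" "B \<noteq> {}" "B \<subseteq> A" for B
      using that
    proof (induction rule: finite_ne_induct)
      case (insert b B)
      then obtain x where x: "x \<in> B" "\<forall>y\<in>B - {x}. r x y" by auto
      have xA: "x \<in> A" "b \<in> A" "x \<noteq> b" using x insert by auto
      then consider "r x b" | "r b x" using Suc.prems(2) unfolding strict_order_on_def by blast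
      then show ?case
      proof cases
        case 1
        then show ?thesis using x by (intro bexI[of _ x]) auto
      next
        case 2
        have "r b y" if "y \<in> B" for y
        proof (cases "y = x")
          case False
          then have "r x y" using x that by auto
          then show ?thesis
            using strict_order_on_trans[OF Suc.prems(2) xA(2,1), of y] 2 that insert.prems by auto
        qed (use 2 in simp)
        then show ?thesis by (intro bexI[of _ b]) auto
      qed
    qed auto
    then show ?thesis using Suc.prems Suc.hyps(2) by fastforce
  qed
  then obtain x where x: "x \<in> A" "\<forall>y\<in>A - {x}. r x y" by auto
  have "n = card (A - {x})" using Suc.hyps(2) x(1) Suc.prems by simp
  then obtain xs where xs: "set xs = A - {x}" "sorted_wrt r xs" "length xs = card (A - {x})"
    using Suc.hyps(1)[of "A - {x}"] Suc.prems strict_order_on_subset[OF Suc.prems(2), of "A - {x}"] by auto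
  then show ?case using x Suc.hyps(2) \<open>n = card (A - {x})\<close>
    by (intro exI[of _ "x # xs"]) auto
qed

text \<open>\<open>H\<close> collects the left ends of caps with \<open>p - 1\<close> points, so its
  complement contains no such cap. A cup in \<open>H\<close> with \<open>q - 1\<close> points ends
  at a point \<open>y\<close> where a cap with \<open>p - 1\<close> points starts, and the triple
  around \<open>y\<close> prolongs one of the two. Pascal's rule matches the two cases.\<close>

lemma cups_caps:
  assumes "finite A" "strict_order_on A r" "(p + q) choose p \<le> card A"
  shows "(\<exists>xs. set xs \<subseteq> A \<and> length xs = p \<and> cap r P xs) \<or>
         (\<exists>xs. set xs \<subseteq> A \<and> length xs = q \<and> cap r (\<lambda>x y z. \<not> P x y z) xs)"
  using assms
proof (induction "p + q" arbitrary: p q A)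
  case 0
  then show ?case by (auto simp: cap_def)
next
  case (Suc s)
  let ?cap = "\<lambda>l A. \<exists>xs. set xs \<subseteq> A \<and> length xs = l \<and> cap r P xs"
  let ?cup = "\<lambda>l A. \<exists>xs. set xs \<subseteq> A \<and> length xs = l \<and> cap r (\<lambda>x y z. \<not> P x y z) xs"
  \<comment> \<open>Lists with at most two entries are caps vacuously; they settle the cases in
    which there is no triple to inspect.\<close>
  have short: "\<exists>xs. set xs \<subseteq> A \<and> length xs = l \<and> cap r Q xs" if "l \<le> 2" "l \<le> card A" for l Q
  proof -
    obtain B where B: "B \<subseteq> A" "card B = l" using \<open>l \<le> card A\<close> by (meson obtain_subset_with_card_n)
    then obtain xs where "set xs = B" "sorted_wrt r xs" "length xs = card B"
      using sorted_list_exists[of B r] Suc.prems strict_order_on_subset[OF Suc.prems(2)] finite_subset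
      by (metis (no_types, lifting))
    then show ?thesis using B \<open>l \<le> 2\<close> unfolding cap_def by (intro exI[of _ xs]) auto
  qed
  have ge: "p + 1 \<le> (p + q) choose p" if "q \<ge> 1"
  proof -
    have "(p + 1) choose p \<le> (p + q) choose p" using that by (intro binomial_right_mono) auto
    then show ?thesis by simp
  qed
  have ge': "q + 1 \<le> (p + q) choose p" if "p \<ge> 1"
  proof -
    have "(q + 1) choose q \<le> (p + q) choose q" using that by (intro binomial_right_mono) auto
    moreover have "(p + q) choose q = (p + q) choose p" using binomial_symmetric[of q "p + q"] by simp
    ultimately show ?thesis by simp
  qed
  consider "p = 0" | "q = 0" | "p \<le> 2" "q \<ge> 1" | "q \<le> 2" "p \<ge> 1" | "p \<ge> 3" "q \<ge> 3" by linarith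
  then show ?case
  proof cases
    case 1 then show ?thesis using short[of 0] by auto
  next
    case 2 then show ?thesis using short[of 0] by auto
  next
    case 3 then show ?thesis using short[of p P] ge Suc.prems by auto
  next
    case 4 then show ?thesis using short[of q] ge' Suc.prems by auto
  next
    case 5
    define H where "H = {y\<in>A. \<exists>xs. set (y # xs) \<subseteq> A \<and> length (y # xs) = p - 1 \<and> cap r P (y # xs)}"
    have HA: "H \<subseteq> A" unfolding H_def by auto
    obtain p' where p': "p = Suc p'" using 5 by (cases p) auto
    obtain q' where q': "q = Suc q'" using 5 by (cases q) auto
    have "(p + q) choose p = ((p' + q) choose p') + ((p + q') choose p)"
      unfolding p' q' by simp
    moreover have "card A = card (A - H) + card H" using card_Diff_subset[of H A] HA Suc.prems(1)
      by (simp add: card_mono finite_subset)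
    ultimately consider "(p' + q) choose p' \<le> card (A - H)" | "(p + q') choose p \<le> card H"
      using Suc.prems(3) by linarith
    then show ?thesis
    proof cases
      case 1
      then have "?cap p' (A - H) \<or> ?cup q (A - H)"
        using Suc.hyps(1)[of p' q "A - H"] Suc.hyps(2) Suc.prems p'
          strict_order_on_subset[OF Suc.prems(2), of "A - H"] by auto
      moreover have "\<not> ?cap p' (A - H)"
      proof
        assume "?cap p' (A - H)"
        then obtain xs where xs: "set xs \<subseteq> A - H" "length xs = p'" "cap r P xs" by blast
        then obtain y ys where y: "xs = y # ys" using 5 p' by (cases xs) auto
        have "y \<in> H" unfolding H_def using xs p' unfolding y by auto
        then show False using xs(1) unfolding y by auto
      qed
      ultimately show ?thesis by blast
    next
      case 2
      then consider "?cap p H" | "?cup q' H"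
        using Suc.hyps(1)[of p q' H] Suc.hyps(2) Suc.prems q' finite_subset[OF HA]
          strict_order_on_subset[OF Suc.prems(2) HA] by auto
      then show ?thesis
      proof cases
        case 1 then show ?thesis using HA by blast
      next
        case 2
        then obtain ys where ys: "set ys \<subseteq> H" "length ys = q'" "cap r (\<lambda>x y z. \<not> P x y z) ys" by blast
        define zs where "zs = butlast (butlast ys)"
        obtain x y where e: "ys = zs @ [x, y]"
        proof -
          have n: "ys \<noteq> []" "butlast ys \<noteq> []" using ys(2) 5 q' by (auto simp flip: length_0_conv)
          have "ys = butlast (butlast ys) @ [last (butlast ys), last ys]"
            using append_butlast_last_id[OF n(1)] append_butlast_last_id[OF n(2)]
            by (metis append.assoc append_Cons append_Nil)
          then show ?thesis using that unfolding zs_def by blast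
        qed
        have "y \<in> H" using ys(1) e by auto
        then obtain ws where ws: "set (y # ws) \<subseteq> A" "length (y # ws) = p - 1" "cap r P (y # ws)"
          unfolding H_def by auto
        then obtain z vs where z: "ws = z # vs" using 5 by (cases ws) auto
        have inA: "x \<in> A" "y \<in> A" "z \<in> A" "set zs \<subseteq> A" "set vs \<subseteq> A" using ys(1) ws(1) HA e z by auto
        have r1: "r x y" "\<forall>w\<in>set zs. r w x \<and> r w y" using ys(3) unfolding e cap_def
          by (auto simp: sorted_wrt_append)
        have r2: "r y z" "\<forall>w\<in>set vs. r y w" using ws(3) unfolding z cap_def by auto
        show ?thesis
        proof (cases "P x y z")
          case True
          have "\<forall>w\<in>set (z # vs). r x w"
            using strict_order_on_trans[OF Suc.prems(2) inA(1,2)] r1 r2 inA by auto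
          then have "cap r P (x # y # z # vs)" using cap_Cons[of r P y z vs x] ws(3) r1 True
            unfolding z by auto
          then show ?thesis using ws inA z 5 by (intro disjI1 exI[of _ "x # y # z # vs"]) auto
        next
          case False
          have "\<forall>w\<in>set (zs @ [x, y]). r w z"
            using strict_order_on_trans[OF Suc.prems(2) _ inA(2,3)] r1 r2 inA by auto
          then have "cap r (\<lambda>x y z. \<not> P x y z) (zs @ [x, y, z])"
            using cap_snoc[of r "\<lambda>x y z. \<not> P x y z" zs x y z] ys(3) False unfolding e by auto
          then show ?thesis using ys e inA q' HA by (intro disjI2 exI[of _ "zs @ [x, y, z]"]) auto
        qed
      qed
    qed
  qed
qed

text \<open>The four-point condition \<open>trans\<close> moves the last or the middle point of a
  triple further along the list. For triples starting at the head, \<open>first\<close> moves the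
  last point and \<open>any\<close> then the middle one.\<close>

lemma cap_all_triples:
  assumes "cap r p xs" "set xs \<subseteq> A"
    and trans: "\<And>x y z w. {x, y, z, w} \<subseteq> A \<Longrightarrow> r x y \<Longrightarrow> r y z \<Longrightarrow> r z w \<Longrightarrow>
      p x y z \<Longrightarrow> p y z w \<Longrightarrow> p x y w \<and> p x z w"
    and ijk: "i < j" "j < k" "k < length xs"
  shows "p (xs ! i) (xs ! j) (xs ! k)"
  using assms(1,2) ijk
proof (induction xs arbitrary: i j k)
  case (Cons x xs)
  have tl: "cap r p xs" "set xs \<subseteq> A" using Cons.prems cap_tl by auto
  have IH: "p (xs ! i) (xs ! j) (xs ! k)" if "i < j" "j < k" "k < length xs" for i j k
    using Cons.IH[OF tl that] .
  have r: "r (xs ! i) (xs ! j)" if "i < j" "j < length xs" for i j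
    using tl(1) that sorted_wrt_nth_less unfolding cap_def by fastforce
  have mem: "x \<in> A" "j < length xs \<Longrightarrow> xs ! j \<in> A" for j
    using Cons.prems(2) nth_mem by auto
  have rx: "r x (xs ! j)" if "j < length xs" for j
    using Cons.prems(1) that unfolding cap_def by auto
  have first: "p x (xs ! 0) (xs ! k)" if k: "0 < k" "k < length xs" for k
  proof -
    have l0: "0 < length xs" using k by linarith
    have "p x (xs ! 0) (xs ! 1)"
      using Cons.prems(1) k unfolding cap_def by (auto dest!: spec[of _ 0])
    show ?thesis
    proof (cases "k = 1")
      case False
      then show ?thesis
        using trans[of x "xs ! 0" "xs ! 1" "xs ! k"] IH[of 0 1 k] k \<open>p x (xs ! 0) (xs ! 1)\<close>
          r[of 0 1] r[of 1 k] rx[OF l0] mem(1) mem(2)[OF l0] mem(2)[of 1] mem(2)[of k] by simp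
    qed (use \<open>p x (xs ! 0) (xs ! 1)\<close> in simp)
  qed
  have any: "p x (xs ! j) (xs ! k)" if jk: "j < k" "k < length xs" for j k
  proof (cases "j = 0")
    case False
    have l0: "0 < length xs" using jk by linarith
    from False show ?thesis
      using trans[of x "xs ! 0" "xs ! j" "xs ! k"] IH[of 0 j k] jk first[of j]
        r[of 0 j] r[of j k] rx[OF l0] mem(1) mem(2)[OF l0] mem(2)[of j] mem(2)[of k] by simp
  qed (use first[of k] jk in simp)
  show ?case
  proof (cases i)
    case 0
    then show ?thesis using any[of "j - 1" "k - 1"] Cons.prems by (simp add: nth_Cons')
  next
    case (Suc i')
    then show ?thesis using IH[of i' "j - 1" "k - 1"] Cons.prems by (auto simp: nth_Cons')
  qed
qed simp

subsection \<open>Orientations of quadruples in space\<close>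

type_synonym r3 = "real \<times> real \<times> real"

fun det3 :: "r3 \<Rightarrow> r3 \<Rightarrow> r3 \<Rightarrow> real" where
  "det3 (a, b, c) (d, e, f) (g, h, i) = a * (e * i - f * h) - b * (d * i - f * g) + c * (d * h - e * g)"

text \<open>The three-term Grassmann-Pluecker relation. The sign deductions below rest on it and on
  Cramer's rule in the form \<open>det3_cramer\<close>.\<close>

lemma det3_three_term:
  "det3 b x y * det3 b c e = det3 b x c * det3 b y e + det3 b x e * det3 b c y"
  by (cases b; cases x; cases y; cases c; cases e; simp only: det3.simps diff_Pair add_Pair scaleR_Pair real_scaleR_def; simp add: algebra_simps)

lemma det3_linear:
  "det3 g h (u *\<^sub>R a + v *\<^sub>R b + w *\<^sub>R c) = u * det3 g h a + v * det3 g h b + w * det3 g h c"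
  by (cases g; cases h; cases a; cases b; cases c;
      simp only: det3.simps add_Pair scaleR_Pair real_scaleR_def; simp add: algebra_simps)

lemma det3_cramer_vector:
  "det3 a b c *\<^sub>R y = det3 y b c *\<^sub>R a + det3 y c a *\<^sub>R b + det3 y a b *\<^sub>R c"
  by (cases y; cases a; cases b; cases c;
      simp only: det3.simps add_Pair scaleR_Pair real_scaleR_def prod.inject; simp add: algebra_simps)

lemma det3_cramer:
  "det3 g h y * det3 a b c = det3 y b c * det3 g h a + det3 y c a * det3 g h b + det3 y a b * det3 g h c"
  using det3_linear[of g h "det3 y b c" a "det3 y c a" b "det3 y a b" c]
    det3_linear[of g h "det3 a b c" y 0 y 0 y]
  unfolding det3_cramer_vector[symmetric] by (simp add: mult.commute)

text \<open>The sign \<open>s\<close> takes care of the mirror image of a configuration.\<close>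

definition orient :: "real \<Rightarrow> r3 \<Rightarrow> r3 \<Rightarrow> r3 \<Rightarrow> r3 \<Rightarrow> real" where
  "orient s a b c d = s * det3 (b - a) (c - a) (d - a)"

lemma orient_swap:
  "orient s b a c d = - orient s a b c d" "orient s a c b d = - orient s a b c d" "orient s a b d c = - orient s a b c d"
  unfolding orient_def by (cases a; cases b; cases c; cases d; simp only: det3.simps diff_Pair add_Pair scaleR_Pair real_scaleR_def; simp add: algebra_simps)+

lemma orient_three_term:
  "orient s a b x y * orient s a b c e = orient s a b x c * orient s a b y e + orient s a b x e * orient s a b c y"
  using det3_three_term[of "b - a" "x - a" "y - a" "c - a" "e - a"]
  unfolding orient_def by algebra

lemma orient_cramer:
  "orient s x g h y * orient s x a b c =
     orient s x y b c * orient s x g h a + orient s x y c a * orient s x g h b + orient s x y a b * orient s x g h c"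
  using det3_cramer[of "g - x" "h - x" "y - x" "a - x" "b - x" "c - x"]
  unfolding orient_def by algebra

lemma orient_affine: "u + v = 1 \<Longrightarrow> orient s a b c (u *\<^sub>R x + v *\<^sub>R y) = u * orient s a b c x + v * orient s a b c y"
proof -
  assume "u + v = 1"
  then have v: "v = 1 - u" by simp
  show ?thesis unfolding orient_def v
    by (cases a; cases b; cases c; cases x; cases y; simp only: det3.simps diff_Pair add_Pair scaleR_Pair real_scaleR_def; simp add: algebra_simps)
qed

lemma orient_same: "orient s a b c a = 0" "orient s a b c b = 0" "orient s a b c c = 0"
  unfolding orient_def by (cases a; cases b; cases c; simp only: det3.simps diff_Pair add_Pair scaleR_Pair real_scaleR_def; simp add: algebra_simps)+

text \<open>The plane through \<open>c\<close>, \<open>x\<close>, \<open>y\<close> supports \<open>U\<close> and meets it at most in \<open>x\<close> and \<open>y\<close>; the point \<open>c\<close> need not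
  belong to \<open>U\<close>.\<close>

lemma not_in_hull_of_rest:
  assumes "x \<noteq> y" "\<And>u. u \<in> U - {x, y} \<Longrightarrow> 0 < orient s c x y u"
  shows "x \<notin> convex hull (U - {x})" "y \<notin> convex hull (U - {y})"
proof -
  \<comment> \<open>An open half-space with one boundary point \<open>w\<close> added: it is convex,
    and for \<open>w = y\<close> it contains \<open>U - {x}\<close> but not
    \<open>x\<close>.\<close>
  define V where "V w = insert w {u. 0 < orient s c x y u}" for w
  have pos: "0 < orient s c x y (u *\<^sub>R p + v *\<^sub>R q)"
    if "0 \<le> orient s c x y p" "0 \<le> orient s c x y q" "0 \<le> u" "0 \<le> v" "u + v = 1"
      "(0 < u \<and> 0 < orient s c x y p) \<or> (0 < v \<and> 0 < orient s c x y q)" for p q u v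
    unfolding orient_affine[OF that(5)]
    using that by (auto intro: add_pos_nonneg add_nonneg_pos)
  have conv: "convex (V w)" if w: "orient s c x y w = 0" for w
    unfolding convex_def
  proof (intro ballI allI impI)
    fix p q and u v :: real
    assume pq: "p \<in> V w" "q \<in> V w" and uv: "0 \<le> u" "0 \<le> v" "u + v = 1"
    have nn: "0 \<le> orient s c x y p" "0 \<le> orient s c x y q" using pq w unfolding V_def by auto
    show "u *\<^sub>R p + v *\<^sub>R q \<in> V w"
    proof (cases "(0 < u \<and> 0 < orient s c x y p) \<or> (0 < v \<and> 0 < orient s c x y q)")
      case True
      then show ?thesis using pos[OF nn uv] unfolding V_def by auto
    next
      case False
      then consider "u = 0" "q = w" | "v = 0" "p = w" | "p = w" "q = w"
        using pq uv unfolding V_def by force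
      then show ?thesis
      proof cases
        case 1 then show ?thesis using uv unfolding V_def by auto
      next
        case 2 then show ?thesis using uv unfolding V_def by auto
      next
        case 3 then show ?thesis using uv scaleR_left_distrib[of u v w] unfolding V_def by auto
      qed
    qed
  qed
  have "convex hull (U - {x}) \<subseteq> V y"
    by (intro hull_minimal conv) (use assms(2) in \<open>auto simp: V_def orient_same\<close>)
  then show "x \<notin> convex hull (U - {x})" using assms(1) unfolding V_def by (auto simp: orient_same)
  have "convex hull (U - {y}) \<subseteq> V x"
    by (intro hull_minimal conv) (use assms(2) in \<open>auto simp: V_def orient_same\<close>)
  then show "y \<notin> convex hull (U - {y})" using assms(1) unfolding V_def by (auto simp: orient_same)
qed

subsection \<open>Alternating sequences of points\<close>

definition alternating :: "real \<Rightarrow> (nat \<Rightarrow> r3) \<Rightarrow> nat set \<Rightarrow> bool" where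
  "alternating s z I \<longleftrightarrow> (\<forall>i\<in>I. \<forall>j\<in>I. \<forall>k\<in>I. \<forall>l\<in>I. i < j \<longrightarrow> j < k \<longrightarrow> k < l \<longrightarrow>
     0 < orient s (z i) (z j) (z k) (z l))"

lemma alternatingD:
  "alternating s z I \<Longrightarrow> i \<in> I \<Longrightarrow> j \<in> I \<Longrightarrow> k \<in> I \<Longrightarrow> l \<in> I \<Longrightarrow> i < j \<Longrightarrow> j < k \<Longrightarrow> k < l \<Longrightarrow>
     0 < orient s (z i) (z j) (z k) (z l)"
  unfolding alternating_def by blast

lemma alternating_subset: "alternating s z I \<Longrightarrow> J \<subseteq> I \<Longrightarrow> alternating s z J"
  unfolding alternating_def by (simp add: subset_iff)

text \<open>The contribution of position \<open>u\<close> to the sign of the permutation that moves \<open>a < b\<close> to the front.\<close>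

definition front_sign :: "nat \<Rightarrow> nat \<Rightarrow> nat \<Rightarrow> real" where
  "front_sign a b u = (if a < u \<and> u < b then -1 else 1)"

lemma orient_perms:
  "orient s x y a b = orient s a b x y" "orient s a x b y = - orient s a b x y" "orient s a x y b = orient s a b x y"
  "orient s x a b y = orient s a b x y" "orient s x a y b = - orient s a b x y"
  unfolding orient_def by (cases a; cases b; cases x; cases y; simp only: det3.simps diff_Pair add_Pair scaleR_Pair real_scaleR_def; simp add: algebra_simps)+

lemma alternating_four:
  assumes "i < j" "j < k" "k < l"
  shows "alternating s z {i, j, k, l} \<longleftrightarrow> 0 < orient s (z i) (z j) (z k) (z l)"
proof
  assume pos: "0 < orient s (z i) (z j) (z k) (z l)"
  show "alternating s z {i, j, k, l}" unfolding alternating_def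
  proof (intro ballI impI)
    fix a b c d assume el: "a \<in> {i, j, k, l}" "b \<in> {i, j, k, l}" "c \<in> {i, j, k, l}" "d \<in> {i, j, k, l}"
      and lt: "a < b" "b < c" "c < d"
    have "i \<le> a" using el(1) assms by auto
    then have "j \<le> b" using el(2) lt assms by auto
    then have "k \<le> c" using el(3) lt assms by auto
    then have "d = l" using el(4) lt assms by auto
    then have "c = k" using el(3) lt assms \<open>k \<le> c\<close> by auto
    then have "b = j" using el(2) lt assms \<open>j \<le> b\<close> by auto
    then have "a = i" using el(1) lt assms by auto
    show "0 < orient s (z a) (z b) (z c) (z d)"
      using pos \<open>a = i\<close> \<open>b = j\<close> \<open>c = k\<close> \<open>d = l\<close> by simp
  qed
qed (use assms in \<open>simp add: alternating_def\<close>)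

lemma front_sign_iff:
  assumes "a < b" "u < v" "u \<noteq> a" "u \<noteq> b" "v \<noteq> a" "v \<noteq> b" "I = {a, b, u, v}"
  shows "alternating s z I \<longleftrightarrow>
    0 < front_sign a b u * front_sign a b v * orient s (z a) (z b) (z u) (z v)"
proof -
  consider "v < a" | "u < a" "a < v" "v < b" | "u < a" "b < v" | "a < u" "v < b"
    | "a < u" "u < b" "b < v" | "b < u" using assms by linarith
  then show ?thesis
  proof cases
    case 1
    have e: "I = {u, v, a, b}" by (simp add: assms(7) insert_commute)
    show ?thesis unfolding e using alternating_four[of u v a b] 1 assms by (simp add: front_sign_def orient_perms(1)[of s "z u" "z v" "z a" "z b"])
  next
    case 2
    have e: "I = {u, a, v, b}" by (simp add: assms(7) insert_commute)
    show ?thesis unfolding e using alternating_four[of u a v b] 2 assms by (simp add: front_sign_def orient_perms(5)[of s "z u" "z a" "z v" "z b"])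
  next
    case 3
    have e: "I = {u, a, b, v}" by (simp add: assms(7) insert_commute)
    show ?thesis unfolding e using alternating_four[of u a b v] 3 assms by (simp add: front_sign_def orient_perms(4)[of s "z u" "z a" "z b" "z v"])
  next
    case 4
    have e: "I = {a, u, v, b}" by (simp add: assms(7) insert_commute)
    show ?thesis unfolding e using alternating_four[of a u v b] 4 assms by (simp add: front_sign_def orient_perms(3)[of s "z a" "z u" "z v" "z b"])
  next
    case 5
    have e: "I = {a, u, b, v}" by (simp add: assms(7) insert_commute)
    show ?thesis unfolding e using alternating_four[of a u b v] 5 assms by (simp add: front_sign_def orient_perms(2)[of s "z a" "z u" "z b" "z v"])
  next
    case 6
    show ?thesis unfolding assms(7) using alternating_four[of a b u v] 6 assms by (simp add: front_sign_def)
  qed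
qed

text \<open>The three-term Grassmann-Pluecker relation determines the orientation of \<open>z a\<close>, \<open>z b\<close>, \<open>z p\<close>, \<open>z q\<close>
  from a point between \<open>p\<close> and \<open>q\<close> and a point after \<open>q\<close>.\<close>

lemma alternating_merge:
  assumes alt: "alternating s z (I - {p})" "alternating s z (I - {q})"
    and pq: "p \<in> I" "q \<in> I" "p < q"
    and mid: "\<And>a b. \<exists>c\<in>I - {a, b}. p < c \<and> c < q"
    and after: "\<And>a b. \<exists>e\<in>I - {a, b}. q < e"
  shows "alternating s z I"
proof -
  have main: "alternating s z {a, b, p, q}" if ab: "a \<in> I" "b \<in> I" "a < b" "{a, b} \<inter> {p, q} = {}" for a b
  proof -
    obtain c where c: "c \<in> I" "c \<noteq> a" "c \<noteq> b" "p < c" "c < q" using mid[of a b] by auto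
    obtain e where e: "e \<in> I" "e \<noteq> a" "e \<noteq> b" "q < e" using after[of a b] by auto
    \<comment> \<open>The orientation corrected by the sign of moving \<open>a\<close> and
      \<open>b\<close> to the front, so that alternating means positive. Among the six values in the
      relation below only \<open>F p q\<close> involves both \<open>p\<close> and \<open>q\<close>;
      the other five are known to be positive.\<close>
    define F where "F u v = front_sign a b u * front_sign a b v * orient s (z a) (z b) (z u) (z v)" for u v
    have F: "0 < F u v" if "u \<in> I" "v \<in> I" "u < v" "u \<noteq> a" "u \<noteq> b" "v \<noteq> a" "v \<noteq> b"
      "p \<notin> {u, v} \<or> q \<notin> {u, v}" for u v
    proof -
      have "alternating s z {a, b, u, v}"
      proof (cases "p \<in> {u, v}")
        case True
        then show ?thesis using that ab by (intro alternating_subset[OF alt(2)]) auto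
      next
        case False
        then show ?thesis using that ab by (intro alternating_subset[OF alt(1)]) auto
      qed
      then show ?thesis unfolding F_def using front_sign_iff[of a b u v "{a, b, u, v}" s z] that ab by auto
    qed
    have sq: "front_sign a b x * front_sign a b x = 1" for x unfolding front_sign_def by auto
    have "F p q * F c e = F p c * F q e + F p e * F c q"
      unfolding F_def using orient_three_term[of s "z a" "z b" "z p" "z q" "z c" "z e"] by algebra
    moreover have "0 < F c e" "0 < F p c" "0 < F q e" "0 < F p e" "0 < F c q"
      using F c e pq ab by auto
    ultimately have "0 < F p q * F c e" by (simp add: add_pos_pos)
    then have "0 < F p q" using \<open>0 < F c e\<close> by (simp add: zero_less_mult_iff)
    then show ?thesis unfolding F_def using front_sign_iff[of a b p q "{a, b, p, q}" s z] pq ab by auto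
  qed
  show ?thesis unfolding alternating_def
  proof (intro ballI impI)
    fix i j k l assume I: "i \<in> I" "j \<in> I" "k \<in> I" "l \<in> I" and lt: "i < j" "j < k" "k < l"
    show "0 < orient s (z i) (z j) (z k) (z l)"
    proof (cases "{p, q} \<subseteq> {i, j, k, l}")
      case False
      then consider "{i, j, k, l} \<subseteq> I - {p}" | "{i, j, k, l} \<subseteq> I - {q}" using I by auto
      then show ?thesis
        using alternatingD[OF alt(1), of i j k l] alternatingD[OF alt(2), of i j k l] lt by auto
    next
      case True
      have "\<exists>a b. a < b \<and> {a, b} \<inter> {p, q} = {} \<and> {i, j, k, l} = {a, b, p, q}"
      proof -
        consider "p = i" "q = j" | "p = i" "q = k" | "p = i" "q = l" | "p = j" "q = k" | "p = j" "q = l"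
          | "p = k" "q = l" using True pq(3) lt by auto
        then show ?thesis
        proof cases
          case 1 then show ?thesis using lt by (intro exI[of _ k] exI[of _ l]) auto
        next
          case 2 then show ?thesis using lt by (intro exI[of _ j] exI[of _ l]) auto
        next
          case 3 then show ?thesis using lt by (intro exI[of _ j] exI[of _ k]) auto
        next
          case 4 then show ?thesis using lt by (intro exI[of _ i] exI[of _ l]) auto
        next
          case 5 then show ?thesis using lt by (intro exI[of _ i] exI[of _ k]) auto
        next
          case 6 then show ?thesis using lt by (intro exI[of _ i] exI[of _ j]) auto
        qed
      qed
      then obtain a b where ab: "a < b" "{a, b} \<inter> {p, q} = {}" "{i, j, k, l} = {a, b, p, q}" by blast
      then have "{a, b, p, q} \<subseteq> I" using I by (metis empty_subsetI insert_subset)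
      then have "alternating s z {i, j, k, l}" using main[of a b] ab by auto
      then show ?thesis using alternating_four lt by auto
    qed
  qed
qed

subsection \<open>Clusters in alternating position\<close>

text \<open>If the edges of a quadrilateral cone with apex \<open>x\<close> see the direction from \<open>x\<close> to \<open>y\<close> on the same
  side, then this direction or its opposite lies inside the cone.\<close>

lemma polygon_inside:
  assumes t: "0 < t * orient s x y a b" "0 < t * orient s x y b d" "0 < t * orient s x y d c" "0 < t * orient s x y c a"
    and tri: "0 < orient s x a b c" "0 < orient s x b d c"
    and r: "0 < r * orient s x g h a" "0 < r * orient s x g h b" "0 < r * orient s x g h c" "0 < r * orient s x g h d"
  shows "0 < t * r * orient s x g h y"
\<comment> \<open>The diagonal \<open>b c\<close> cuts the quadrilateral \<open>a b d c\<close> into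
  two triangles. Its sign tells which of them the line through \<open>x\<close> and \<open>y\<close>
  hits, and Cramer's rule over that triangle has nonnegative weights.\<close>
proof (cases "0 \<le> t * orient s x y b c")
  case True
  have "t * r * orient s x g h y * orient s x a b c =
    (t * orient s x y b c) * (r * orient s x g h a) + (t * orient s x y c a) * (r * orient s x g h b) + (t * orient s x y a b) * (r * orient s x g h c)"
    using orient_cramer[of s x g h y a b c] by algebra
  moreover have "0 \<le> (t * orient s x y b c) * (r * orient s x g h a)" using True r by simp
  moreover have "0 < (t * orient s x y c a) * (r * orient s x g h b)" "0 < (t * orient s x y a b) * (r * orient s x g h c)"
    using t r by simp_all
  ultimately have "0 < t * r * orient s x g h y * orient s x a b c" by linarith
  then show ?thesis using tri(1) by (simp add: zero_less_mult_iff)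
next
  case False
  have cb: "0 \<le> t * orient s x y c b" using False orient_swap(3)[of s x y b c] by simp
  have "t * r * orient s x g h y * orient s x b d c =
    (t * orient s x y d c) * (r * orient s x g h b) + (t * orient s x y c b) * (r * orient s x g h d) + (t * orient s x y b d) * (r * orient s x g h c)"
    using orient_cramer[of s x g h y b d c] by algebra
  moreover have "0 \<le> (t * orient s x y c b) * (r * orient s x g h d)" using cb r by simp
  moreover have "0 < (t * orient s x y d c) * (r * orient s x g h b)" "0 < (t * orient s x y b d) * (r * orient s x g h c)"
    using t r by simp_all
  ultimately have "0 < t * r * orient s x g h y * orient s x b d c" by linarith
  then show ?thesis using tri(2) by (simp add: zero_less_mult_iff)
qed

text \<open>The last two hypotheses say that, modulo the line from \<open>x\<close> to
  \<open>p\<close>, the direction to \<open>u\<close> is a positive combination of those to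
  \<open>e\<close> and \<open>f\<close>. A plane through this line with \<open>e\<close> and
  \<open>f\<close> on one side then has \<open>u\<close> there as well.\<close>

lemma beyond_vertex:
  assumes "0 < orient s x y p e" "0 < orient s x y p f"
    and "0 < orient s x p e f * orient s x p u f" "0 < orient s x p e f * orient s x p e u"
  shows "0 < orient s x y p u"
proof -
  have "orient s x p e f \<noteq> 0" using assms(3) by auto
  have "orient s x y p u * (orient s x p e f)\<^sup>2 =
    orient s x y p e * (orient s x p e f * orient s x p u f) + orient s x y p f * (orient s x p e f * orient s x p e u)"
    using orient_three_term[of s x p y u e f] orient_swap(2)[of s x y p u] orient_swap(2)[of s x y p e]
      orient_swap(2)[of s x y p f] by algebra
  then have "0 < orient s x y p u * (orient s x p e f)\<^sup>2" using assms by (simp add: add_pos_pos)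
  then show ?thesis by (simp add: zero_less_mult_iff)
qed

lemma orient_cyclic: "orient s a c d b = orient s a b c d" "orient s a d b c = orient s a b c d" "orient s c a b d = orient s a b c d"
  by (cases a; cases b; cases c; cases d;
      simp only: orient_def det3.simps diff_Pair; simp add: algebra_simps)+

lemma orient_front: "orient s x y a b = orient s a b x y"
  by (rule orient_perms)

text \<open>The analogue of \<open>front_sign\<close> when the single position \<open>p\<close> is
  moved to the front.\<close>

definition before_sign :: "nat \<Rightarrow> nat \<Rightarrow> real" where
  "before_sign p u = (if u < p then -1 else 1)"

lemma before_sign_pos:
  assumes "alternating s z I" "p \<in> I" "u \<in> I" "v \<in> I" "w \<in> I" "u < v" "v < w" "p \<notin> {u, v, w}"
  shows "0 < before_sign p u * before_sign p v * before_sign p w * orient s (z p) (z u) (z v) (z w)"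
proof -
  consider "p < u" | "u < p" "p < v" | "v < p" "p < w" | "w < p" using assms(6-8) by force
  then show ?thesis
  proof cases
    case 1
    then show ?thesis using alternatingD[OF assms(1,2,3,4,5)] assms by (simp add: before_sign_def)
  next
    case 2
    then show ?thesis using alternatingD[OF assms(1,3,2,4,5)] assms orient_swap(1)[of s "z u" "z p"]
      by (simp add: before_sign_def)
  next
    case 3
    then show ?thesis using alternatingD[OF assms(1,3,4,2,5)] assms orient_cyclic(3)[of s "z p" "z u" "z v" "z w"]
        orient_cyclic(3)[of s "z u" "z v" "z p" "z w"]
      by (simp add: before_sign_def)
  next
    case 4
    have "orient s (z p) (z u) (z v) (z w) = - orient s (z u) (z v) (z w) (z p)"
      using orient_swap(1)[of s "z p" "z u" "z v" "z w"] orient_swap(2)[of s "z u" "z p" "z v" "z w"]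
        orient_swap(3)[of s "z u" "z v" "z p" "z w"] by simp
    then show ?thesis using alternatingD[OF assms(1,3,4,5,2)] 4 assms by (simp add: before_sign_def)
  qed
qed

text \<open>Position \<open>8 * i\<close> with \<open>1 \<le> i \<le> m\<close> is taken by an arbitrary point of the cluster \<open>X i\<close>, every other
  position \<open>p\<close> by the single frame point \<open>q p\<close>. Seven frame points between neighbouring clusters leave
  room for the auxiliary points of \<open>alt2\<close> and \<open>dichotomy\<close>.\<close>

locale clusters =
  fixes s :: real and m :: nat and X :: "nat \<Rightarrow> r3 set" and q :: "nat \<Rightarrow> r3"
  fixes F :: "nat set"
  defines "F \<equiv> {p. p < 8 * m + 16 \<and> \<not> (8 dvd p \<and> 8 \<le> p \<and> p \<le> 8 * m)}"
  assumes alt1: "\<And>i x. i \<in> {1..m} \<Longrightarrow> x \<in> X i \<Longrightarrow> alternating s (q(8 * i := x)) (insert (8 * i) F)"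
    and nonzero: "\<And>i x y f g. i \<in> {1..m} \<Longrightarrow> x \<in> X i \<Longrightarrow> y \<in> X i \<Longrightarrow> x \<noteq> y \<Longrightarrow> f \<in> F \<Longrightarrow> g \<in> F \<Longrightarrow>
      f \<noteq> g \<Longrightarrow> orient s (q f) (q g) x y \<noteq> 0"
    and fin: "\<And>i. i \<in> {1..m} \<Longrightarrow> finite (X i)"
begin

lemma frame:
  "1 \<le> r \<Longrightarrow> r \<le> 7 \<Longrightarrow> i \<le> m \<Longrightarrow> 8 * i + r \<in> F" "0 \<in> F"
proof -
  assume "1 \<le> r" "r \<le> 7" "i \<le> m"
  then have "(8 * i + r) mod 8 = r" by simp
  then show "8 * i + r \<in> F" using \<open>1 \<le> r\<close> \<open>r \<le> 7\<close> \<open>i \<le> m\<close> unfolding F_def by (auto simp: dvd_eq_mod_eq_0)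
qed (simp add: F_def)

lemma cluster_not_frame: "i \<in> {1..m} \<Longrightarrow> 8 * i \<notin> F"
  unfolding F_def by auto

lemma alt2:
  assumes ij: "i \<in> {1..m}" "j \<in> {1..m}" "i \<noteq> j" and xy: "x \<in> X i" "y \<in> X j"
  shows "alternating s (q(8 * i := x, 8 * j := y)) (insert (8 * i) (insert (8 * j) F))"
proof -
  have main: "alternating s (q(8 * i := x, 8 * j := y)) (insert (8 * i) (insert (8 * j) F))"
    if ij: "i \<in> {1..m}" "j \<in> {1..m}" "i < j" and xy: "x \<in> X i" "y \<in> X j" for i j x y
  proof (rule alternating_merge[of _ _ _ "8 * i" "8 * j"])
    let ?I = "insert (8 * i) (insert (8 * j) F)"
    let ?z = "q(8 * i := x, 8 * j := y)"
    have nF: "8 * i \<notin> F" "8 * j \<notin> F" using cluster_not_frame ij by auto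
    have cong: "alternating s ?z J" if "alternating s z J" "\<And>p. p \<in> J \<Longrightarrow> ?z p = z p" for z J
      using that unfolding alternating_def by auto
    have "?I - {8 * i} = insert (8 * j) F" using ij nF by auto
    then show "alternating s ?z (?I - {8 * i})"
      by (simp only:) (rule cong[OF alt1[OF ij(2) xy(2)]], use nF ij in auto)
    have "?I - {8 * j} = insert (8 * i) F" using ij nF by auto
    then show "alternating s ?z (?I - {8 * j})"
      by (simp only:) (rule cong[OF alt1[OF ij(1) xy(1)]], use nF ij in auto)
    fix a b
    \<comment> \<open>Of three consecutive frame points at least one differs from both
      \<open>a\<close> and \<open>b\<close>.\<close>
    have third: "\<exists>c\<in>{u + 1, u + 2, u + 3}. c \<noteq> a \<and> c \<noteq> b" for u :: nat by auto
    show "\<exists>c\<in>?I - {a, b}. 8 * i < c \<and> c < 8 * j"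
    proof -
      obtain c where "c \<in> {8 * i + 1, 8 * i + 2, 8 * i + 3}" "c \<noteq> a" "c \<noteq> b" using third by blast
      then show ?thesis
        using frame(1)[of 1 i] frame(1)[of 2 i] frame(1)[of 3 i] ij by (intro bexI[of _ c]) auto
    qed
    show "\<exists>e\<in>?I - {a, b}. 8 * j < e"
    proof -
      obtain e where "e \<in> {8 * m + 1, 8 * m + 2, 8 * m + 3}" "e \<noteq> a" "e \<noteq> b" using third by blast
      then show ?thesis
        using frame(1)[of 1 m] frame(1)[of 2 m] frame(1)[of 3 m] ij by (intro bexI[of _ e]) auto
    qed
  qed (use ij in auto)
  show ?thesis
  proof (cases "i < j")
    case False
    have "alternating s (q(8 * j := y, 8 * i := x)) (insert (8 * j) (insert (8 * i) F))"
      by (rule main) (use False assms in auto)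
    moreover have "q(8 * j := y, 8 * i := x) = q(8 * i := x, 8 * j := y)"
      using assms by (intro fun_upd_twist) auto
    ultimately show ?thesis by (simp add: insert_commute)
  qed (use main assms in auto)
qed

text \<open>The points of a cluster are sorted by angle around the line through two frame points.
  These angles span less than a half-turn, because the cluster lies on one side of the plane through
  the line and a later frame point \<open>h\<close>; with this constant sign the three-term relation
  yields transitivity.\<close>

lemma frame_order:
  assumes i: "i \<in> {1..m}" and fg: "f \<in> F" "g \<in> F" "f \<noteq> g"
  shows "strict_order_on (X i) (\<lambda>x y. 0 < orient s (q f) (q g) x y)"
proof -
  define h where "h = (if 8 * m + 1 \<notin> {f, g} then 8 * m + 1 else if 8 * m + 2 \<notin> {f, g} then 8 * m + 2 else 8 * m + 3)"
  have h: "h \<in> F" "h \<noteq> f" "h \<noteq> g" "8 * i < h"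
    unfolding h_def using frame(1)[of 1 m] frame(1)[of 2 m] frame(1)[of 3 m] i by auto
  have nF: "8 * i \<notin> F" using cluster_not_frame[OF i] .
  define a where "a = min f g"
  define b where "b = max f g"
  have ab: "a < b" "a \<in> F" "b \<in> F" "h \<noteq> a" "h \<noteq> b" using fg h unfolding a_def b_def by (auto simp: min_def max_def)
  define \<tau> where "\<tau> = front_sign a b (8 * i) * front_sign a b h"
  have tau: "\<tau> = 1 \<or> \<tau> = - 1" unfolding \<tau>_def front_sign_def by auto
  have ref: "0 < \<tau> * orient s (q a) (q b) x (q h)" if x: "x \<in> X i" for x
  proof -
    have "alternating s (q(8 * i := x)) {a, b, 8 * i, h}"
      by (rule alternating_subset[OF alt1[OF i x]]) (use ab h in auto)
    then show ?thesis
      using front_sign_iff[of a b "8 * i" h "{a, b, 8 * i, h}" s "q(8 * i := x)"] ab h nF unfolding \<tau>_def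
      by auto
  qed
  define \<rho> where "\<rho> = (if f < g then 1 else - 1 :: real)"
  have flip: "orient s (q f) (q g) x y = \<rho> * orient s (q a) (q b) x y" for x y
    unfolding \<rho>_def a_def b_def using orient_swap(1)[of s "q g" "q f" x y] fg by (auto simp: min_def max_def)
  have trans: "0 < \<rho> * orient s (q a) (q b) x z"
    if xyz: "x \<in> X i" "y \<in> X i" "z \<in> X i" and lt: "0 < \<rho> * orient s (q a) (q b) x y" "0 < \<rho> * orient s (q a) (q b) y z" for x y z
  proof -
    let ?E = "orient s (q a) (q b)"
    have "?E x z * ?E y (q h) = ?E x y * ?E z (q h) + ?E x (q h) * ?E y z"
      by (rule orient_three_term)
    then have "(\<rho> * ?E x z) * (\<tau> * ?E y (q h)) =
      (\<rho> * ?E x y) * (\<tau> * ?E z (q h)) + (\<tau> * ?E x (q h)) * (\<rho> * ?E y z)" by algebra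
    also have "\<dots> > 0"
      by (rule add_pos_pos[OF mult_pos_pos[OF lt(1) ref[OF xyz(3)]] mult_pos_pos[OF ref[OF xyz(1)] lt(2)]])
    finally show ?thesis using ref[OF xyz(2)] by (simp add: zero_less_mult_iff)
  qed
  show ?thesis unfolding strict_order_on_def
  proof (intro conjI ballI impI)
    fix x show "\<not> 0 < orient s (q f) (q g) x x" using orient_same(3)[of s "q f" "q g" x] by simp
  next
    fix x y assume xy: "x \<in> X i" "y \<in> X i" "x \<noteq> y"
    show "0 < orient s (q f) (q g) x y \<or> 0 < orient s (q f) (q g) y x"
      using nonzero[OF i xy fg] orient_swap(3)[of s "q f" "q g" x y] by auto
  next
    fix x y z assume "x \<in> X i" "y \<in> X i" "z \<in> X i" "0 < orient s (q f) (q g) x y" "0 < orient s (q f) (q g) y z"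
    then show "0 < orient s (q f) (q g) x z" using trans[of x y z] unfolding flip by auto
  qed
qed

text \<open>Seen from \<open>q f\<close>, the lines through two points of \<open>Y\<close> do not separate the clusters in \<open>W\<close>; so a cap
  of \<open>Y\<close>, as seen from there, stays in convex position together with these clusters.\<close>

definition good :: "nat \<Rightarrow> nat \<Rightarrow> nat set \<Rightarrow> bool" where
  "good b i W \<longleftrightarrow> (\<exists>Y\<subseteq>X i. card Y = b \<and> (\<exists>f\<in>F. \<exists>g\<in>F. f \<noteq> g \<and>
     (\<forall>x\<in>Y. \<forall>y\<in>Y. 0 < orient s (q f) (q g) x y \<longrightarrow> (\<forall>j\<in>W. \<forall>u\<in>X j. 0 < orient s (q f) x y u))))"

lemma good_anti:
  assumes "good b i W" "W' \<subseteq> W"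
  shows "good b i W'"
proof -
  obtain Y f g where Y: "Y \<subseteq> X i" "card Y = b" "f \<in> F" "g \<in> F" "f \<noteq> g"
    "\<forall>x\<in>Y. \<forall>y\<in>Y. 0 < orient s (q f) (q g) x y \<longrightarrow> (\<forall>j\<in>W. \<forall>u\<in>X j. 0 < orient s (q f) x y u)"
    using assms(1) unfolding good_def by blast
  have "0 < orient s (q f) x y u"
    if "x \<in> Y" "y \<in> Y" "0 < orient s (q f) (q g) x y" "j \<in> W'" "u \<in> X j" for x y j u
    using Y(6) that assms(2) by blast
  then show ?thesis unfolding good_def using Y(1-5)
    by (intro exI[of _ Y] conjI bexI[of _ f] bexI[of _ g]) simp_all
qed

text \<open>\<open>p\<close> is a vertex of the cone seen from a point of the cluster,
  \<open>e\<close> and \<open>f\<close> are its neighbours, and the last hypothesis puts the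
  clusters of \<open>W\<close> inside the angle at \<open>p\<close>. If the lines to both neighbours
  order \<open>Y\<close> alike, \<open>beyond_vertex\<close> makes \<open>q p\<close> a valid centre
  of projection.\<close>

lemma good_vertex:
  assumes Y: "Y \<subseteq> X i" "card Y = b" and fr: "p \<in> F" "e \<in> F" "p \<noteq> e"
    and same: "\<And>x y. x \<in> Y \<Longrightarrow> y \<in> Y \<Longrightarrow> 0 < orient s (q p) (q e) x y \<Longrightarrow> 0 < orient s (q p) (q f) x y"
    and W: "\<And>j u x. j \<in> W \<Longrightarrow> u \<in> X j \<Longrightarrow> x \<in> X i \<Longrightarrow>
      0 < orient s x (q p) (q e) (q f) * orient s x (q p) u (q f) \<and> 0 < orient s x (q p) (q e) (q f) * orient s x (q p) (q e) u"
  shows "good b i W"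
proof -
  have "0 < orient s (q p) x y u" if "x \<in> Y" "y \<in> Y" "0 < orient s (q p) (q e) x y" "j \<in> W" "u \<in> X j" for x y j u
  proof -
    have "0 < orient s x y (q p) u"
    proof (rule beyond_vertex[of s x y "q p" "q e" "q f" u])
      show "0 < orient s x y (q p) (q e)" using that(3) unfolding orient_front[of s x y] .
      show "0 < orient s x y (q p) (q f)" using same[OF that(1-3)] unfolding orient_front[of s x y] .
    qed (use W[OF that(4,5), of x] that Y in auto)
    then show ?thesis unfolding orient_cyclic(3)[of s "q p" x y u] orient_cyclic(3)[of s x y "q p" u]
      orient_cyclic(3)[of s y "q p" x u, symmetric] by simp
  qed
  then show ?thesis unfolding good_def using Y fr
    by (intro exI[of _ Y] conjI bexI[of _ p] bexI[of _ e]) simp_all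
qed

text \<open>Seen from \<open>x\<close>, the points \<open>q a\<close>, \<open>q b\<close>,
  \<open>q d\<close>, \<open>q c\<close> in this cyclic order span a cone that contains the clusters
  between \<open>a\<close> and \<open>b\<close> and between \<open>c\<close> and \<open>d\<close>.
  The four triples \<open>(p, e, f)\<close> are its vertices with their neighbours. All signs follow
  from how many of the positions involved precede \<open>8 * i\<close>.\<close>

lemma cone_vertices:
  assumes i: "i \<in> {1..m}" and j: "j \<in> {1..m}" "i \<noteq> j" and fr: "a \<in> F" "b \<in> F" "c \<in> F" "d \<in> F"
    and lt: "a < b" "b < 8 * i" "8 * i < c" "c < d" and pos: "a < 8 * j \<and> 8 * j < b \<or> c < 8 * j \<and> 8 * j < d"
    and xu: "x \<in> X i" "u \<in> X j"
    and pef: "(p, e, f) \<in> {(b, a, d), (d, b, c), (a, b, c), (c, a, d)}"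
  shows "0 < orient s x (q p) (q e) (q f) * orient s x (q p) u (q f) \<and> 0 < orient s x (q p) (q e) (q f) * orient s x (q p) (q e) u"
proof -
  let ?z = "q(8 * i := x, 8 * j := u)"
  let ?I = "insert (8 * i) (insert (8 * j) F)"
  let ?\<epsilon> = "before_sign (8 * i)"
  have nF: "8 * i \<notin> F" "8 * j \<notin> F" using cluster_not_frame i j by auto
  then have z: "?z a = q a" "?z b = q b" "?z c = q c" "?z d = q d" "?z (8 * i) = x" "?z (8 * j) = u"
    using fr j by auto
  have E: "0 < ?\<epsilon> k * ?\<epsilon> l * ?\<epsilon> n * orient s x (?z k) (?z l) (?z n)"
    if "k \<in> {a, b, c, d, 8 * j}" "l \<in> {a, b, c, d, 8 * j}" "n \<in> {a, b, c, d, 8 * j}" "k < l" "l < n" for k l n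
  proof -
    have sub: "{a, b, c, d, 8 * j} \<subseteq> ?I" and ni: "8 * i \<notin> {a, b, c, d, 8 * j}" using fr nF j by auto
    have "k \<in> ?I" "l \<in> ?I" "n \<in> ?I" using that(1-3) sub by blast+
    moreover have "8 * i \<notin> {k, l, n}" using that(1-3) ni by blast
    moreover have "8 * i \<in> ?I" by blast
    ultimately have "0 < ?\<epsilon> k * ?\<epsilon> l * ?\<epsilon> n * orient s (?z (8 * i)) (?z k) (?z l) (?z n)"
      using before_sign_pos[OF alt2[OF i j xu]] that(4,5) by blast
    then show ?thesis unfolding z(5) .
  qed
  have ne: "a \<in> {a, b, c, d, 8 * j}" "b \<in> {a, b, c, d, 8 * j}" "c \<in> {a, b, c, d, 8 * j}"
    "d \<in> {a, b, c, d, 8 * j}" "8 * j \<in> {a, b, c, d, 8 * j}" by auto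
  have sg: "?\<epsilon> a = -1" "?\<epsilon> b = -1" "?\<epsilon> c = 1" "?\<epsilon> d = 1" using lt unfolding before_sign_def by auto
  have abd: "0 < orient s x (q a) (q b) (q d)" using E[OF ne(1,2,4)] lt unfolding sg z by auto
  have abc: "0 < orient s x (q a) (q b) (q c)" using E[OF ne(1,2,3)] lt unfolding sg z by auto
  have bcd: "orient s x (q b) (q c) (q d) < 0" using E[OF ne(2,3,4)] lt unfolding sg z by auto
  have acd: "orient s x (q a) (q c) (q d) < 0" using E[OF ne(1,3,4)] lt unfolding sg z by auto
  have T: "orient s x v u w = - orient s x u v w" "orient s x v w u = orient s x u v w" "orient s x w u v = orient s x u v w"
    "orient s x u w v = - orient s x u v w" for u v w
    by (rule orient_swap(2), rule orient_cyclic(1), rule orient_cyclic(2), rule orient_swap(3))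
  have pm: "0 < A * B \<and> 0 < A * C" if "(0 < A \<and> 0 < B \<and> 0 < C) \<or> (A < 0 \<and> B < 0 \<and> C < 0)" for A B C :: real
    using that by (auto simp: zero_less_mult_iff)
  from pos show ?thesis
  proof
    assume j1: "a < 8 * j \<and> 8 * j < b"
    then have sj: "?\<epsilon> (8 * j) = -1" using lt unfolding before_sign_def by auto
    have aub: "orient s x (q a) u (q b) < 0" using E[OF ne(1,5,2)] lt j1 unfolding sg sj z by auto
    have ubd: "0 < orient s x u (q b) (q d)" using E[OF ne(5,2,4)] lt j1 unfolding sg sj z by auto
    have ucd: "orient s x u (q c) (q d) < 0" using E[OF ne(5,3,4)] lt j1 unfolding sg sj z by auto
    have auc: "0 < orient s x (q a) u (q c)" using E[OF ne(1,5,3)] lt j1 unfolding sg sj z by auto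
    consider "p = b" "e = a" "f = d" | "p = d" "e = b" "f = c" | "p = a" "e = b" "f = c" | "p = c" "e = a" "f = d"
      using pef by auto
    then show ?thesis
    proof cases
      case 1
      show ?thesis unfolding 1 using abd ubd aub
        T(1)[of "q b" "q a" "q d"] T(1)[of "q b" u "q d"] T(3)[of "q b" "q a" u] by (intro pm) linarith
    next
      case 2
      show ?thesis unfolding 2 using bcd ucd ubd
        T(3)[of "q d" "q b" "q c"] T(3)[of "q d" u "q c"] T(3)[of "q d" "q b" u] T(1)[of "q b" u "q d"]
        by (intro pm) linarith
    next
      case 3
      show ?thesis unfolding 3 using abc auc aub T(4)[of "q a" "q b" u] by (intro pm) linarith
    next
      case 4
      show ?thesis unfolding 4 using acd ucd auc
        T(1)[of "q c" "q a" "q d"] T(1)[of "q c" u "q d"] T(3)[of "q c" "q a" u] by (intro pm) linarith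
    qed
  next
    assume j2: "c < 8 * j \<and> 8 * j < d"
    then have sj: "?\<epsilon> (8 * j) = 1" using lt unfolding before_sign_def by auto
    have cud: "0 < orient s x (q c) u (q d)" using E[OF ne(3,5,4)] lt j2 unfolding sg sj z by auto
    have bud: "orient s x (q b) u (q d) < 0" using E[OF ne(2,5,4)] lt j2 unfolding sg sj z by auto
    have acu: "orient s x (q a) (q c) u < 0" using E[OF ne(1,3,5)] lt j2 unfolding sg sj z by auto
    have abu: "0 < orient s x (q a) (q b) u" using E[OF ne(1,2,5)] lt j2 unfolding sg sj z by auto
    consider "p = b" "e = a" "f = d" | "p = d" "e = b" "f = c" | "p = a" "e = b" "f = c" | "p = c" "e = a" "f = d"
      using pef by auto
    then show ?thesis
    proof cases
      case 1
      show ?thesis unfolding 1 using abd bud abu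
        T(1)[of "q b" "q a" "q d"] T(1)[of "q b" "q a" u] by (intro pm) linarith
    next
      case 2
      show ?thesis unfolding 2 using bcd cud bud
        T(3)[of "q d" "q b" "q c"] T(3)[of "q d" u "q c"] T(3)[of "q d" "q b" u] T(1)[of u "q c" "q d"]
        by (intro pm) linarith
    next
      case 3
      show ?thesis unfolding 3 using abc acu abu T(4)[of "q a" u "q c"] by (intro pm) linarith
    next
      case 4
      show ?thesis unfolding 4 using acd cud acu
        T(1)[of "q c" "q a" "q d"] T(1)[of "q c" "q a" u] by (intro pm) linarith
    qed
  qed
qed

text \<open>On \<open>Y\<close> the two orders are equal or reverse to each other. The pair
  \<open>x\<close>, \<open>y\<close> excludes equality; directing both edges away from
  \<open>p\<close> exchanges the ends of one of them and turns reversal into agreement.\<close>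

lemma edges_agree:
  assumes i: "i \<in> {1..m}" and Y: "Y \<subseteq> X i" and fr: "u \<in> F" "p \<in> F" "v \<in> F" "u \<noteq> p" "p \<noteq> v"
    and mono: "same_or_reversed Y r0 (\<lambda>x y. 0 < orient s (q u) (q p) x y)"
      "same_or_reversed Y r0 (\<lambda>x y. 0 < orient s (q p) (q v) x y)"
    and xy: "x \<in> Y" "y \<in> Y" "orient s x y (q u) (q p) * orient s x y (q p) (q v) < 0"
    and zw: "z \<in> Y" "w \<in> Y"
  shows "0 < orient s (q p) (q u) z w \<longleftrightarrow> 0 < orient s (q p) (q v) z w"
proof -
  let ?A = "\<lambda>x y. 0 < orient s (q u) (q p) x y" and ?B = "\<lambda>x y. 0 < orient s (q p) (q v) x y"
  have "?A x y \<noteq> ?B x y" using xy(3) unfolding orient_front[of s x y] by (auto simp: mult_less_0_iff)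
  then have "\<not> (\<forall>x\<in>Y. \<forall>y\<in>Y. ?A x y \<longleftrightarrow> ?B x y)" using xy by metis
  then have rev: "?A w z \<longleftrightarrow> ?B z w" using mono zw unfolding same_or_reversed_def by metis
  have "orient s (q p) (q u) z w = orient s (q u) (q p) w z"
    using orient_swap(1)[of s "q p" "q u" z w] orient_swap(3)[of s "q u" "q p" z w] by linarith
  then show ?thesis using rev by simp
qed

text \<open>If two consecutive edges of the quadrilateral disagree about the line through
  \<open>x\<close> and \<open>y\<close>, their common vertex is a centre of projection that makes
  \<open>i\<close> good. Otherwise all four edges agree, and \<open>t\<close> is their common sign,
  as \<open>polygon_inside\<close> requires.\<close>

lemma good_or_consistent:
  assumes i: "i \<in> {1..m}" and Y: "Y \<subseteq> X i" "card Y = n"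
    and fr: "a \<in> F" "b \<in> F" "c \<in> F" "d \<in> F"
    and lt: "a < b" "b < 8 * i" "8 * i < c" "c < d"
    and W: "\<And>j. j \<in> W \<Longrightarrow> j \<in> {1..m} \<and> j \<noteq> i \<and> (a < 8 * j \<and> 8 * j < b \<or> c < 8 * j \<and> 8 * j < d)"
    and mono: "\<And>u v. (u, v) \<in> {(a, b), (b, d), (d, c), (c, a)} \<Longrightarrow>
      same_or_reversed Y r0 (\<lambda>x y. 0 < orient s (q u) (q v) x y)"
    and xy: "x \<in> Y" "y \<in> Y" "x \<noteq> y" and bad: "\<not> good n i W"
  shows "\<exists>t\<in>{-1, 1}. 0 < t * orient s x y (q a) (q b) \<and> 0 < t * orient s x y (q b) (q d) \<and>
    0 < t * orient s x y (q d) (q c) \<and> 0 < t * orient s x y (q c) (q a)"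
proof -
  have no: "\<not> orient s x y (q u) (q p) * orient s x y (q p) (q v) < 0"
    if pv: "(u, p, v, e, f) \<in> {(a, b, d, a, d), (b, d, c, b, c), (d, c, a, a, d), (c, a, b, b, c)}" for u p v e f
  proof
    assume neg: "orient s x y (q u) (q p) * orient s x y (q p) (q v) < 0"
    have uv: "u \<in> F" "p \<in> F" "v \<in> F" "u \<noteq> p" "p \<noteq> v"
      "(u, p) \<in> {(a, b), (b, d), (d, c), (c, a)}" "(p, v) \<in> {(a, b), (b, d), (d, c), (c, a)}"
      using pv fr lt by auto
    have iff: "0 < orient s (q p) (q u) z w \<longleftrightarrow> 0 < orient s (q p) (q v) z w" if "z \<in> Y" "w \<in> Y" for z w
      by (rule edges_agree[OF i Y(1) uv(1-5) mono[OF uv(6)] mono[OF uv(7)] xy(1,2) neg that])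
    have ef: "(p, e, f) \<in> {(b, a, d), (d, b, c), (a, b, c), (c, a, d)}" "e = u \<and> f = v \<or> e = v \<and> f = u"
      using pv by auto
    have "good n i W"
    proof (rule good_vertex[OF Y, of p e f])
      show "p \<in> F" "e \<in> F" "p \<noteq> e" using ef uv by auto
      show "0 < orient s (q p) (q f) z w" if "z \<in> Y" "w \<in> Y" "0 < orient s (q p) (q e) z w" for z w
        using iff[OF that(1,2)] that(3) ef(2) by auto
      show "0 < orient s z (q p) (q e) (q f) * orient s z (q p) w (q f) \<and> 0 < orient s z (q p) (q e) (q f) * orient s z (q p) (q e) w"
        if "j \<in> W" "w \<in> X j" "z \<in> X i" for j w z
      proof -
        have j: "j \<in> {1..m}" "i \<noteq> j" "a < 8 * j \<and> 8 * j < b \<or> c < 8 * j \<and> 8 * j < d"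
          using W[OF that(1)] by auto
        show ?thesis by (rule cone_vertices[OF i j(1,2) fr lt j(3) that(3,2) ef(1)])
      qed
    qed
    then show False using bad by simp
  qed
  have nz: "orient s x y (q u) (q v) \<noteq> 0" if "u \<in> F" "v \<in> F" "u \<noteq> v" for u v
    using nonzero[OF i _ _ xy(3) that] xy Y unfolding orient_front[of s x y] by auto
  have nz4: "orient s x y (q a) (q b) \<noteq> 0" "orient s x y (q b) (q d) \<noteq> 0" "orient s x y (q d) (q c) \<noteq> 0" "orient s x y (q c) (q a) \<noteq> 0"
    using nz fr lt by auto
  show ?thesis
  proof (cases "0 < orient s x y (q a) (q b)")
    case True
    then have "0 < orient s x y (q b) (q d)" using no[of a b d a d] nz4 by (auto simp: mult_less_0_iff)
    moreover from this have "0 < orient s x y (q d) (q c)" using no[of b d c b c] nz4 by (auto simp: mult_less_0_iff)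
    moreover from this have "0 < orient s x y (q c) (q a)" using no[of d c a a d] nz4 by (auto simp: mult_less_0_iff)
    ultimately show ?thesis using True by (intro bexI[of _ 1]) auto
  next
    case False
    then have "orient s x y (q a) (q b) < 0" using nz4 by simp
    moreover from this have "orient s x y (q b) (q d) < 0" using no[of a b d a d] nz4 by (auto simp: mult_less_0_iff)
    moreover from this have "orient s x y (q d) (q c) < 0" using no[of b d c b c] nz4 by (auto simp: mult_less_0_iff)
    moreover from this have "orient s x y (q c) (q a) < 0" using no[of d c a a d] nz4 by (auto simp: mult_less_0_iff)
    ultimately show ?thesis by (intro bexI[of _ "-1"]) auto
  qed
qed

text \<open>The side changes whenever \<open>w\<close> passes \<open>g\<close>, \<open>8 * i\<close>
  or \<open>h\<close>, as for a plane that cuts the moment curve in three points.\<close>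

lemma frame_plane_sign:
  assumes i: "i \<in> {1..m}" and x: "x \<in> X i" and fr: "g \<in> F" "h \<in> F" "w \<in> F" and gh: "g < 8 * i" "8 * i < h"
    and w: "w \<noteq> g" "w \<noteq> h"
  shows "if g < w \<and> w < 8 * i \<or> h < w then 0 < - orient s x (q g) (q h) (q w) else 0 < orient s x (q g) (q h) (q w)"
proof -
  have nF: "8 * i \<notin> F" using cluster_not_frame[OF i] .
  have E: "0 < before_sign (8 * i) k * before_sign (8 * i) l * before_sign (8 * i) n * orient s x (q k) (q l) (q n)"
    if "k \<in> F" "l \<in> F" "n \<in> F" "k < l" "l < n" for k l n
    using before_sign_pos[OF alt1[OF i x], of "8 * i" k l n] that nF by auto
  have "w \<noteq> 8 * i" using fr nF by auto
  then consider "w < g" | "g < w" "w < 8 * i" | "8 * i < w" "w < h" | "h < w" using w by linarith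
  then show ?thesis
  proof cases
    case 1
    then show ?thesis using E[of w g h] fr gh orient_cyclic(1)[of s x "q g" "q h" "q w"] by (simp add: before_sign_def)
  next
    case 2
    then show ?thesis using E[of g w h] fr gh orient_swap(3)[of s x "q g" "q w" "q h"] by (simp add: before_sign_def)
  next
    case 3
    then show ?thesis using E[of g w h] fr gh orient_swap(3)[of s x "q g" "q w" "q h"] by (simp add: before_sign_def)
  next
    case 4
    then show ?thesis using E[of g h w] fr gh by (simp add: before_sign_def)
  qed
qed

lemma frame_triangles:
  assumes i: "i \<in> {1..m}" and x: "x \<in> X i" and fr: "a \<in> F" "b \<in> F" "c \<in> F" "d \<in> F"
    and lt: "a < b" "b < 8 * i" "8 * i < c" "c < d"
  shows "0 < orient s x (q a) (q b) (q c)" "0 < orient s x (q b) (q d) (q c)"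
proof -
  have nF: "8 * i \<notin> F" using cluster_not_frame[OF i] .
  show "0 < orient s x (q a) (q b) (q c)"
    using before_sign_pos[OF alt1[OF i x], of "8 * i" a b c] fr lt nF by (auto simp: before_sign_def)
  show "0 < orient s x (q b) (q d) (q c)"
    using before_sign_pos[OF alt1[OF i x], of "8 * i" b c d] fr lt nF orient_swap(3)[of s x "q b" "q d" "q c"]
    by (auto simp: before_sign_def)
qed

text \<open>The two cones below have only their apex in common: they are separated by the plane through the
  frame points \<open>8 * a + 2\<close> and \<open>8 * c - 2\<close>, and both lie on the same side of the plane through the frame
  points \<open>0\<close> and \<open>8 * i + 1\<close>.\<close>

lemma dichotomy:
  assumes ia: "1 \<le> a" "a < i" "i < c" "c \<le> m" and n: "2 \<le> n" "n ^ 256 \<le> card (X i)"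
  shows "good n i ({a<..<i} \<union> {c..m}) \<or> good n i ({1..a} \<union> {i<..<c})"
proof (rule ccontr)
  assume "\<not> ?thesis"
  then have bad: "\<not> good n i ({a<..<i} \<union> {c..m})" "\<not> good n i ({1..a} \<union> {i<..<c})" by auto
  have i: "i \<in> {1..m}" using ia by auto
  obtain i' c' where i': "i = Suc i'" and c': "c = Suc c'" using ia by (cases i; cases c) auto
  \<comment> \<open>With predecessors resolved, \<open>b1\<close> is \<open>8 * i - 1\<close>,
    \<open>c1\<close> is \<open>8 * c - 1\<close> and \<open>d2\<close> is \<open>8 * c - 3\<close>.
    The first cone encloses the clusters in \<open>{a<..<i}\<close> and \<open>{c..m}\<close>, the
    second those in \<open>{1..a}\<close> and \<open>{i<..<c}\<close>.\<close>
  define a1 b1 c1 d1 where T: "a1 = 8 * a + 3" "b1 = 8 * i' + 7" "c1 = 8 * c' + 7" "d1 = 8 * m + 3"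
  define a2 b2 c2 d2 where T': "a2 = 8 * 0 + (1::nat)" "b2 = 8 * a + 1" "c2 = 8 * i + 2" "d2 = 8 * c' + 5"
  define g h where gh: "g = (0::nat)" "h = 8 * i + 1"
  define s' t' where st: "s' = 8 * a + 2" "t' = 8 * c' + 6"
  have fr1: "a1 \<in> F" "b1 \<in> F" "c1 \<in> F" "d1 \<in> F" unfolding T
    by (rule frame(1); use ia i' c' in linarith)+
  have fr2: "a2 \<in> F" "b2 \<in> F" "c2 \<in> F" "d2 \<in> F" unfolding T'
    by (rule frame(1); use ia i' c' in linarith)+
  have fr3: "g \<in> F" "h \<in> F" "s' \<in> F" "t' \<in> F" unfolding gh st
    by (rule frame(2)) (rule frame(1); use ia i' c' in linarith)+
  have lt1: "a1 < b1" "b1 < 8 * i" "8 * i < c1" "c1 < d1" and lt2: "a2 < b2" "b2 < 8 * i" "8 * i < c2" "c2 < d2"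
    and lt3: "g < 8 * i" "8 * i < h" "s' < 8 * i" "8 * i < t'"
    unfolding T T' gh st using ia i' c' by linarith+
  define E where "E = [(a1, b1), (b1, d1), (d1, c1), (c1, a1), (a2, b2), (b2, d2), (d2, c2), (c2, a2)]"
  define r where "r e = (\<lambda>x y. 0 < orient s (q (fst e)) (q (snd e)) x y)" for e
  have ord: "strict_order_on (X i) (r e)" if "e \<in> set E" for e
    unfolding r_def by (rule frame_order[OF i]) (use that fr1 fr2 lt1 lt2 in \<open>auto simp: E_def\<close>)
  \<comment> \<open>One squaring for each of the eight edges of the two cones: 256 = 2 ^ 8.\<close>
  have "n ^ (2 ^ length (map r E)) \<le> card (X i)" using n(2) unfolding E_def by simp
  then obtain Y where Y: "Y \<subseteq> X i" "card Y = n" "\<forall>e\<in>set (map r E). same_or_reversed Y (r (a1, b1)) e"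
    using monotone_subset_list[OF fin[OF i] ord[of "(a1, b1)"], of "map r E" n] ord by (auto simp: E_def)
  obtain x y where xy: "x \<in> Y" "y \<in> Y" "x \<noteq> y"
  proof -
    have "\<not> card Y \<le> Suc 0" using Y n by simp
    moreover have "finite Y" using Y(1) fin[OF i] finite_subset by auto
    ultimately show ?thesis using that card_le_Suc0_iff_eq by metis
  qed
  have xi: "x \<in> X i" using xy Y by auto
  have mono: "same_or_reversed Y (r (a1, b1)) (\<lambda>x y. 0 < orient s (q u) (q v) x y)" if "(u, v) \<in> set E" for u v
    using Y(3) that unfolding r_def by force
  have "\<exists>t\<in>{-1, 1}. 0 < t * orient s x y (q a1) (q b1) \<and> 0 < t * orient s x y (q b1) (q d1) \<and>
    0 < t * orient s x y (q d1) (q c1) \<and> 0 < t * orient s x y (q c1) (q a1)"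
  proof (rule good_or_consistent[OF i Y(1,2) fr1 lt1 _ mono xy bad(1)])
    fix j assume "j \<in> {a<..<i} \<union> {c..m}"
    then show "j \<in> {1..m} \<and> j \<noteq> i \<and> (a1 < 8 * j \<and> 8 * j < b1 \<or> c1 < 8 * j \<and> 8 * j < d1)"
      using ia i' c' unfolding T by auto
  qed (auto simp: E_def)
  then obtain t1 where t1: "t1 = -1 \<or> t1 = 1" "0 < t1 * orient s x y (q a1) (q b1)" "0 < t1 * orient s x y (q b1) (q d1)"
    "0 < t1 * orient s x y (q d1) (q c1)" "0 < t1 * orient s x y (q c1) (q a1)" by blast
  have "\<exists>t\<in>{-1, 1}. 0 < t * orient s x y (q a2) (q b2) \<and> 0 < t * orient s x y (q b2) (q d2) \<and>
    0 < t * orient s x y (q d2) (q c2) \<and> 0 < t * orient s x y (q c2) (q a2)"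
  proof (rule good_or_consistent[OF i Y(1,2) fr2 lt2 _ mono xy bad(2)])
    fix j assume "j \<in> {1..a} \<union> {i<..<c}"
    then show "j \<in> {1..m} \<and> j \<noteq> i \<and> (a2 < 8 * j \<and> 8 * j < b2 \<or> c2 < 8 * j \<and> 8 * j < d2)"
      using ia i' c' unfolding T' by auto
  qed (auto simp: E_def)
  then obtain t2 where t2: "t2 = -1 \<or> t2 = 1" "0 < t2 * orient s x y (q a2) (q b2)" "0 < t2 * orient s x y (q b2) (q d2)"
    "0 < t2 * orient s x y (q d2) (q c2)" "0 < t2 * orient s x y (q c2) (q a2)" by blast
  note tri1 = frame_triangles[OF i xi fr1 lt1] and tri2 = frame_triangles[OF i xi fr2 lt2]
  have gs: "0 < - 1 * orient s x (q g) (q h) (q w)" if "w \<in> {a1, b1, c1, d1, a2, b2, c2, d2}" for w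
    using frame_plane_sign[OF i xi fr3(1,2) _ lt3(1,2), of w] that fr1 fr2 lt1 lt2
    using i' c' ia by (auto simp: gh T T' split: if_splits)
  have ss1: "0 < - 1 * orient s x (q s') (q t') (q w)" if "w \<in> {a1, b1, c1, d1}" for w
    using frame_plane_sign[OF i xi fr3(3,4) _ lt3(3,4), of w] that fr1 lt1
    by (auto simp: st T split: if_splits)
  have ss2: "0 < 1 * orient s x (q s') (q t') (q w)" if "w \<in> {a2, b2, c2, d2}" for w
    using frame_plane_sign[OF i xi fr3(3,4) _ lt3(3,4), of w] that fr2 lt2
    by (auto simp: st T' split: if_splits)
  \<comment> \<open>The direction from \<open>x\<close> to \<open>y\<close> or its opposite lies in
    each of the cones. The plane with both cones on one side forces \<open>t1 = t2\<close>, the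
    separating plane forces \<open>t1 = - t2\<close>.\<close>
  have "0 < t1 * - 1 * orient s x (q g) (q h) y" by (rule polygon_inside[OF t1(2-5) tri1 gs gs gs gs]) auto
  moreover have "0 < t2 * - 1 * orient s x (q g) (q h) y" by (rule polygon_inside[OF t2(2-5) tri2 gs gs gs gs]) auto
  moreover have "0 < t1 * - 1 * orient s x (q s') (q t') y" by (rule polygon_inside[OF t1(2-5) tri1 ss1 ss1 ss1 ss1]) auto
  moreover have "0 < t2 * 1 * orient s x (q s') (q t') y" by (rule polygon_inside[OF t2(2-5) tri2 ss2 ss2 ss2 ss2]) auto
  ultimately show False using t1(1) t2(1) by auto
qed

end

section \<open>Uniting caps seen from different centres\<close>

lemma orient_scale: "orient (t * s) a b c d = t * orient s a b c d"
  unfolding orient_def by simp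

text \<open>The four-point condition for \<open>cap_all_triples\<close>: three-term relations around
  the lines from \<open>f\<close> to \<open>y\<close> and from \<open>f\<close> to \<open>z\<close>,
  with positive coefficients supplied by the order around the line through \<open>f\<close> and
  \<open>g\<close>.\<close>

lemma cap_transitive:
  assumes ord: "0 < orient s f g x y" "0 < orient s f g y z" "0 < orient s f g z w" "0 < orient s f g x z" "0 < orient s f g y w"
    and cap: "0 < t * orient s f x y z" "0 < t * orient s f y z w"
  shows "0 < t * orient s f x y w" "0 < t * orient s f x z w"
proof -
  have "orient s f g y z * (t * orient s f x y w) = orient s f g x y * (t * orient s f y z w) + orient s f g y w * (t * orient s f x y z)"
    using orient_three_term[of s f y g z x w] orient_swap(2)[of s f y g z] orient_swap(2)[of s f y x w]
      orient_swap(2)[of s f y g x] orient_swap(3)[of s f g y x] orient_swap(2)[of s f y g w] orient_swap(2)[of s f y x z]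
    by algebra
  then have "0 < orient s f g y z * (t * orient s f x y w)"
    using mult_pos_pos[OF ord(1) cap(2)] mult_pos_pos[OF ord(5) cap(1)] by linarith
  then show "0 < t * orient s f x y w" using zero_less_mult_pos[OF _ ord(2)] by blast
  have "orient s f g y z * (t * orient s f x z w) = orient s f g x z * (t * orient s f y z w) + orient s f g z w * (t * orient s f x y z)"
    using orient_three_term[of s f z g y x w] orient_swap(2)[of s f z g y] orient_swap(3)[of s f g z y] orient_swap(2)[of s f z x w]
      orient_swap(2)[of s f z g x] orient_swap(3)[of s f g z x] orient_swap(2)[of s f z y w] orient_swap(2)[of s f z g w]
      orient_swap(2)[of s f z x y] orient_swap(3)[of s f x z y]
    by algebra
  then have "0 < orient s f g y z * (t * orient s f x z w)"
    using mult_pos_pos[OF ord(4) cap(2)] mult_pos_pos[OF ord(3) cap(1)] by linarith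
  then show "0 < t * orient s f x z w" using zero_less_mult_pos[OF _ ord(2)] by blast
qed

text \<open>Every entry belongs to a pair of neighbours in the list. A triple keeps its sign under
  cyclic shifts, so earlier and later entries lie on the same side of the plane through
  \<open>f\<close> and such a pair.\<close>

lemma cap_edge:
  assumes ord: "strict_order_on Y (\<lambda>x y. 0 < orient s f g x y)" and xs: "set xs \<subseteq> Y" "2 \<le> length xs"
    and cap: "cap (\<lambda>x y. 0 < orient s f g x y) (\<lambda>x y z. 0 < t * orient s f x y z) xs" and a: "a \<in> set xs"
  shows "\<exists>x\<in>set xs. \<exists>y\<in>set xs. x \<noteq> y \<and> a \<in> {x, y} \<and> 0 < orient s f g x y \<and>
    (\<forall>u\<in>set xs - {x, y}. 0 < t * orient s f x y u)"
proof -
  let ?r = "\<lambda>x y. 0 < orient s f g x y"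
  have tr: "0 < t * orient s f (xs ! i) (xs ! j) (xs ! k)" if "i < j" "j < k" "k < length xs" for i j k
  proof (rule cap_all_triples[OF cap xs(1) _ that])
    fix x y z w
    assume el: "{x, y, z, w} \<subseteq> Y" and o: "?r x y" "?r y z" "?r z w"
      and p: "0 < t * orient s f x y z" "0 < t * orient s f y z w"
    have "?r x z" "?r y w"
      using strict_order_on_trans[OF ord, of x y z] strict_order_on_trans[OF ord, of y z w] el o by auto
    then show "0 < t * orient s f x y w \<and> 0 < t * orient s f x z w"
      using cap_transitive[OF o _ _ p] by blast
  qed
  have ordn: "?r (xs ! i) (xs ! j)" if "i < j" "j < length xs" for i j
    using cap that sorted_wrt_nth_less[of ?r xs i j] unfolding cap_def by auto
  obtain l where l: "l < length xs" "a = xs ! l" using a by (metis in_set_conv_nth)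
  obtain j where j: "Suc j < length xs" "a \<in> {xs ! j, xs ! Suc j}"
  proof (cases "Suc l < length xs")
    case True then show ?thesis using that[of l] l by auto
  next
    case False then show ?thesis using that[of "l - 1"] l xs(2) by auto
  qed
  have less: "?r (xs ! j) (xs ! Suc j)" using ordn[of j "Suc j"] j by simp
  have "xs ! j \<noteq> xs ! Suc j" using less orient_same(3)[of s f g "xs ! j"] by auto
  moreover have "0 < t * orient s f (xs ! j) (xs ! Suc j) u" if u: "u \<in> set xs - {xs ! j, xs ! Suc j}" for u
  proof -
    obtain k where k: "k < length xs" "u = xs ! k" using u by (metis DiffD1 in_set_conv_nth)
    have "k \<noteq> j" "k \<noteq> Suc j" using u k by auto
    then consider "k < j" | "Suc j < k" by linarith
    then show ?thesis
    proof cases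
      case 1
      then have "0 < t * orient s f (xs ! k) (xs ! j) (xs ! Suc j)" using tr[of k j "Suc j"] j by simp
      then show ?thesis unfolding k(2) using orient_cyclic(1)[of s f "xs ! j" "xs ! Suc j" "xs ! k"] by simp
    next
      case 2 then show ?thesis using tr[of j "Suc j" k] k by simp
    qed
  qed
  ultimately show ?thesis using j less by (intro bexI[of _ "xs ! j"] bexI[of _ "xs ! Suc j"]) auto
qed

text \<open>Caps have the sign that \<open>good\<close> grants to the points of the other selected
  clusters, so the plane through a centre and two neighbours of its cap has the rest of the union on
  one side. Cups have the opposite sign and must supply all \<open>n\<close> points within one
  cluster; hence the lopsided binomial coefficient.\<close>

lemma (in clusters) convex_subset:
  assumes nonzero3: "\<And>i x y z f. i \<in> {1..m} \<Longrightarrow> {x, y, z} \<subseteq> X i \<Longrightarrow> distinct [x, y, z] \<Longrightarrow> f \<in> F \<Longrightarrow>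
      orient s (q f) x y z \<noteq> 0"
    and disj: "\<And>i j. i \<in> {1..m} \<Longrightarrow> j \<in> {1..m} \<Longrightarrow> i \<noteq> j \<Longrightarrow> X i \<inter> X j = {}"
    and m: "1 + (k + 1) ^ k \<le> m" and p: "2 \<le> p" and n: "2 \<le> n" "n \<le> k * p"
    and large: "\<And>i. i \<in> {1..m} \<Longrightarrow> ((p + n) choose p) ^ 256 \<le> card (X i)"
  shows "\<exists>U\<subseteq>(\<Union>i\<in>{1..m}. X i). card U = n \<and> (\<forall>a\<in>U. a \<notin> convex hull (U - {a}))"
proof -
  define b where "b = (p + n) choose p"
  have "(p + 1) choose p \<le> (p + n) choose p" using n by (intro binomial_right_mono) auto
  then have b2: "2 \<le> b" using p unfolding b_def by simp
  have "\<exists>S\<subseteq>{1..m}. card S = k \<and> (\<forall>i\<in>S. good b i (S - {i}))"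
    by (rule select_clusters[OF good_anti dichotomy m]) (use b2 large in \<open>auto simp: b_def\<close>)
  then obtain S where S: "S \<subseteq> {1..m}" "card S = k" "\<forall>i\<in>S. good b i (S - {i})" by blast
  have "\<exists>Y f g. Y \<subseteq> X i \<and> card Y = b \<and> f \<in> F \<and> g \<in> F \<and> f \<noteq> g \<and>
    (\<forall>x\<in>Y. \<forall>y\<in>Y. 0 < orient s (q f) (q g) x y \<longrightarrow> (\<forall>j\<in>S - {i}. \<forall>u\<in>X j. 0 < orient s (q f) x y u))"
    if "i \<in> S" for i
  proof -
    have "good b i (S - {i})" using S(3) that by simp
    then show ?thesis unfolding good_def by (elim exE bexE conjE) (intro exI conjI; assumption)
  qed
  then obtain Y f g where Y: "\<And>i. i \<in> S \<Longrightarrow> Y i \<subseteq> X i \<and> card (Y i) = b \<and> f i \<in> F \<and> g i \<in> F \<and> f i \<noteq> g i \<and>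
    (\<forall>x\<in>Y i. \<forall>y\<in>Y i. 0 < orient s (q (f i)) (q (g i)) x y \<longrightarrow> (\<forall>j\<in>S - {i}. \<forall>u\<in>X j. 0 < orient s (q (f i)) x y u))"
    by metis
  let ?r = "\<lambda>i x y. 0 < orient s (q (f i)) (q (g i)) x y"
  let ?P = "\<lambda>t i x y z. 0 < t * orient s (q (f i)) x y z"
  have ord: "strict_order_on (Y i) (?r i)" if "i \<in> S" for i
    using strict_order_on_subset[OF frame_order] Y[OF that] S(1) that by blast
  have "finite (Y i)" if "i \<in> S" for i
    using Y[OF that] fin S(1) that finite_subset by blast
  then have cc: "(\<exists>xs. set xs \<subseteq> Y i \<and> length xs = p \<and> cap (?r i) (?P 1 i) xs) \<or>
      (\<exists>xs. set xs \<subseteq> Y i \<and> length xs = n \<and> cap (?r i) (\<lambda>x y z. \<not> ?P 1 i x y z) xs)" if "i \<in> S" for i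
    by (intro cups_caps[OF _ ord]) (use Y that in \<open>auto simp: b_def\<close>)
  show ?thesis
  proof (cases "\<exists>i\<in>S. \<exists>xs. set xs \<subseteq> Y i \<and> length xs = n \<and> cap (?r i) (\<lambda>x y z. \<not> ?P 1 i x y z) xs")
    case True
    then obtain i xs where i: "i \<in> S" "set xs \<subseteq> Y i" "length xs = n" "cap (?r i) (\<lambda>x y z. \<not> ?P 1 i x y z) xs"
      by blast
    have im: "i \<in> {1..m}" using S(1) i(1) by auto
    have sorted: "sorted_wrt (?r i) xs" using i(4) unfolding cap_def by auto
    have dist: "xs ! l \<noteq> xs ! l'" if "l < l'" "l' < length xs" for l l'
      using sorted_wrt_nth_less[OF sorted that] orient_same(3)[of s "q (f i)" "q (g i)" "xs ! l"] by auto
    have "cap (?r i) (?P (-1) i) xs" unfolding cap_def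
    proof (intro conjI allI impI sorted)
      fix l assume l: "l + 2 < length xs"
      have "\<not> ?P 1 i (xs ! l) (xs ! (l + 1)) (xs ! (l + 2))" by (rule i(4)[unfolded cap_def, THEN conjunct2, rule_format, OF l])
      moreover have "orient s (q (f i)) (xs ! l) (xs ! (l + 1)) (xs ! (l + 2)) \<noteq> 0"
      proof (rule nonzero3[OF im])
        show "{xs ! l, xs ! (l + 1), xs ! (l + 2)} \<subseteq> X i" 
        proof -
          have "set xs \<subseteq> X i" using i(2) Y[OF i(1)] by blast
          then show ?thesis using l nth_mem[of l xs] nth_mem[of "l + 1" xs] nth_mem[of "l + 2" xs] by auto
        qed
        show "distinct [xs ! l, xs ! (l + 1), xs ! (l + 2)]"
          using dist[of l "l + 1"] dist[of l "l + 2"] dist[of "l + 1" "l + 2"] l by simp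
        show "f i \<in> F" using Y[OF i(1)] by blast
      qed
      ultimately show "?P (-1) i (xs ! l) (xs ! (l + 1)) (xs ! (l + 2))" by linarith
    qed
    note edge = cap_edge[OF ord[OF i(1)] i(2) _ this]
    have "a \<notin> convex hull (set xs - {a})" if a: "a \<in> set xs" for a
    proof -
      obtain x y where xy: "x \<noteq> y" "a \<in> {x, y}" "\<forall>u\<in>set xs - {x, y}. 0 < -1 * orient s (q (f i)) x y u"
        using edge[OF _ a] n i(3) by blast
      show ?thesis
        using not_in_hull_of_rest[OF xy(1), of "set xs" "-1 * s" "q (f i)"] xy(2,3)
        unfolding orient_scale by blast
    qed
    moreover have "distinct xs" using dist by (metis distinct_conv_nth linorder_neqE_nat)
    then have "card (set xs) = n" using i(3) distinct_card by blast
    moreover have "set xs \<subseteq> (\<Union>i\<in>{1..m}. X i)" using i(2) Y[OF i(1)] im by blast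
    ultimately show ?thesis by blast
  next
    case False
    then have "\<exists>xs. set xs \<subseteq> Y i \<and> length xs = p \<and> cap (?r i) (?P 1 i) xs" if "i \<in> S" for i
      using cc that by blast
    then obtain xs where xs: "\<And>i. i \<in> S \<Longrightarrow> set (xs i) \<subseteq> Y i \<and> length (xs i) = p \<and> cap (?r i) (?P 1 i) (xs i)"
      by metis
    define U where "U = (\<Union>i\<in>S. set (xs i))"
    have ext: "a \<notin> convex hull (U - {a})" if a: "a \<in> U" for a
    proof -
      obtain i where i: "i \<in> S" "a \<in> set (xs i)" using a unfolding U_def by blast
      obtain x y where xy: "x \<in> set (xs i)" "y \<in> set (xs i)" "x \<noteq> y" "a \<in> {x, y}" "?r i x y"
        "\<forall>u\<in>set (xs i) - {x, y}. 0 < 1 * orient s (q (f i)) x y u"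
        using cap_edge[OF ord[OF i(1)], of "xs i" 1 a] xs[OF i(1)] p i(2) by blast
      have "0 < orient s (q (f i)) x y u" if u: "u \<in> U - {x, y}" for u
      proof -
        obtain j where j: "j \<in> S" "u \<in> set (xs j)" using u unfolding U_def by blast
        show ?thesis
        proof (cases "j = i")
          case True
          then show ?thesis using xy(6) j u by (metis Diff_iff mult_1)
        next
          case False
          have "u \<in> X j" using xs[OF j(1)] Y[OF j(1)] j(2) by blast
          moreover have "x \<in> Y i" "y \<in> Y i" using xy xs[OF i(1)] by blast+
          ultimately show ?thesis using Y[OF i(1)] xy(5) j(1) False by blast
        qed
      qed
      then show ?thesis using not_in_hull_of_rest[OF xy(3), of U s "q (f i)"] xy(4) by blast
    qed
    have dist: "card (set (xs i)) = p" if i: "i \<in> S" for i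
    proof -
      have sorted: "sorted_wrt (?r i) (xs i)" using xs[OF i] unfolding cap_def by blast
      have "xs i ! l \<noteq> xs i ! l'" if "l < l'" "l' < length (xs i)" for l l'
        using sorted_wrt_nth_less[OF sorted that] orient_same(3)[of s "q (f i)" "q (g i)" "xs i ! l"] by auto
      then have "distinct (xs i)" by (metis distinct_conv_nth linorder_neqE_nat)
      then show ?thesis using xs[OF i] distinct_card by metis
    qed
    have "card U = (\<Sum>i\<in>S. card (set (xs i)))" unfolding U_def
    proof (rule card_UN_disjoint)
      show "finite S" using S(1) finite_subset by blast
      show "\<forall>i\<in>S. \<forall>j\<in>S. i \<noteq> j \<longrightarrow> set (xs i) \<inter> set (xs j) = {}"
      proof (intro ballI impI)
        fix i j assume ij: "i \<in> S" "j \<in> S" "i \<noteq> j"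
        have "X i \<inter> X j = {}" using disj ij S(1) by blast
        then show "set (xs i) \<inter> set (xs j) = {}" using xs[OF ij(1)] xs[OF ij(2)] Y[OF ij(1)] Y[OF ij(2)] by blast
      qed
    qed simp
    then have "card U = k * p" using dist S(2) by simp
    then obtain V where V: "V \<subseteq> U" "card V = n" using n by (metis obtain_subset_with_card_n)
    have "a \<notin> convex hull (V - {a})" if "a \<in> V" for a
      using ext[of a] that V(1) hull_mono[of "V - {a}" "U - {a}" convex] by blast
    moreover have "V \<subseteq> (\<Union>i\<in>{1..m}. X i)"
    proof
      fix a assume "a \<in> V"
      then obtain i where i: "i \<in> S" "a \<in> set (xs i)" using V(1) unfolding U_def by blast
      then have "a \<in> X i" using xs[OF i(1)] Y[OF i(1)] by (meson subsetD)
      then show "a \<in> (\<Union>i\<in>{1..m}. X i)" using S(1) i(1) by blast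
    qed
    ultimately show ?thesis using V(2) by blast
  qed
qed

subsection \<open>Supersaturation\<close>

lemma disjoint_blocks:
  assumes "finite P" "r * n \<le> card P"
  shows "\<exists>B. (\<forall>j<r. B j \<subseteq> P \<and> card (B j) = n) \<and> (\<forall>i<r. \<forall>j<r. i \<noteq> j \<longrightarrow> B i \<inter> B j = {})"
  using assms
proof (induction r arbitrary: P)
  case (Suc r)
  then have "n \<le> card P" by simp
  then obtain A where A: "A \<subseteq> P" "card A = n" by (meson obtain_subset_with_card_n)
  have "r * n \<le> card (P - A)" using Suc.prems A card_Diff_subset[OF finite_subset[OF A(1)]] by simp
  then obtain B where B: "\<forall>j<r. B j \<subseteq> P - A \<and> card (B j) = n" "\<forall>i<r. \<forall>j<r. i \<noteq> j \<longrightarrow> B i \<inter> B j = {}"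
    using Suc.IH[of "P - A"] Suc.prems by auto
  define B' where "B' j = (if j = r then A else B j)" for j
  have "B' j \<subseteq> P \<and> card (B' j) = n" if "j < Suc r" for j
  proof (cases "j = r")
    case False
    then have "B j \<subseteq> P - A \<and> card (B j) = n" using B(1) that by simp
    then show ?thesis using False unfolding B'_def by auto
  qed (use A in \<open>simp add: B'_def\<close>)
  moreover have "B' i \<inter> B' j = {}" if "i < Suc r" "j < Suc r" "i \<noteq> j" for i j
  proof -
    have "B l \<inter> A = {}" if "l < r" for l using B(1) that by blast
    moreover have "B' l = B l" if "l \<noteq> r" for l using that unfolding B'_def by simp
    moreover have "B' r = A" unfolding B'_def by simp
    ultimately show ?thesis using B(2) that by (metis Int_commute less_SucE)
  qed
  ultimately show ?case by blast
qed auto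

lemma homogeneous_alternating:
  assumes R: "ramsey_bound 4 L R"
    and nz: "\<And>a b c d. a < b \<Longrightarrow> b < c \<Longrightarrow> c < d \<Longrightarrow> d < R \<Longrightarrow> orient 1 (w a) (w b) (w c) (w d) \<noteq> 0"
  shows "\<exists>H\<subseteq>{..<R}. card H = L \<and> (\<exists>t\<in>{-1, 1}. alternating t w H)"
proof -
  define f where "f T = (let xs = sorted_list_of_set T in 0 < orient 1 (w (xs ! 0)) (w (xs ! 1)) (w (xs ! 2)) (w (xs ! 3)))"
    for T :: "nat set"
  obtain H b where H: "H \<subseteq> {..<R}" "card H = L" "\<forall>T\<subseteq>H. card T = 4 \<longrightarrow> f T = b"
    using R[unfolded ramsey_bound_def, rule_format, of "{..<R}" f] by auto
  define t :: real where "t = (if b then 1 else -1)"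
  have "alternating t w H" unfolding alternating_def
  proof (intro ballI impI)
    fix i j k l assume el: "i \<in> H" "j \<in> H" "k \<in> H" "l \<in> H" and lt: "i < j" "j < k" "k < l"
    have c: "card {i, j, k, l} = 4" using lt by simp
    have "sorted_list_of_set {i, j, k, l} = [i, j, k, l]"
      by (rule sorted_list_of_set_unique[THEN iffD1]) (use lt in auto)
    then have "f {i, j, k, l} \<longleftrightarrow> 0 < orient 1 (w i) (w j) (w k) (w l)"
      unfolding f_def by (simp add: numeral_2_eq_2 numeral_3_eq_3)
    moreover have "f {i, j, k, l} = b" using H(3) el c by simp
    moreover have "orient 1 (w i) (w j) (w k) (w l) \<noteq> 0" using nz lt el H(1) by auto
    moreover have "orient t (w i) (w j) (w k) (w l) = t * orient 1 (w i) (w j) (w k) (w l)"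
      using orient_scale[of t 1] by simp
    ultimately show "0 < orient t (w i) (w j) (w k) (w l)" unfolding t_def by (cases b) auto
  qed
  moreover have "t \<in> {-1, 1}" unfolding t_def by simp
  ultimately show ?thesis using H by blast
qed

text \<open>Averaging over all transversals of the blocks: many of them have their homogeneous subset at the same
  place and also share the points outside the positions \<open>C\<close>.\<close>

lemma supersaturation:
  assumes R: "ramsey_bound 4 L R" and LR: "L \<le> R"
    and B: "\<And>j. j < R \<Longrightarrow> finite (B j) \<and> card (B j) = n" and n: "0 < n"
    and nz: "\<And>w a b c d. w \<in> PiE {..<R} B \<Longrightarrow> a < b \<Longrightarrow> b < c \<Longrightarrow> c < d \<Longrightarrow> d < R \<Longrightarrow>
      orient 1 (w a) (w b) (w c) (w d) \<noteq> 0"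
    and C: "C \<subseteq> {..<L}"
  shows "\<exists>\<Omega> e t. \<Omega> \<noteq> {} \<and> \<Omega> \<subseteq> PiE {..<R} B \<and> t \<in> {-1, 1} \<and> strict_mono_on {..<L} e \<and> e ` {..<L} \<subseteq> {..<R} \<and>
    (\<forall>w\<in>\<Omega>. alternating t (\<lambda>p. w (e p)) {..<L}) \<and>
    (\<forall>w\<in>\<Omega>. \<forall>w'\<in>\<Omega>. \<forall>p\<in>{..<L} - C. w (e p) = w' (e p)) \<and>
    (\<forall>p\<in>C. n \<le> 2 * R ^ L * card ((\<lambda>w. w (e p)) ` \<Omega>))"
proof -
  define A where "A = PiE {..<R} B"
  define HH where "HH = {H. H \<subseteq> {..<R} \<and> card H = L}"
  define en where "en H p = sorted_list_of_set H ! p" for H :: "nat set" and p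
  define rest where "rest H = {..<R} - en H ` C" for H
  have en: "strict_mono_on {..<L} (en H)" "en H ` {..<L} = H" if "H \<in> HH" for H
  proof -
    have H: "finite H" "card H = L" using that finite_subset unfolding HH_def by auto
    have len: "length (sorted_list_of_set H) = L" using H by simp
    show "strict_mono_on {..<L} (en H)" unfolding en_def
      by (rule strict_mono_onI) (use len in \<open>auto intro: sorted_wrt_nth_less[OF strict_sorted_list_of_set]\<close>)
    have "en H ` {..<L} = set (sorted_list_of_set H)" unfolding en_def set_conv_nth len by auto
    then show "en H ` {..<L} = H" using H by simp
  qed
  have inj: "inj_on (en H) C" if "H \<in> HH" for H
    using strict_mono_on_imp_inj_on[OF en(1)[OF that]] C inj_on_subset by blast
  have finC: "finite C" using C finite_subset by blast
  have "\<exists>H t. H \<in> HH \<and> t \<in> {-1, 1} \<and> alternating t w H" if w: "w \<in> A" for w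
    using homogeneous_alternating[OF R, of w] nz w unfolding A_def HH_def by blast
  then obtain hh tt where ht: "\<And>w. w \<in> A \<Longrightarrow> hh w \<in> HH \<and> tt w \<in> {-1, 1} \<and> alternating (tt w) w (hh w)"
    by metis
  \<comment> \<open>The label of a transversal: place and sign of its homogeneous subset, and its
    points in all blocks except those at the positions \<open>C\<close> of this subset. There are at
    most \<open>2 * R ^ L * n ^ (R - card C)\<close> labels.\<close>
  define \<Phi> where "\<Phi> w = ((hh w, tt w), restrict w (rest (hh w)))" for w
  define K where "K = Sigma (HH \<times> {-1, 1 :: real}) (\<lambda>h. PiE (rest (fst h)) B)"
  have finHH: "finite HH" unfolding HH_def by simp
  have cardHH: "card HH \<le> R ^ L"
  proof -
    have "card HH = R choose L" unfolding HH_def using n_subsets[of "{..<R}" L] by simp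
    then show ?thesis using binomial_le_pow[OF LR] by simp
  qed
  have cardPi: "card (PiE I B) = n ^ card I" "finite (PiE I B)" if "I \<subseteq> {..<R}" for I
  proof -
    have fI: "finite I" using that finite_subset by blast
    have "card (PiE I B) = (\<Prod>i\<in>I. card (B i))" using card_PiE[OF fI] by auto
    also have "\<dots> = (\<Prod>i\<in>I. n)" using that B by (intro prod.cong) auto
    finally show "card (PiE I B) = n ^ card I" by simp
    show "finite (PiE I B)" using that B by (intro finite_PiE fI) auto
  qed
  have rest: "rest H \<subseteq> {..<R}" "card (rest H) = R - card C" "en H ` C \<subseteq> {..<R}" "card C \<le> R" if H: "H \<in> HH" for H
  proof -
    have sub: "en H ` C \<subseteq> {..<R}" using en(2)[OF H] C H unfolding HH_def by blast
    then show "en H ` C \<subseteq> {..<R}" .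
    show "rest H \<subseteq> {..<R}" unfolding rest_def by blast
    have ci: "card (en H ` C) = card C" using card_image[OF inj[OF H]] .
    then show "card (rest H) = R - card C" unfolding rest_def
      using card_Diff_subset[of "en H ` C" "{..<R}"] sub finC by simp
    show "card C \<le> R" using card_mono[OF _ sub] ci by simp
  qed
  have finK: "finite K" unfolding K_def
    by (intro finite_SigmaI) (use finHH cardPi(2)[OF rest(1)] in auto)
  have "card K = (\<Sum>h\<in>HH \<times> {-1, 1 :: real}. card (PiE (rest (fst h)) B))" unfolding K_def
    by (intro card_SigmaI) (use finHH cardPi(2)[OF rest(1)] in auto)
  also have "\<dots> = (\<Sum>h\<in>HH \<times> {-1, 1 :: real}. n ^ (R - card C))"
    by (intro sum.cong) (use cardPi(1)[OF rest(1)] rest(2) in auto)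
  also have "\<dots> = card HH * 2 * n ^ (R - card C)" by (simp add: card_cartesian_product)
  finally have cardK: "card K = card HH * 2 * n ^ (R - card C)" .
  have finA: "finite A" and cardA: "card A = n ^ R" unfolding A_def using cardPi[of "{..<R}"] by auto
  then have "A \<noteq> {}" using n by (metis card.empty less_not_refl zero_less_power)
  moreover have "\<Phi> ` A \<subseteq> K"
  proof
    fix y assume "y \<in> \<Phi> ` A"
    then obtain w where w: "w \<in> A" "y = \<Phi> w" by blast
    have "restrict w (rest (hh w)) \<in> PiE (rest (hh w)) B"
      using w(1) rest(1)[of "hh w"] ht[OF w(1)] unfolding A_def by auto
    then show "y \<in> K" using ht[OF w(1)] unfolding w(2) \<Phi>_def K_def by auto
  qed
  ultimately obtain \<kappa> where \<kappa>: "\<kappa> \<in> K" "card A \<le> card {w\<in>A. \<Phi> w = \<kappa>} * card K"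
    using pigeonhole_fibre[OF finA finK] by blast
  obtain H t v where k: "\<kappa> = ((H, t), v)" "H \<in> HH" "t \<in> {-1, 1}" using \<kappa>(1) unfolding K_def by auto
  define \<Omega> where "\<Omega> = {w\<in>A. \<Phi> w = \<kappa>}"
  have Om: "w \<in> A" "hh w = H" "tt w = t" "restrict w (rest H) = v" if "w \<in> \<Omega>" for w
    using that unfolding \<Omega>_def \<Phi>_def k(1) by auto
  have finOm: "finite \<Omega>" using finA unfolding \<Omega>_def by auto
  have agree: "w x = w' x" if "w \<in> \<Omega>" "w' \<in> \<Omega>" "x \<in> rest H" for w w' x
    using Om(4)[OF that(1)] Om(4)[OF that(2)] that(3) by (metis restrict_apply')
  have "n ^ (R - card C) * n ^ card C \<le> card \<Omega> * (card HH * 2 * n ^ (R - card C))"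
    using \<kappa>(2) cardK cardA rest(4)[OF k(2)] unfolding \<Omega>_def by (simp flip: power_add)
  then have "n ^ (R - card C) * n ^ card C \<le> n ^ (R - card C) * (card \<Omega> * (card HH * 2))"
    by (simp add: ac_simps)
  then have OmC: "n ^ card C \<le> card \<Omega> * (card HH * 2)" using n by simp
  have proj: "n \<le> 2 * R ^ L * card ((\<lambda>w. w (en H p)) ` \<Omega>)" if p: "p \<in> C" for p
  proof -
    let ?X = "(\<lambda>w. w (en H p)) ` \<Omega>" and ?I = "en H ` (C - {p})"
    \<comment> \<open>Members of \<open>\<Omega>\<close> differ only in the blocks belonging to
      \<open>C\<close>, so each is determined by its point at \<open>p\<close> and its points at the
      other \<open>card C - 1\<close> positions. With few points at \<open>p\<close>, the set
      \<open>\<Omega>\<close> would be too small.\<close>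
    define \<Psi> where "\<Psi> w = (w (en H p), restrict w ?I)" for w :: "nat \<Rightarrow> r3"
    have I: "?I \<subseteq> {..<R}" using rest(3)[OF k(2)] by blast
    have "inj_on \<Psi> \<Omega>"
    proof (rule inj_onI)
      fix w w' assume w: "w \<in> \<Omega>" "w' \<in> \<Omega>" "\<Psi> w = \<Psi> w'"
      have "w x = w' x" for x
      proof (cases "x \<in> {..<R}")
        case False
        then show ?thesis using Om(1)[OF w(1)] Om(1)[OF w(2)] unfolding A_def by (metis PiE_arb)
      next
        case True
        then consider "x \<in> rest H" | "x = en H p" | "x \<in> ?I" unfolding rest_def by blast
        then show ?thesis
        proof cases
          case 1 then show ?thesis using agree w by blast
        next
          case 2 then show ?thesis using w(3) unfolding \<Psi>_def by simp
        next
          case 3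
          have "restrict w ?I = restrict w' ?I" using w(3) unfolding \<Psi>_def by simp
          then show ?thesis using 3 by (metis restrict_apply')
        qed
      qed
      then show "w = w'" by blast
    qed
    moreover have "\<Psi> ` \<Omega> \<subseteq> ?X \<times> PiE ?I B"
    proof
      fix y assume "y \<in> \<Psi> ` \<Omega>"
      then obtain w where w: "w \<in> \<Omega>" "y = \<Psi> w" by blast
      have "restrict w ?I \<in> PiE ?I B" using Om(1)[OF w(1)] I unfolding A_def by auto
      then show "y \<in> ?X \<times> PiE ?I B" using w unfolding \<Psi>_def by blast
    qed
    moreover have "finite (?X \<times> PiE ?I B)" using finOm cardPi(2)[OF I] by blast
    ultimately have "card \<Omega> \<le> card (?X \<times> PiE ?I B)" using card_inj_on_le by blast
    also have "\<dots> = card ?X * n ^ card ?I" using cardPi(1)[OF I] by (simp add: card_cartesian_product)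
    also have "card ?I = card C - 1"
      using card_image[OF inj_on_subset[OF inj[OF k(2)], of "C - {p}"]] p finC by simp
    finally have le: "card \<Omega> \<le> card ?X * n ^ (card C - 1)" .
    have "card C = Suc (card C - 1)" using p finC by (metis Suc_pred' card_gt_0_iff empty_iff)
    then have "n ^ card C = n ^ (card C - 1) * n" by (metis power_Suc mult.commute)
    then have "n ^ (card C - 1) * n \<le> card ?X * n ^ (card C - 1) * (card HH * 2)"
      using OmC mult_le_mono1[OF le, of "card HH * 2"] by linarith
    then have "n ^ (card C - 1) * n \<le> n ^ (card C - 1) * (2 * card HH * card ?X)" by (simp add: ac_simps)
    then have "n \<le> 2 * card HH * card ?X" using n by simp
    also have "\<dots> \<le> 2 * R ^ L * card ?X" using cardHH by simp
    finally show ?thesis .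
  qed
  have "\<Omega> \<noteq> {}" using OmC n by fastforce
  moreover have "\<Omega> \<subseteq> PiE {..<R} B" using Om(1) unfolding A_def by blast
  moreover have "strict_mono_on {..<L} (en H)" "en H ` {..<L} \<subseteq> {..<R}"
    using en[OF k(2)] k(2) unfolding HH_def by auto
  moreover have "alternating t (\<lambda>p. w (en H p)) {..<L}" if w: "w \<in> \<Omega>" for w
    unfolding alternating_def
  proof (intro ballI impI)
    fix i j l r assume el: "i \<in> {..<L}" "j \<in> {..<L}" "l \<in> {..<L}" "r \<in> {..<L}" and lt: "i < j" "j < l" "l < r"
    have "alternating t w H" using ht[OF Om(1)[OF w]] Om(2,3)[OF w] by simp
    then show "0 < orient t (w (en H i)) (w (en H j)) (w (en H l)) (w (en H r))"
      by (rule alternatingD) (use en[OF k(2)] el lt strict_mono_onD[OF en(1)[OF k(2)]] in blast)+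
  qed
  moreover have "w (en H p) = w' (en H p)" if "w \<in> \<Omega>" "w' \<in> \<Omega>" "p \<in> {..<L} - C" for w w' p
  proof (rule agree[OF that(1,2)])
    have "en H p \<notin> en H ` C"
      using strict_mono_on_imp_inj_on[OF en(1)[OF k(2)]] that(3) C by (meson DiffD1 DiffD2 inj_on_image_mem_iff)
    then show "en H p \<in> rest H" using en(2)[OF k(2)] k(2) that(3) unfolding rest_def HH_def by blast
  qed
  ultimately show ?thesis using proj k(3)
    by (intro exI[of _ \<Omega>] exI[of _ "en H"] exI[of _ t] conjI ballI) blast+
qed

lemma convex_subset_of_space:
  fixes P :: "r3 set"
  assumes fin: "finite P"
    and nz: "\<And>a b c d. {a, b, c, d} \<subseteq> P \<Longrightarrow> distinct [a, b, c, d] \<Longrightarrow> orient 1 a b c d \<noteq> 0"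
    and p: "2 \<le> p" and n: "2 \<le> n" "n \<le> k * p"
    and m: "m = 1 + (k + 1) ^ k" and L: "L = 8 * m + 16" and R: "ramsey_bound 4 L R" "L \<le> R"
    and card: "R * (2 * R ^ L * ((p + n) choose p) ^ 256) \<le> card P"
  shows "\<exists>U\<subseteq>P. card U = n \<and> (\<forall>a\<in>U. a \<notin> convex hull (U - {a}))"
proof -
  define M where "M = ((p + n) choose p) ^ 256"
  \<comment> \<open>The block size is the required cluster size \<open>M\<close> times the loss
    \<open>2 * R ^ L\<close> of \<open>supersaturation\<close>.\<close>
  define N where "N = 2 * R ^ L * M"
  have M0: "0 < M" unfolding M_def by simp
  have R0: "0 < R" using R(2) L by simp
  have N0: "0 < N" using M0 R0 unfolding N_def by simp
  have "R * N \<le> card P" using card unfolding N_def M_def .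
  then obtain B where "\<forall>j<R. B j \<subseteq> P \<and> card (B j) = N"
    "\<forall>i<R. \<forall>j<R. i \<noteq> j \<longrightarrow> B i \<inter> B j = {}"
    using disjoint_blocks[OF fin] by blast
  then have B: "\<And>j. j < R \<Longrightarrow> B j \<subseteq> P \<and> card (B j) = N"
    "\<And>i j. i < R \<Longrightarrow> j < R \<Longrightarrow> i \<noteq> j \<Longrightarrow> B i \<inter> B j = {}"
    by simp_all
  have diff: "x \<noteq> y" if "x \<in> B i" "y \<in> B j" "i < R" "j < R" "i \<noteq> j" for x y i j
    using B(2)[of i j] that by blast
  define C where "C = (\<lambda>i. 8 * i) ` {1..m}"
  have C: "C \<subseteq> {..<L}" unfolding C_def L by auto
  have "\<exists>\<Omega> e t. \<Omega> \<noteq> {} \<and> \<Omega> \<subseteq> PiE {..<R} B \<and> t \<in> {-1, 1} \<and> strict_mono_on {..<L} e \<and> e ` {..<L} \<subseteq> {..<R} \<and>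
    (\<forall>w\<in>\<Omega>. alternating t (\<lambda>p. w (e p)) {..<L}) \<and>
    (\<forall>w\<in>\<Omega>. \<forall>w'\<in>\<Omega>. \<forall>p\<in>{..<L} - C. w (e p) = w' (e p)) \<and>
    (\<forall>p\<in>C. N \<le> 2 * R ^ L * card ((\<lambda>w. w (e p)) ` \<Omega>))"
  proof (rule supersaturation[OF R _ N0 _ C])
    show "finite (B j) \<and> card (B j) = N" if "j < R" for j using B(1)[OF that] fin finite_subset by blast
    fix w a b c d assume w: "w \<in> PiE {..<R} B" and lt: "a < b" "b < c" "c < d" "d < R"
    have mem: "w a \<in> B a" "w b \<in> B b" "w c \<in> B c" "w d \<in> B d" using PiE_mem[OF w] lt by simp_all
    have "distinct [w a, w b, w c, w d]"
      using diff[OF mem(1,2)] diff[OF mem(1,3)] diff[OF mem(1,4)] diff[OF mem(2,3)] diff[OF mem(2,4)]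
        diff[OF mem(3,4)] lt by simp
    moreover have "B a \<subseteq> P" "B b \<subseteq> P" "B c \<subseteq> P" "B d \<subseteq> P" using B(1) lt by simp_all
    then have "{w a, w b, w c, w d} \<subseteq> P" using mem by blast
    ultimately show "orient 1 (w a) (w b) (w c) (w d) \<noteq> 0" using nz by blast
  qed
  then obtain \<Omega> e t where "\<Omega> \<noteq> {} \<and> \<Omega> \<subseteq> PiE {..<R} B \<and> t \<in> {-1, 1} \<and> strict_mono_on {..<L} e \<and> e ` {..<L} \<subseteq> {..<R} \<and>
    (\<forall>w\<in>\<Omega>. alternating t (\<lambda>p. w (e p)) {..<L}) \<and>
    (\<forall>w\<in>\<Omega>. \<forall>w'\<in>\<Omega>. \<forall>p\<in>{..<L} - C. w (e p) = w' (e p)) \<and>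
    (\<forall>p\<in>C. N \<le> 2 * R ^ L * card ((\<lambda>w. w (e p)) ` \<Omega>))"
    by (elim exE) (rule that)
  then have Om: "\<Omega> \<noteq> {}" "\<Omega> \<subseteq> PiE {..<R} B" "t \<in> {-1, 1}" "strict_mono_on {..<L} e"
    "e ` {..<L} \<subseteq> {..<R}" "\<forall>w\<in>\<Omega>. alternating t (\<lambda>p. w (e p)) {..<L}"
    "\<forall>w\<in>\<Omega>. \<forall>w'\<in>\<Omega>. \<forall>p\<in>{..<L} - C. w (e p) = w' (e p)"
    "\<forall>p\<in>C. N \<le> 2 * R ^ L * card ((\<lambda>w. w (e p)) ` \<Omega>)"
    by - (elim conjE, assumption)+
  obtain w0 where w0: "w0 \<in> \<Omega>" using Om(1) by blast
  \<comment> \<open>The transversals in \<open>\<Omega>\<close> agree outside \<open>C\<close>, so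
    any one of them supplies the frame.\<close>
  define q where "q p = w0 (e p)" for p
  define X where "X i = (\<lambda>w. w (e (8 * i))) ` \<Omega>" for i
  define F where "F = {p. p < 8 * m + 16 \<and> \<not> (8 dvd p \<and> 8 \<le> p \<and> p \<le> 8 * m)}"
  have F: "F = {..<L} - C"
  proof -
    have "8 dvd p \<and> 8 \<le> p \<and> p \<le> 8 * m \<longleftrightarrow> p \<in> C" for p
      unfolding C_def by (auto simp: image_iff elim!: dvdE)
    then show ?thesis unfolding F_def L by auto
  qed
  have pos: "8 * i < L" "8 * i \<in> C" if "i \<in> {1..m}" for i using that unfolding L C_def by auto
  have eR: "e p < R" if "p < L" for p using Om(5) that by blast
  have einj: "e p \<noteq> e p'" if "p < L" "p' < L" "p \<noteq> p'" for p p'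
    using strict_mono_on_imp_inj_on[OF Om(4)] that by (meson inj_on_eq_iff lessThan_iff)
  have XB: "X i \<subseteq> B (e (8 * i))" if "i \<in> {1..m}" for i
  proof
    fix x assume "x \<in> X i"
    then obtain w where w: "w \<in> \<Omega>" "x = w (e (8 * i))" unfolding X_def by blast
    then have "w \<in> PiE {..<R} B" using Om(2) by blast
    then show "x \<in> B (e (8 * i))" unfolding w(2) by (rule PiE_mem) (use eR[OF pos(1)[OF that]] in simp)
  qed
  have qB: "q f \<in> B (e f)" if "f < L" for f
  proof -
    have "w0 \<in> PiE {..<R} B" using Om(2) w0 by blast
    then show ?thesis unfolding q_def by (rule PiE_mem) (use eR[OF that] in simp)
  qed
  have BP: "B (e f) \<subseteq> P" if "f < L" for f using B(1)[OF eR[OF that]] by blast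
  have t0: "t \<noteq> 0" using Om(3) by auto
  have Dt: "orient t a b c d = t * orient 1 a b c d" for a b c d using orient_scale[of t 1] by simp
  have FL: "f < L" "f \<noteq> 8 * i" if "f \<in> F" "i \<in> {1..m}" for f i using that pos(2)[of i] unfolding F by auto
  have cl: "clusters t m X q"
  proof (unfold_locales, fold F_def)
    fix i x assume i: "i \<in> {1..m}" and x: "x \<in> X i"
    then obtain w where w: "w \<in> \<Omega>" "x = w (e (8 * i))" unfolding X_def by blast
    show "alternating t (q(8 * i := x)) (insert (8 * i) F)" unfolding alternating_def
    proof (intro ballI impI)
      have eq: "(q(8 * i := x)) p = w (e p)" "p < L" if "p \<in> insert (8 * i) F" for p
        using that w Om(7) w0 pos[OF i] unfolding q_def F by auto
      fix a b c d assume el: "a \<in> insert (8 * i) F" "b \<in> insert (8 * i) F" "c \<in> insert (8 * i) F" "d \<in> insert (8 * i) F"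
        and lt: "a < b" "b < c" "c < d"
      have "alternating t (\<lambda>p. w (e p)) {..<L}" using Om(6) w(1) by blast
      then have "0 < orient t (w (e a)) (w (e b)) (w (e c)) (w (e d))"
        using alternatingD[of t "\<lambda>p. w (e p)" "{..<L}" a b c d] eq(2)[OF el(1)] eq(2)[OF el(2)] eq(2)[OF el(3)]
          eq(2)[OF el(4)] lt by simp
      then show "0 < orient t ((q(8 * i := x)) a) ((q(8 * i := x)) b) ((q(8 * i := x)) c) ((q(8 * i := x)) d)"
        unfolding eq(1)[OF el(1)] eq(1)[OF el(2)] eq(1)[OF el(3)] eq(1)[OF el(4)] .
    qed
  next
    fix i x y f g assume i: "i \<in> {1..m}" and xy: "x \<in> X i" "y \<in> X i" "x \<noteq> y" and fg: "f \<in> F" "g \<in> F" "f \<noteq> g"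
    have f: "f < L" "f \<noteq> 8 * i" and g: "g < L" "g \<noteq> 8 * i" using FL fg i by blast+
    have mem: "x \<in> B (e (8 * i))" "y \<in> B (e (8 * i))" using XB[OF i] xy by blast+
    have "distinct [q f, q g, x, y]"
      using diff[OF qB[OF f(1)] qB[OF g(1)] eR eR einj] diff[OF qB[OF f(1)] mem(1) eR eR einj]
        diff[OF qB[OF f(1)] mem(2) eR eR einj] diff[OF qB[OF g(1)] mem(1) eR eR einj]
        diff[OF qB[OF g(1)] mem(2) eR eR einj] f g fg xy pos(1)[OF i] by simp
    moreover have "{q f, q g, x, y} \<subseteq> P" using qB[OF f(1)] qB[OF g(1)] mem BP f g pos(1)[OF i] by blast
    ultimately show "orient t (q f) (q g) x y \<noteq> 0" using nz t0 unfolding Dt by simp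
  next
    fix i assume "i \<in> {1..m}"
    then show "finite (X i)" using XB BP[OF pos(1)] fin finite_subset by (metis subset_trans)
  qed
  have "\<exists>U\<subseteq>(\<Union>i\<in>{1..m}. X i). card U = n \<and> (\<forall>a\<in>U. a \<notin> convex hull (U - {a}))"
  proof (rule clusters.convex_subset[OF cl, folded F_def, OF _ _ _ p n])
    fix i x y z f assume i: "i \<in> {1..m}" and xyz: "{x, y, z} \<subseteq> X i" "distinct [x, y, z]" and f: "f \<in> F"
    have f': "f < L" "f \<noteq> 8 * i" using FL f i by blast+
    have mem: "x \<in> B (e (8 * i))" "y \<in> B (e (8 * i))" "z \<in> B (e (8 * i))" using XB[OF i] xyz by blast+
    have "distinct [q f, x, y, z]"
      using diff[OF qB[OF f'(1)] mem(1) eR eR einj] diff[OF qB[OF f'(1)] mem(2) eR eR einj]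
        diff[OF qB[OF f'(1)] mem(3) eR eR einj] f' xyz pos(1)[OF i] by simp
    moreover have "{q f, x, y, z} \<subseteq> P" using qB[OF f'(1)] mem BP f' pos(1)[OF i] by blast
    ultimately show "orient t (q f) x y z \<noteq> 0" using nz t0 unfolding Dt by simp
  next
    fix i j assume ij: "i \<in> {1..m}" "j \<in> {1..m}" "i \<noteq> j"
    have "B (e (8 * i)) \<inter> B (e (8 * j)) = {}"
      using B(2)[OF eR[OF pos(1)[OF ij(1)]] eR[OF pos(1)[OF ij(2)]]] einj[OF pos(1)[OF ij(1)] pos(1)[OF ij(2)]] ij(3)
      by simp
    then show "X i \<inter> X j = {}" using XB[OF ij(1)] XB[OF ij(2)] by blast
  next
    fix i assume i: "i \<in> {1..m}"
    have "2 * R ^ L * M \<le> 2 * R ^ L * card (X i)" using Om(8) pos(2)[OF i] unfolding X_def N_def by blast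
    then show "((p + n) choose p) ^ 256 \<le> card (X i)" using R0 unfolding M_def by simp
  qed (simp add: m)
  then obtain U where U: "U \<subseteq> (\<Union>i\<in>{1..m}. X i)" "card U = n" "\<forall>a\<in>U. a \<notin> convex hull (U - {a})" by blast
  have "U \<subseteq> P" using U(1) XB BP pos(1) by blast
  then show ?thesis using U by blast
qed

subsection \<open>Points on hyperplanes\<close>

text \<open>Gaussian elimination: an unknown \<open>h\<close> with nonzero coefficient in equation
  \<open>j\<close> is eliminated from the other equations and finally receives the value that
  satisfies equation \<open>j\<close>.\<close>

lemma homogeneous_solution:
  fixes M :: "'j \<Rightarrow> 'i \<Rightarrow> real"
  assumes "finite J" "finite I" "card J < card I"
  shows "\<exists>c. (\<exists>i\<in>I. c i \<noteq> 0) \<and> (\<forall>j\<in>J. (\<Sum>i\<in>I. c i * M j i) = 0)"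
  using assms
proof (induction J arbitrary: I M)
  case empty
  then have "I \<noteq> {}" by auto
  then show ?case by (intro exI[of _ "\<lambda>_. 1"]) auto
next
  case (insert j J)
  show ?case
  proof (cases "\<forall>i\<in>I. M j i = 0")
    case True
    obtain c where "\<exists>i\<in>I. c i \<noteq> 0" "\<forall>j\<in>J. (\<Sum>i\<in>I. c i * M j i) = 0"
      using insert.IH[of I M] insert.prems insert.hyps by auto
    then show ?thesis using True by (intro exI[of _ c]) auto
  next
    case False
    then obtain h where h: "h \<in> I" "M j h \<noteq> 0" by blast
    have card: "card J < card (I - {h})" using insert.prems insert.hyps h by simp
    obtain c where c: "\<exists>i\<in>I - {h}. c i \<noteq> 0"
      "\<forall>j'\<in>J. (\<Sum>i\<in>I - {h}. c i * (M j' i - M j' h * M j i / M j h)) = 0"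
      using insert.IH[OF _ card, of "\<lambda>j' i. M j' i - M j' h * M j i / M j h"] insert.prems by auto
    define \<sigma> where "\<sigma> = (\<Sum>i\<in>I - {h}. c i * M j i)"
    define e where "e i = (if i = h then - \<sigma> / M j h else c i)" for i
    have sum: "(\<Sum>i\<in>I. e i * M j' i) = (\<Sum>i\<in>I - {h}. c i * M j' i) - \<sigma> / M j h * M j' h" for j'
    proof -
      have "(\<Sum>i\<in>I. e i * M j' i) = e h * M j' h + (\<Sum>i\<in>I - {h}. e i * M j' i)"
        using h insert.prems by (simp add: sum.remove)
      also have "(\<Sum>i\<in>I - {h}. e i * M j' i) = (\<Sum>i\<in>I - {h}. c i * M j' i)"
        by (intro sum.cong) (auto simp: e_def)
      finally show ?thesis by (simp add: e_def)
    qed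
    have "(\<Sum>i\<in>I. e i * M j' i) = 0" if j': "j' \<in> insert j J" for j'
    proof (cases "j' = j")
      case True
      then show ?thesis unfolding sum using h by (simp add: \<sigma>_def)
    next
      case False
      have "(\<Sum>i\<in>I - {h}. c i * (M j' i - M j' h * M j i / M j h)) =
        (\<Sum>i\<in>I - {h}. c i * M j' i) - (\<Sum>i\<in>I - {h}. M j' h / M j h * (c i * M j i))"
        unfolding sum_subtractf[symmetric] by (intro sum.cong) (auto simp: algebra_simps)
      also have "\<dots> = (\<Sum>i\<in>I - {h}. c i * M j' i) - M j' h / M j h * \<sigma>"
        unfolding \<sigma>_def sum_distrib_left ..
      finally show ?thesis unfolding sum using c(2) j' False by (simp add: mult.commute)
    qed
    moreover have "\<exists>i\<in>I. e i \<noteq> 0" using c(1) unfolding e_def by auto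
    ultimately show ?thesis by blast
  qed
qed

definition dot :: "nat \<Rightarrow> point \<Rightarrow> point \<Rightarrow> real" where
  "dot d a x = (\<Sum>i<d. Poly_Mapping.lookup a i * Poly_Mapping.lookup x i)"

definition on_hyperplane :: "nat \<Rightarrow> point set \<Rightarrow> bool" where
  "on_hyperplane d Q \<longleftrightarrow> (\<exists>a\<in>Rd d. \<exists>b. a \<noteq> 0 \<and> (\<forall>x\<in>Q. dot d a x = b))"

lemma on_hyperplane_iff:
  "Q \<subseteq> Rd d \<Longrightarrow> on_hyperplane d Q \<longleftrightarrow> (\<exists>H. affine_hyperplane d H \<and> Q \<subseteq> H)"
  unfolding on_hyperplane_def affine_hyperplane_def dot_def by (auto 0 4)

lemma on_hyperplane_subset: "on_hyperplane d Q \<Longrightarrow> P \<subseteq> Q \<Longrightarrow> on_hyperplane d P"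
  unfolding on_hyperplane_def by (meson subsetD)

lemma lookup_scaleR: "Poly_Mapping.lookup (r *\<^sub>R x) i = r * Poly_Mapping.lookup (x :: point) i"
proof -
  have "finite {i. r * Poly_Mapping.lookup x i \<noteq> 0}"
    by (rule finite_subset[OF _ finite_keys[of x]]) (auto simp: in_keys_iff)
  then show ?thesis unfolding scaleR_poly_mapping_def by simp
qed

lemma Rd_iff: "x \<in> Rd d \<longleftrightarrow> (\<forall>i\<ge>d. Poly_Mapping.lookup x i = 0)"
proof -
  have "Poly_Mapping.keys x \<subseteq> {..<d} \<longleftrightarrow> (\<forall>i. Poly_Mapping.lookup x i \<noteq> 0 \<longrightarrow> i < d)"
    by (auto simp: in_keys_iff)
  then show ?thesis unfolding Rd_def by (auto simp: not_le[symmetric])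
qed

lemma Rd_lookup: "x \<in> Rd d \<Longrightarrow> d \<le> i \<Longrightarrow> Poly_Mapping.lookup x i = 0"
  unfolding Rd_iff by simp

lemma Rd_diff: "x \<in> Rd d \<Longrightarrow> y \<in> Rd d \<Longrightarrow> r *\<^sub>R x - s *\<^sub>R y \<in> Rd d"
  unfolding Rd_iff by (simp add: lookup_minus lookup_scaleR)

lemma Rd_zero: "a \<in> Rd d \<Longrightarrow> a = 0 \<longleftrightarrow> (\<forall>i<d. Poly_Mapping.lookup a i = 0)"
proof
  assume a: "a \<in> Rd d" "\<forall>i<d. Poly_Mapping.lookup a i = 0"
  show "a = 0"
  proof (rule poly_mapping_eqI)
    show "Poly_Mapping.lookup a k = Poly_Mapping.lookup 0 k" for k
      using a Rd_lookup[of a d k] by (cases "k < d") auto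
  qed
qed simp

lemma Rd_vector: "\<exists>a\<in>Rd d. \<forall>i<d. Poly_Mapping.lookup a i = c i"
proof -
  define a :: point where "a = Abs_poly_mapping (\<lambda>i. if i < d then c i else 0)"
  have "finite {i. (if i < d then c i else 0) \<noteq> 0}"
    by (rule finite_subset[of _ "{..<d}"]) auto
  then have "Poly_Mapping.lookup a = (\<lambda>i. if i < d then c i else 0)" unfolding a_def by simp
  then show ?thesis by (intro bexI[of _ a]) (simp_all add: Rd_iff)
qed

lemma dot_diff_left: "dot d (r *\<^sub>R a - s *\<^sub>R b) x = r * dot d a x - s * dot d b x"
  unfolding dot_def sum_distrib_left sum_subtractf[symmetric]
  by (intro sum.cong) (auto simp: lookup_minus lookup_scaleR algebra_simps)

lemma few_points_on_hyperplane:
  assumes Q: "finite Q" "card Q \<le> d" and d: "1 \<le> d"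
  shows "on_hyperplane d Q"
proof (cases "Q = {}")
  case True
  obtain a where "a \<in> Rd d" "\<forall>i<d. Poly_Mapping.lookup a i = 1" using Rd_vector[of d "\<lambda>_. 1"] by blast
  then show ?thesis using d Rd_zero[of a d] True unfolding on_hyperplane_def by (auto intro!: bexI[of _ a])
next
  case False
  define M where "M x i = (if i < d then Poly_Mapping.lookup x i else 1)" for x :: point and i
  obtain c where c: "\<exists>i\<in>{..d}. c i \<noteq> 0" "\<forall>x\<in>Q. (\<Sum>i\<le>d. c i * M x i) = 0"
    using homogeneous_solution[of Q "{..d}" M] Q by auto
  obtain a where a: "a \<in> Rd d" "\<forall>i<d. Poly_Mapping.lookup a i = c i" using Rd_vector by blast
  have eq: "dot d a x = - c d" if "x \<in> Q" for x
  proof -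
    have "(\<Sum>i\<le>d. c i * M x i) = (\<Sum>i<d. c i * M x i) + c d * M x d"
      by (simp add: lessThan_Suc_atMost[symmetric])
    also have "(\<Sum>i<d. c i * M x i) = dot d a x" unfolding dot_def M_def using a(2) by (intro sum.cong) auto
    finally show ?thesis using c(2) that by (simp add: M_def)
  qed
  \<comment> \<open>If \<open>a\<close> vanished, the equation at any point of \<open>Q\<close>
    would give \<open>c d = 0\<close> as well; for this reason the empty set is treated
    separately.\<close>
  have "a \<noteq> 0"
  proof
    assume "a = 0"
    then have "\<forall>i<d. c i = 0" using a(2) by simp
    moreover obtain x where "x \<in> Q" using False by blast
    then have "c d = 0" using eq[of x] \<open>a = 0\<close> by (simp add: dot_def)
    ultimately show False using c(1) by (metis atMost_iff le_neq_implies_less)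
  qed
  then show ?thesis using a(1) eq unfolding on_hyperplane_def by blast
qed

text \<open>A least subset \<open>B\<close> on no hyperplane is small: otherwise each
  \<open>x\<close> in \<open>B\<close> has an affine function that vanishes on
  \<open>B - {x}\<close> but not at \<open>x\<close>. Evaluation at the points of \<open>B\<close>
  shows that these more than \<open>d + 1\<close> functions are linearly independent, whereas affine
  functions have only \<open>d + 1\<close> coefficients.\<close>

lemma spanning_subset:
  assumes P: "finite P" "d + 1 \<le> card P" and no: "\<not> on_hyperplane d P"
  shows "\<exists>Q\<subseteq>P. card Q = d + 1 \<and> \<not> on_hyperplane d Q"
proof -
  define S where "S = {B. B \<subseteq> P \<and> \<not> on_hyperplane d B}"
  have "P \<in> S" using no unfolding S_def by simp
  then obtain B where B: "B \<in> S" "\<And>B'. B' \<in> S \<Longrightarrow> card B \<le> card B'"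
    using ex_has_least_nat[of "\<lambda>B. B \<in> S" P card] by blast
  have BP: "B \<subseteq> P" "\<not> on_hyperplane d B" "finite B" using B(1) P(1) finite_subset unfolding S_def by auto
  have "card B \<le> d + 1"
  proof (rule ccontr)
    assume big: "\<not> card B \<le> d + 1"
    have "on_hyperplane d (B - {x})" if "x \<in> B" for x
    proof (rule ccontr)
      assume "\<not> on_hyperplane d (B - {x})"
      then have "card B \<le> card (B - {x})" using B(2) BP unfolding S_def by blast
      then show False using that BP(3) card_Diff1_less[of B x] by simp
    qed
    then have "\<forall>x\<in>B. \<exists>a b. a \<in> Rd d \<and> a \<noteq> 0 \<and> (\<forall>y\<in>B - {x}. dot d a y = b)"
      unfolding on_hyperplane_def by blast
    then obtain a b where ab: "\<And>x. x \<in> B \<Longrightarrow> a x \<in> Rd d \<and> a x \<noteq> 0 \<and> (\<forall>y\<in>B - {x}. dot d (a x) y = b x)"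
      by metis
    have own: "dot d (a x) x \<noteq> b x" if "x \<in> B" for x
      using BP(2) ab[OF that] unfolding on_hyperplane_def by (metis DiffI singletonD)
    define M where "M i x = (if i < d then Poly_Mapping.lookup (a x) i else b x)" for i x
    obtain c where c: "\<exists>x\<in>B. c x \<noteq> 0" "\<forall>i\<le>d. (\<Sum>x\<in>B. c x * M i x) = 0"
      using homogeneous_solution[of "{..d}" B M] BP(3) big by auto
    have "c y = 0" if y: "y \<in> B" for y
    proof -
      have "(\<Sum>x\<in>B. c x * (dot d (a x) y - b x)) = (\<Sum>x\<in>B. c x * dot d (a x) y) - (\<Sum>x\<in>B. c x * b x)"
        by (simp add: algebra_simps sum_subtractf)
      also have "(\<Sum>x\<in>B. c x * b x) = 0" using c(2)[rule_format, of d] by (simp add: M_def)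
      also have "(\<Sum>x\<in>B. c x * dot d (a x) y) = (\<Sum>i<d. Poly_Mapping.lookup y i * (\<Sum>x\<in>B. c x * M i x))"
        unfolding dot_def sum_distrib_left by (subst sum.swap) (simp add: M_def ac_simps)
      also have "\<dots> = 0" using c(2) by simp
      finally have "(\<Sum>x\<in>B. c x * (dot d (a x) y - b x)) = 0" by simp
      moreover have "(\<Sum>x\<in>B. c x * (dot d (a x) y - b x)) = c y * (dot d (a y) y - b y)"
      proof -
        have "c x * (dot d (a x) y - b x) = 0" if "x \<in> B - {y}" for x
          using ab[of x] that y by auto
        then have "(\<Sum>x\<in>B - {y}. c x * (dot d (a x) y - b x)) = 0" by (intro sum.neutral ballI)
        then show ?thesis using y BP(3) by (subst sum.remove[of _ y]) simp_all
      qed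
      ultimately show ?thesis using own[OF y] by simp
    qed
    then show False using c(1) by blast
  qed
  then obtain Q where "B \<subseteq> Q" "Q \<subseteq> P" "card Q = d + 1"
    using exists_subset_between[of B "d + 1" P] BP P by blast
  then show ?thesis using BP(2) on_hyperplane_subset by blast
qed

lemma general_position_iff:
  "general_position d P \<longleftrightarrow> P \<subseteq> Rd d \<and> finite P \<and> d + 1 \<le> card P \<and>
     (\<forall>Q\<subseteq>P. card Q = d + 1 \<longrightarrow> \<not> on_hyperplane d Q)"
  unfolding general_position_def using on_hyperplane_iff[of _ d] by (meson order_trans)

lemma general_position_subset:
  "general_position d P \<Longrightarrow> Q \<subseteq> P \<Longrightarrow> d + 1 \<le> card Q \<Longrightarrow> general_position d Q"
  unfolding general_position_iff using finite_subset by (meson order_trans)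

text \<open>For a further point \<open>q\<close> of \<open>Q\<close>, a combination of the two
  equations is constant on \<open>E\<close> and \<open>q\<close>. General position makes its normal
  vector \<open>v\<close> zero, so the equations are proportional.\<close>

lemma hyperplane_unique:
  assumes Q: "general_position d Q" and E: "E \<subseteq> Q" "card E = d" and d: "1 \<le> d"
    and a: "a \<in> Rd d" "a \<noteq> 0" "\<forall>x\<in>E. dot d a x = b" and a': "a' \<in> Rd d" "a' \<noteq> 0" "\<forall>x\<in>E. dot d a' x = b'"
    and p: "dot d a p = b"
  shows "dot d a' p = b'"
proof -
  have Qf: "finite Q" "d + 1 \<le> card Q" "\<And>T. T \<subseteq> Q \<Longrightarrow> card T = d + 1 \<Longrightarrow> \<not> on_hyperplane d T"
    using Q unfolding general_position_iff by auto
  have Ef: "finite E" using E(1) Qf(1) finite_subset by blast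
  have "E \<noteq> Q" using E(2) Qf(2) by auto
  then obtain q where q: "q \<in> Q" "q \<notin> E" using E(1) by blast
  have no: "\<not> on_hyperplane d (insert q E)" by (rule Qf(3)) (use q E Ef in auto)
  define r where "r = dot d a q - b"
  define r' where "r' = dot d a' q - b'"
  have r0: "r \<noteq> 0" "r' \<noteq> 0" using no a a' unfolding on_hyperplane_def r_def r'_def by auto
  define v where "v = r' *\<^sub>R a - r *\<^sub>R a'"
  have v: "v \<in> Rd d" unfolding v_def by (rule Rd_diff[OF a(1) a'(1)])
  have dv: "dot d v x = r' * dot d a x - r * dot d a' x" for x unfolding v_def by (rule dot_diff_left)
  have vE: "dot d v x = r' * b - r * b'" if "x \<in> insert q E" for x
    using that a(3) a'(3) unfolding dv r_def r'_def by (auto simp: algebra_simps)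
  then have "v = 0" using no v unfolding on_hyperplane_def by blast
  then have zero: "dot d v x = 0" for x by (simp add: dot_def)
  have "E \<noteq> {}" using E(2) d by auto
  then have "r' * b - r * b' = 0" using vE zero by (metis insertI2 ex_in_conv)
  moreover have "r' * b - r * dot d a' p = 0" using zero[of p] dv[of p] p by simp
  ultimately have "r * (dot d a' p - b') = 0" by algebra
  then show ?thesis using r0 by simp
qed

lemma self_le_binomial: "1 \<le> d \<Longrightarrow> d + 1 + e \<le> (d + 1 + e) choose d"
proof (induction e)
  case (Suc e)
  obtain d' where d': "d = Suc d'" using Suc.prems by (cases d) auto
  have "(d + 1 + Suc e) choose d = ((d + 1 + e) choose d') + ((d + 1 + e) choose d)" unfolding d' by simp
  moreover have "1 \<le> (d + 1 + e) choose d'" using zero_less_binomial[of d' "d + 1 + e"] d' by linarith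
  ultimately show ?case using Suc.IH[OF Suc.prems] by linarith
qed simp

lemma large_general_position_subset:
  assumes P: "P \<subseteq> Rd d" "finite P" "d + 1 \<le> card P" "l \<le> card P" and d: "1 \<le> d" "d < l"
    and no: "\<not> (\<exists>Q\<subseteq>P. card Q = l \<and> on_hyperplane d Q)"
  shows "\<exists>Q\<subseteq>P. general_position d Q \<and> card P \<le> (l - d) * (card Q choose d)"
proof -
  have small: "card Q < l" if "Q \<subseteq> P" "on_hyperplane d Q" for Q
  proof (rule ccontr)
    assume "\<not> card Q < l"
    then obtain Q' where Q': "Q' \<subseteq> Q" "card Q' = l" by (meson obtain_subset_with_card_n not_less)
    have "Q' \<subseteq> P" using Q'(1) that(1) by blast
    then show False using no Q'(2) on_hyperplane_subset[OF that(2) Q'(1)] by blast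
  qed
  have "\<not> on_hyperplane d P" using small[of P] P(4) by auto
  then obtain Q0 where Q0: "Q0 \<subseteq> P" "card Q0 = d + 1" "\<not> on_hyperplane d Q0"
    using spanning_subset P by blast
  have "general_position d Q0" unfolding general_position_iff
  proof (intro conjI allI impI)
    show fin: "finite Q0" using Q0(1) P(2) finite_subset by blast
    fix T assume "T \<subseteq> Q0" "card T = d + 1"
    then have "T = Q0" using card_subset_eq[OF fin] Q0(2) by simp
    then show "\<not> on_hyperplane d T" using Q0(3) by simp
  qed (use Q0 P in auto)
  moreover define \<Q> where "\<Q> = {Q. Q \<subseteq> P \<and> general_position d Q}"
  ultimately have "\<Q> \<noteq> {}" using Q0(1) by blast
  moreover have finQ: "finite \<Q>" unfolding \<Q>_def using P(2) by simp
  ultimately have "Max (card ` \<Q>) \<in> card ` \<Q>" by (intro Max_in) simp_all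
  then obtain Q where "Q \<in> \<Q>" and maxQ: "card Q = Max (card ` \<Q>)" by auto
  then have Q: "Q \<subseteq> P" "general_position d Q" unfolding \<Q>_def by simp_all
  have max: "card Q' \<le> card Q" if "Q' \<subseteq> P" "general_position d Q'" for Q'
    unfolding maxQ by (rule Max_ge) (use that finQ in \<open>simp_all add: \<Q>_def\<close>)
  have Qf: "finite Q" "d + 1 \<le> card Q" "Q \<subseteq> Rd d" using Q(2) unfolding general_position_iff by auto
  define \<E> where "\<E> = {E. E \<subseteq> Q \<and> card E = d}"
  define Z where "Z E = {p \<in> P - Q. on_hyperplane d (insert p E)}" for E
  have finE: "finite \<E>" unfolding \<E>_def using Qf(1) by simp
  have cardE: "card \<E> = card Q choose d" unfolding \<E>_def using n_subsets[OF Qf(1)] by simp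
  have cover: "P - Q \<subseteq> (\<Union>E\<in>\<E>. Z E)"
  proof
    fix p assume p: "p \<in> P - Q"
    have "\<not> general_position d (insert p Q)" using max[of "insert p Q"] p Q(1) Qf(1) by auto
    then obtain T where T: "T \<subseteq> insert p Q" "card T = d + 1" "on_hyperplane d T"
      using Qf P(1) p unfolding general_position_iff by auto
    have "p \<in> T"
    proof (rule ccontr)
      assume "p \<notin> T"
      then have "T \<subseteq> Q" using T(1) by blast
      then show False using T Q(2) unfolding general_position_iff by blast
    qed
    moreover have "finite T" using T(2) by (metis card.infinite Suc_eq_plus1 nat.distinct(1))
    ultimately have "T - {p} \<in> \<E>" using T unfolding \<E>_def by auto
    moreover have "insert p (T - {p}) = T" using \<open>p \<in> T\<close> by blast
    then have "p \<in> Z (T - {p})" using T(3) p unfolding Z_def by simp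
    ultimately show "p \<in> (\<Union>E\<in>\<E>. Z E)" by blast
  qed
  \<comment> \<open>The hyperplane spanned by \<open>E\<close> holds at most \<open>l - 1\<close>
    points, and \<open>d\<close> of these are the points of \<open>E\<close>.\<close>
  have Zcard: "card (Z E) \<le> l - 1 - d" if E: "E \<in> \<E>" for E
  proof -
    have E': "E \<subseteq> Q" "card E = d" "finite E" using E Qf(1) finite_subset unfolding \<E>_def by auto
    show ?thesis
    proof (cases "Z E = {}")
      case False
      then obtain p where "p \<in> Z E" by blast
      then obtain a b where a: "a \<in> Rd d" "a \<noteq> 0" "\<forall>x\<in>insert p E. dot d a x = b"
        unfolding Z_def on_hyperplane_def by blast
      have "dot d a z = b" if z: "z \<in> Z E" for z
      proof -
        obtain a' b' where a': "a' \<in> Rd d" "a' \<noteq> 0" "\<forall>x\<in>insert z E. dot d a' x = b'"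
          using z unfolding Z_def on_hyperplane_def by blast
        show ?thesis
          by (rule hyperplane_unique[OF Q(2) E'(1,2) d(1) a'(1,2) _ a(1,2)]) (use a a' in auto)
      qed
      then have "on_hyperplane d (Z E \<union> E)" using a unfolding on_hyperplane_def by auto
      moreover have "Z E \<union> E \<subseteq> P" using E'(1) Q(1) unfolding Z_def by blast
      ultimately have "card (Z E \<union> E) < l" by (rule small[rotated])
      moreover have "Z E \<inter> E = {}" using E'(1) unfolding Z_def by blast
      moreover have "finite (Z E)" using P(2) unfolding Z_def by simp
      ultimately show ?thesis using E' by (simp add: card_Un_disjoint)
    qed simp
  qed
  have "card (P - Q) \<le> card (\<Union>E\<in>\<E>. Z E)"
    by (rule card_mono[OF _ cover]) (use finE P(2) in \<open>auto simp: Z_def\<close>)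
  also have "\<dots> \<le> (\<Sum>E\<in>\<E>. card (Z E))" by (rule card_UN_le[OF finE])
  also have "\<dots> \<le> (\<Sum>E\<in>\<E>. l - 1 - d)" by (rule sum_mono) (rule Zcard)
  also have "\<dots> = (card Q choose d) * (l - 1 - d)" by (simp add: cardE)
  finally have PQ: "card (P - Q) \<le> (card Q choose d) * (l - 1 - d)" .
  \<comment> \<open>The points of \<open>Q\<close> are charged to the \<open>d\<close>-subsets, one
    each, which turns the factor \<open>l - 1 - d\<close> into \<open>l - d\<close>.\<close>
  have "card Q \<le> card Q choose d"
    using self_le_binomial[OF d(1), of "card Q - (d + 1)"] Qf(2) by simp
  moreover have "card P = card Q + card (P - Q)"
    using Q(1) P(2) Qf(1) by (metis card_Diff_subset card_mono le_add_diff_inverse)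
  ultimately have "card P \<le> (card Q choose d) * (1 + (l - 1 - d))" using PQ by (simp add: algebra_simps)
  also have "1 + (l - 1 - d) = l - d" using d by simp
  finally show ?thesis using Q by (metis mult.commute)
qed

subsection \<open>Generic projection to space\<close>

lemma dot_add_right: "dot d a (x + y) = dot d a x + dot d a y"
  unfolding dot_def sum.distrib[symmetric] by (intro sum.cong) (auto simp: lookup_add algebra_simps)

lemma dot_scaleR_right: "dot d a (r *\<^sub>R x) = r * dot d a x"
  unfolding dot_def sum_distrib_left by (intro sum.cong) (auto simp: lookup_scaleR)

lemma dot_sum_right: "finite T \<Longrightarrow> dot d a (\<Sum>x\<in>T. g x) = (\<Sum>x\<in>T. dot d a (g x))"
proof (induction T rule: finite_induct)
  case empty
  show ?case by (simp add: dot_def)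
qed (simp add: dot_add_right)

text \<open>Affine independence of at most \<open>d + 1\<close> points. Once \<open>T\<close> is
  enlarged to \<open>d + 1\<close> points, a hyperplane through all of them except \<open>x\<close>
  gives an affine function that kills every term of the relation but that of
  \<open>x\<close>.\<close>

lemma general_position_independent:
  assumes Q: "general_position d Q" and T: "T \<subseteq> Q" "card T \<le> d + 1" and d: "1 \<le> d"
    and c: "(\<Sum>x\<in>T. c x) = 0" "(\<Sum>x\<in>T. c x *\<^sub>R x) = 0" and x: "x \<in> T"
  shows "c x = 0"
proof (rule ccontr)
  assume cx: "c x \<noteq> 0"
  have Qf: "finite Q" "d + 1 \<le> card Q" "\<And>T. T \<subseteq> Q \<Longrightarrow> card T = d + 1 \<Longrightarrow> \<not> on_hyperplane d T"
    using Q unfolding general_position_iff by auto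
  have Tf: "finite T" using T(1) Qf(1) finite_subset by blast
  obtain S where S: "T \<subseteq> S" "S \<subseteq> Q" "card S = d + 1"
    using exists_subset_between[of T "d + 1" Q] T Qf by auto
  have Sf: "finite S" using S(2) Qf(1) finite_subset by blast
  have "on_hyperplane d (S - {x})"
    by (rule few_points_on_hyperplane) (use S Sf x d in auto)
  then obtain a b where a: "a \<in> Rd d" "a \<noteq> 0" "\<forall>y\<in>S - {x}. dot d a y = b"
    unfolding on_hyperplane_def by blast
  have "(\<Sum>y\<in>T. c y * dot d a y) = dot d a (\<Sum>y\<in>T. c y *\<^sub>R y)"
    using dot_sum_right[OF Tf] by (simp add: dot_scaleR_right)
  also have "\<dots> = 0" using c(2) by (simp add: dot_def)
  finally have 1: "(\<Sum>y\<in>T. c y * dot d a y) = 0" .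
  have "(\<Sum>y\<in>T. c y * b) = (\<Sum>y\<in>T. c y) * b" by (rule sum_distrib_right[symmetric])
  then have "(\<Sum>y\<in>T. c y * (dot d a y - b)) = 0" using 1 c(1) by (simp add: right_diff_distrib sum_subtractf)
  moreover have "c y * (dot d a y - b) = 0" if "y \<in> T - {x}" for y using a(3) S(1) that by auto
  then have "(\<Sum>y\<in>T - {x}. c y * (dot d a y - b)) = 0" by (intro sum.neutral ballI)
  then have "(\<Sum>y\<in>T. c y * (dot d a y - b)) = c x * (dot d a x - b)"
    using x Tf by (subst sum.remove[of _ x]) simp_all
  ultimately have "dot d a x = b" using cx by simp
  then have "on_hyperplane d S" using a unfolding on_hyperplane_def by auto
  then show False using Qf(3)[OF S(2,3)] by blast
qed

text \<open>A coordinate that does not vanish at the new vector is added with a factor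
  \<open>\<epsilon>\<close> outside a finite set, namely the factors for which some value becomes
  zero.\<close>

lemma generic_functional:
  fixes W :: "point set"
  assumes "finite W" "0 \<notin> W"
  shows "\<exists>f :: point \<Rightarrow> real. linear f \<and> (\<forall>w\<in>W. f w \<noteq> 0)"
  using assms
proof (induction W rule: finite_induct)
  case empty
  show ?case by (intro exI[of _ "\<lambda>_. 0"]) (simp add: linear_zero)
next
  case (insert w W)
  then obtain f :: "point \<Rightarrow> real" where f: "linear f" "\<forall>w\<in>W. f w \<noteq> 0" by auto
  have "w \<noteq> 0" using insert.prems by auto
  then obtain k where k: "Poly_Mapping.lookup w k \<noteq> 0" by (metis lookup_zero poly_mapping_eqI)
  define g where "g x = Poly_Mapping.lookup x k" for x :: point
  have g: "linear g" unfolding g_def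
    by (rule linearI) (simp_all add: lookup_add lookup_scaleR)
  have "finite ((\<lambda>v. - f v / g v) ` insert w W)" using insert.hyps by simp
  then obtain \<epsilon> :: real where e: "\<epsilon> \<notin> insert 0 ((\<lambda>v. - f v / g v) ` insert w W)"
    using ex_new_if_finite[OF infinite_UNIV_char_0, of "insert 0 ((\<lambda>v. - f v / g v) ` insert w W)"] by auto
  define h where "h x = f x + \<epsilon> * g x" for x
  have "linear h" unfolding h_def
    using linear_compose_add[OF f(1) linear_compose_scale_right[OF g, of \<epsilon>]] by simp
  moreover have "h v \<noteq> 0" if v: "v \<in> insert w W" for v
  proof (cases "g v = 0")
    case True
    then have "v \<noteq> w" using k unfolding g_def by auto
    then show ?thesis using f(2) v True unfolding h_def by auto
  next
    case False
    have "\<epsilon> \<noteq> - f v / g v" using e v by blast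
    then show ?thesis using False unfolding h_def by (auto simp: field_simps)
  qed
  ultimately show ?case by blast
qed

text \<open>The three coordinates are chosen one after another. Expanded along the last one, the
  determinant is the value of \<open>f3\<close> at a vector \<open>v3\<close> whose coefficients are
  2 by 2 minors of \<open>f1\<close> and \<open>f2\<close>; such a minor is the value of
  \<open>f2\<close> at a vector \<open>v2\<close> with coefficients from \<open>f1\<close>. Affine
  independence keeps these vectors nonzero, and there are only finitely many of them.\<close>

lemma generic_projection:
  assumes Q: "general_position d Q" and d: "3 \<le> d"
  shows "\<exists>g :: point \<Rightarrow> r3. linear g \<and>
    (\<forall>a b c e. {a, b, c, e} \<subseteq> Q \<and> distinct [a, b, c, e] \<longrightarrow> orient 1 (g a) (g b) (g c) (g e) \<noteq> 0)"
proof -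
  have Qf: "finite Q" using Q unfolding general_position_iff by auto
  have indep3: "\<beta> *\<^sub>R (y - x) + \<gamma> *\<^sub>R (z - x) \<noteq> 0"
    if "{x, y, z} \<subseteq> Q" "distinct [x, y, z]" "\<beta> \<noteq> 0" for x y z \<beta> \<gamma>
  proof
    assume zero: "\<beta> *\<^sub>R (y - x) + \<gamma> *\<^sub>R (z - x) = 0"
    define c where "c u = (if u = x then - \<beta> - \<gamma> else if u = y then \<beta> else \<gamma>)" for u
    have "(\<Sum>u\<in>{x, y, z}. c u) = 0" using that unfolding c_def by auto
    moreover have "(\<Sum>u\<in>{x, y, z}. c u *\<^sub>R u) = 0" using that zero unfolding c_def
      by (auto simp: algebra_simps)
    ultimately have "c y = 0" using general_position_independent[OF Q that(1), of c y] d that(2) by simp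
    then show False using that unfolding c_def by (auto split: if_splits)
  qed
  have indep4: "\<beta> *\<^sub>R (y - x) + \<gamma> *\<^sub>R (z - x) + \<delta> *\<^sub>R (w - x) \<noteq> 0"
    if "{x, y, z, w} \<subseteq> Q" "distinct [x, y, z, w]" "\<delta> \<noteq> 0" for x y z w \<beta> \<gamma> \<delta>
  proof
    assume zero: "\<beta> *\<^sub>R (y - x) + \<gamma> *\<^sub>R (z - x) + \<delta> *\<^sub>R (w - x) = 0"
    define c where "c u = (if u = x then - \<beta> - \<gamma> - \<delta> else if u = y then \<beta> else if u = z then \<gamma> else \<delta>)" for u
    have "(\<Sum>u\<in>{x, y, z, w}. c u) = 0" using that unfolding c_def by auto
    moreover have "(\<Sum>u\<in>{x, y, z, w}. c u *\<^sub>R u) = 0" using that zero unfolding c_def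
      by (auto simp: algebra_simps)
    ultimately have "c w = 0" using general_position_independent[OF Q that(1), of c w] d that(2) by simp
    then show False using that unfolding c_def by (auto split: if_splits)
  qed
  define W1 where "W1 = (\<lambda>(x, y). y - x) ` (Q \<times> Q) - {0}"
  obtain f1 :: "point \<Rightarrow> real" where f1: "linear f1" "\<forall>w\<in>W1. f1 w \<noteq> 0"
    using generic_functional[of W1] Qf unfolding W1_def by auto
  define v2 where "v2 x y z = f1 (y - x) *\<^sub>R (z - x) - f1 (z - x) *\<^sub>R (y - x)" for x y z
  define W2 where "W2 = (\<lambda>(x, y, z). v2 x y z) ` (Q \<times> Q \<times> Q) - {0}"
  obtain f2 :: "point \<Rightarrow> real" where f2: "linear f2" "\<forall>w\<in>W2. f2 w \<noteq> 0"
    using generic_functional[of W2] Qf unfolding W2_def by auto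
  define m where "m x y z = f1 (y - x) * f2 (z - x) - f1 (z - x) * f2 (y - x)" for x y z
  define v3 where "v3 x y z w = m x z w *\<^sub>R (y - x) + (- m x y w) *\<^sub>R (z - x) + m x y z *\<^sub>R (w - x)" for x y z w
  define W3 where "W3 = (\<lambda>(x, y, z, w). v3 x y z w) ` (Q \<times> Q \<times> Q \<times> Q) - {0}"
  obtain f3 :: "point \<Rightarrow> real" where f3: "linear f3" "\<forall>w\<in>W3. f3 w \<noteq> 0"
    using generic_functional[of W3] Qf unfolding W3_def by auto
  define g where "g x = (f1 x, f2 x, f3 x)" for x
  have "linear g" unfolding g_def
    by (rule linearI) (simp_all add: linear_add[OF f1(1)] linear_add[OF f2(1)] linear_add[OF f3(1)]
      linear_scale[OF f1(1)] linear_scale[OF f2(1)] linear_scale[OF f3(1)])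
  moreover have "orient 1 (g x) (g y) (g z) (g w) \<noteq> 0" if xyzw: "{x, y, z, w} \<subseteq> Q" "distinct [x, y, z, w]" for x y z w
  proof -
    have "y - x \<in> W1" using xyzw unfolding W1_def by (auto intro!: image_eqI[of _ _ "(x, y)"])
    then have "f1 (y - x) \<noteq> 0" using f1(2) by blast
    then have "(- f1 (z - x)) *\<^sub>R (y - x) + f1 (y - x) *\<^sub>R (z - x) \<noteq> 0"
      using indep3[of x z y "f1 (y - x)" "- f1 (z - x)"] xyzw by (auto simp: algebra_simps)
    then have "v2 x y z \<noteq> 0" unfolding v2_def by (simp add: algebra_simps)
    then have "v2 x y z \<in> W2" using xyzw unfolding W2_def by (auto intro!: image_eqI[of _ _ "(x, y, z)"])
    then have "f2 (v2 x y z) \<noteq> 0" using f2(2) by blast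
    then have "m x y z \<noteq> 0" unfolding v2_def m_def
      by (simp add: linear_diff[OF f2(1)] linear_scale[OF f2(1)])
    then have "v3 x y z w \<noteq> 0" using indep4 xyzw unfolding v3_def by blast
    then have "v3 x y z w \<in> W3" using xyzw unfolding W3_def by (auto intro!: image_eqI[of _ _ "(x, y, z, w)"])
    then have "f3 (v3 x y z w) \<noteq> 0" using f3(2) by blast
    moreover have g: "g u - g x = (f1 (u - x), f2 (u - x), f3 (u - x))" for u
      unfolding g_def by (simp add: linear_diff[OF f1(1)] linear_diff[OF f2(1)] linear_diff[OF f3(1)])
    have "f3 (v3 x y z w) = m x z w * f3 (y - x) + (- m x y w) * f3 (z - x) + m x y z * f3 (w - x)"
      unfolding v3_def linear_add[OF f3(1)] linear_scale[OF f3(1)] by simp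
    then have "orient 1 (g x) (g y) (g z) (g w) = f3 (v3 x y z w)"
      unfolding orient_def g det3.simps m_def by algebra
    ultimately show ?thesis by simp
  qed
  ultimately show ?thesis by (intro exI[of _ g]) blast
qed

text \<open>A linear map sends hulls to hulls, so a point in the hull of the others would stay there
  after projection. General position is inherited from \<open>Q\<close> in the original
  space.\<close>

lemma convex_position_by_projection:
  assumes Q: "general_position d Q" and g: "linear g" and n: "d + 1 \<le> n"
    and U: "U \<subseteq> g ` Q" "card U = n" "\<forall>a\<in>U. a \<notin> convex hull (U - {a})"
  shows "\<exists>V\<subseteq>Q. card V = n \<and> convex_position d V"
proof -
  obtain V where V: "V \<subseteq> Q" "inj_on g V" "U = g ` V" using U(1) by (metis subset_image_inj)
  have cV: "card V = n" using V U(2) card_image by metis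
  have "finite V" using Q V(1) finite_subset unfolding general_position_iff by blast
  have "p extreme_point_of (convex hull V)" if p: "p \<in> V" for p
  proof -
    have "p \<notin> convex hull (V - {p})"
    proof
      assume "p \<in> convex hull (V - {p})"
      then have "g p \<in> g ` (convex hull (V - {p}))" by blast
      also have "\<dots> = convex hull (g ` (V - {p}))" by (rule convex_hull_linear_image[OF g])
      also have "g ` (V - {p}) = U - {g p}" unfolding V(3)
        using inj_on_image_set_diff[OF V(2), of V "{p}"] p by simp
      finally show False using U(3) p V(3) by blast
    qed
    then have "p extreme_point_of (convex hull (insert p (V - {p})))"
      using \<open>finite V\<close> by (intro extreme_point_of_convex_hull_insert) auto
    then show ?thesis using p by (simp add: insert_absorb)
  qed
  then have "convex_position d V"
    unfolding convex_position_def using general_position_subset[OF Q V(1)] cV n by simp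
  then show ?thesis using V(1) cV by blast
qed

section \<open>The bound in dimension \<open>d\<close> in terms of the parameters\<close>

lemma ES_property_bound:
  assumes d: "3 \<le> d" "d < l" "d < n"
    and k: "2 \<le> p" "n \<le> k * p" and L: "L = 8 * (1 + (k + 1) ^ k) + 16" and R: "R = ramsey4 L" "L \<le> R"
    and N: "n \<le> N" "R * (2 * R ^ L * ((p + n) choose p) ^ 256) \<le> N"
  shows "ES_property d l n ((l - d) * (N choose d))"
  unfolding ES_property_def
proof (intro allI impI)
  fix P assume P: "P \<subseteq> Rd d" and "infinite P \<or> (l - d) * (N choose d) \<le> card P"
  then obtain P' where P': "P' \<subseteq> P" "finite P'" "(l - d) * (N choose d) \<le> card P'"
    by (metis infinite_arbitrarily_large order_refl)
  have P'd: "P' \<subseteq> Rd d" using P P'(1) by blast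
  show "(\<exists>Q H. Q \<subseteq> P \<and> card Q = l \<and> affine_hyperplane d H \<and> Q \<subseteq> H) \<or>
    (\<exists>Q\<subseteq>P. card Q = n \<and> convex_position d Q)"
  proof (cases "\<exists>Q\<subseteq>P'. card Q = l \<and> on_hyperplane d Q")
    case True
    then obtain Q where Q: "Q \<subseteq> P'" "card Q = l" "on_hyperplane d Q" by blast
    then have "Q \<subseteq> Rd d" using P'd by blast
    then obtain H where "affine_hyperplane d H" "Q \<subseteq> H" using Q(3) on_hyperplane_iff[of Q d] by blast
    moreover have "Q \<subseteq> P" using Q(1) P'(1) by blast
    ultimately show ?thesis using Q(2) by blast
  next
    case False
    have dN: "d + 1 \<le> N" using d N by simp
    have "d + 1 \<le> N choose d"
      using self_le_binomial[of d "N - (d + 1)"] dN d by simp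
    then have le: "(l - d) * (d + 1) \<le> card P'" using P'(3) by (meson le_trans mult_le_mono2)
    have "1 * (d + 1) \<le> (l - d) * (d + 1)" by (rule mult_le_mono1) (use d in simp)
    then have "d + 1 \<le> card P'" using le by (metis le_trans mult_1)
    moreover have "l \<le> (l - d) * (d + 1)"
    proof -
      have "1 * d \<le> (l - d) * d" by (rule mult_le_mono1) (use d in simp)
      then show ?thesis using d by (simp add: algebra_simps)
    qed
    then have "l \<le> card P'" using le by (rule le_trans)
    ultimately obtain Q where Q: "Q \<subseteq> P'" "general_position d Q" "card P' \<le> (l - d) * (card Q choose d)"
      using large_general_position_subset[OF P'd P'(2) _ _ _ d(2) False] d by auto
    \<comment> \<open>A smaller \<open>Q\<close> would contradict the covering bound, since
      \<open>N choose d\<close> exceeds its predecessor once \<open>d \<le> N\<close>.\<close>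
    have NQ: "N \<le> card Q"
    proof (rule ccontr)
      assume "\<not> N \<le> card Q"
      then obtain N' where N': "N = Suc N'" "card Q \<le> N'" by (cases N) auto
      obtain d' where d': "d = Suc d'" using d by (cases d) auto
      have "card Q choose d \<le> N' choose d" using N'(2) by (rule binomial_right_mono)
      moreover have "0 < N' choose d'" using dN N' d' by (simp add: zero_less_binomial)
      ultimately have "card Q choose d < N choose d" unfolding N'(1) d' binomial_Suc_Suc by linarith
      then have "(l - d) * (card Q choose d) < (l - d) * (N choose d)" using d by simp
      then show False using P'(3) Q(3) by linarith
    qed
    obtain g where g: "linear g" and nz: "\<And>a b c e. {a, b, c, e} \<subseteq> Q \<Longrightarrow> distinct [a, b, c, e] \<Longrightarrow>
        orient 1 (g a) (g b) (g c) (g e) \<noteq> 0"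
      using generic_projection[OF Q(2) d(1)] by blast
    have fin: "finite Q" using Q(2) unfolding general_position_iff by blast
    \<comment> \<open>Two points with the same image, completed to a quadruple, would have
      orientation 0.\<close>
    have "inj_on g Q"
    proof (rule inj_onI, rule ccontr)
      fix a b assume ab: "a \<in> Q" "b \<in> Q" "g a = g b" "a \<noteq> b"
      have "2 \<le> card (Q - {a, b})" using NQ dN d fin ab by (simp add: card_Diff_subset)
      then obtain T where T: "T \<subseteq> Q - {a, b}" "card T = 2" by (meson obtain_subset_with_card_n)
      then obtain c e where ce: "T = {c, e}" "c \<noteq> e" by (metis card_2_iff)
      have "orient 1 (g a) (g b) (g c) (g e) \<noteq> 0" using nz[of a b c e] ab T ce by auto
      moreover have "orient 1 (g a) (g a) (g c) (g e) = 0" using orient_swap(1)[of 1 "g a" "g a"] by simp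
      ultimately show False using ab(3) by simp
    qed
    then have cg: "card (g ` Q) = card Q" by (rule card_image)
    have "\<exists>U\<subseteq>g ` Q. card U = n \<and> (\<forall>a\<in>U. a \<notin> convex hull (U - {a}))"
    proof (rule convex_subset_of_space[OF _ _ k(1) _ k(2) refl L _ R(2)])
      show "finite (g ` Q)" using fin by simp
      fix a b c e assume abce: "{a, b, c, e} \<subseteq> g ` Q" "distinct [a, b, c, e]"
      then obtain a' b' c' e' where eq: "a' \<in> Q" "b' \<in> Q" "c' \<in> Q" "e' \<in> Q"
        "a = g a'" "b = g b'" "c = g c'" "e = g e'" by (auto elim!: imageE)
      have "distinct [a', b', c', e']" using abce(2) eq by auto
      then show "orient 1 a b c e \<noteq> 0" using nz[of a' b' c' e'] eq by simp
    next
      show "2 \<le> n" using d by simp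
      show "ramsey_bound 4 L R" unfolding R(1) by (rule ramsey_bound_4)
      show "R * (2 * R ^ L * ((p + n) choose p) ^ 256) \<le> card (g ` Q)" using N(2) NQ cg by simp
    qed
    then obtain U where U: "U \<subseteq> g ` Q" "card U = n" "\<forall>a\<in>U. a \<notin> convex hull (U - {a})" by blast
    have "\<exists>V\<subseteq>Q. card V = n \<and> convex_position d V"
      by (rule convex_position_by_projection[OF Q(2) g _ U]) (use d in simp)
    moreover have "Q \<subseteq> P" using Q(1) P'(1) by blast
    ultimately show ?thesis by blast
  qed
qed

text \<open>The estimate \<open>N choose d \<le> N ^ d / fact d\<close> supplies the factorial, and
  the power \<open>N ^ d\<close> is the origin of the factor \<open>d\<close> in the final
  exponent.\<close>

lemma ES_le:
  assumes "ES_property d l n ((l - d) * (N choose d))" "d < l"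
  shows "ereal_of_enat (ES d l n) \<le> ereal ((real l - real d) / fact d * real N ^ d)"
proof -
  have "ES d l n \<le> enat ((l - d) * (N choose d))" unfolding ES_def using assms(1) by (intro INF_lower) simp
  then have "ereal_of_enat (ES d l n) \<le> ereal (real ((l - d) * (N choose d)))"
    by (metis ereal_of_enat_le_iff ereal_of_enat_simps(1))
  also have "real ((l - d) * (N choose d)) = (real l - real d) * real (N choose d)"
    using assms(2) by (simp add: of_nat_diff)
  also have "\<dots> \<le> (real l - real d) * (real N ^ d / fact d)"
  proof (rule mult_left_mono)
    have "(N choose d) * fact d \<le> N ^ d" by (rule binomial_fact_pow)
    then have "real (N choose d) * fact d \<le> real N ^ d" by (metis of_nat_fact of_nat_le_iff of_nat_mult of_nat_power)
    then show "real (N choose d) \<le> real N ^ d / fact d" by (simp add: field_simps)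
  qed (use assms in simp)
  finally show ?thesis by simp
qed

subsection \<open>Asymptotics\<close>

lemma power2_le_exp: "(2::real) ^ a \<le> exp (real a)"
proof -
  have "(2::real) ^ a \<le> exp 1 ^ a" by (rule power_mono) (use exp_ge_add_one_self[of 1] in auto)
  then show ?thesis by (simp add: exp_of_nat_mult[symmetric])
qed

text \<open>The constant 8 comes from squaring \<open>2 ^ (4 * L)\<close>, and 6 from cubing
  \<open>2 ^ (2 * a ^ 2)\<close>.\<close>

lemma ln_ramsey4_le: "ln (real (ramsey4 L)) \<le> 2 * exp (6 * exp (8 * real L))"
proof -
  define r where "r = ramsey3 L"
  define a where "a = (2::nat) ^ (4 * L)"
  have r1: "1 \<le> r" unfolding r_def ramsey3_def by simp
  have a1: "1 \<le> a" unfolding a_def by simp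
  have a2: "a ^ 2 = 2 ^ (8 * L)" unfolding a_def by (simp flip: power_mult)
  have "r = 2 ^ ((a + 1) * a)" unfolding r_def ramsey3_def a_def ..
  moreover have "(a + 1) * a \<le> 2 * a ^ 2" using a1 by (simp add: power2_eq_square)
  ultimately have "r \<le> 2 ^ (2 * a ^ 2)" by simp
  then have "r ^ 3 \<le> (2 ^ (2 * a ^ 2)) ^ 3" by (rule power_mono) simp
  also have "\<dots> = 2 ^ (6 * a ^ 2)" by (simp flip: power_mult)
  finally have "real (r ^ 3) \<le> 2 ^ (6 * a ^ 2)" by (metis of_nat_le_iff of_nat_numeral of_nat_power)
  also have "\<dots> \<le> exp (real (6 * a ^ 2))" by (rule power2_le_exp)
  also have "real (6 * a ^ 2) = 6 * 2 ^ (8 * L)" using a2 by simp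
  also have "exp (6 * 2 ^ (8 * L)) \<le> exp (6 * exp (8 * real L))" using power2_le_exp[of "8 * L"] by simp
  finally have r3: "real (r ^ 3) \<le> exp (6 * exp (8 * real L))" .
  have "ln (real (ramsey4 L)) = real ((r ^ 2 + 1) * r) * ln 2"
    unfolding ramsey4_def r_def[symmetric] by (simp add: ln_realpow)
  also have "\<dots> \<le> real ((r ^ 2 + 1) * r) * 1" by (rule mult_left_mono) (use ln_2_less_1 in auto)
  also have "(r ^ 2 + 1) * r \<le> 2 * r ^ 3" using r1 by (simp add: power2_eq_square power3_eq_cube)
  then have "real ((r ^ 2 + 1) * r) * 1 \<le> 2 * real (r ^ 3)" by (metis mult.right_neutral of_nat_le_iff of_nat_mult of_nat_numeral)
  finally show ?thesis using r3 by simp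
qed

text \<open>A single term of the expansion of \<open>(1 / k + 1) ^ (p + n)\<close>. For
  \<open>p\<close> about \<open>n / k\<close> the bound is exp (O (n * ln k / k)).\<close>

lemma binomial_le_exp:
  assumes "1 \<le> k"
  shows "real ((p + n) choose p) \<le> real k ^ p * exp (real (p + n) / real k)"
proof -
  have "real ((p + n) choose p) * (1 / real k) ^ p \<le> (\<Sum>i\<le>p + n. real ((p + n) choose i) * (1 / real k) ^ i)"
    by (rule member_le_sum[of p]) auto
  also have "\<dots> = (1 / real k + 1) ^ (p + n)" by (subst binomial_ring) simp
  also have "\<dots> \<le> exp (1 / real k) ^ (p + n)"
    by (rule power_mono) (use exp_ge_add_one_self[of "1 / real k"] in \<open>auto simp: add.commute\<close>)
  also have "\<dots> = exp (real (p + n) / real k)" by (simp flip: exp_of_nat_mult)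
  finally show ?thesis using assms by (simp add: field_simps)
qed

lemma le_ramsey4: "L \<le> ramsey4 L"
proof -
  have le: "c \<le> 2 ^ c" for c :: nat using less_exp[of c] by simp
  have "L \<le> 4 * L" by simp
  also have "\<dots> \<le> 2 ^ (4 * L)" by (rule le)
  also have "\<dots> \<le> (2 ^ (4 * L) + 1) * 2 ^ (4 * L)" by simp
  also have "\<dots> \<le> ramsey3 L" unfolding ramsey3_def by (rule le)
  also have "\<dots> \<le> (ramsey3 L ^ 2 + 1) * ramsey3 L" by simp
  also have "\<dots> \<le> ramsey4 L" unfolding ramsey4_def by (rule le)
  finally show ?thesis .
qed

text \<open>The hypotheses hold for all large \<open>n\<close>. Here \<open>e2\<close> bounds
  \<open>L\<close> by the square root of \<open>ln (ln n)\<close>, \<open>e3\<close> then bounds the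
  logarithm of the Ramsey number by \<open>2 * sqrt n\<close>, and \<open>e4\<close> makes all
  factors except the binomial coefficient cost at most \<open>n / x\<close> in the exponent.\<close>

lemma parameters:
  fixes n :: nat
  defines "x \<equiv> ln (ln (ln (ln (real n))))"
  assumes x: "2 \<le> x"
    and e2: "24 + 8 * (x\<^sup>2 + 2) powr (x\<^sup>2 + 1) \<le> sqrt (ln (ln (real n)))"
    and e3: "6 * exp (8 * sqrt (ln (ln (real n)))) \<le> ln (real n) / 2"
    and e4: "(sqrt (ln (ln (real n))) + 1) * (2 * sqrt (real n)) + 1 \<le> real n / x"
    and e5: "x\<^sup>2 + 1 \<le> real n" and e6: "ln (real n) \<le> real n / x" and e7: "ln (x\<^sup>2 + 1) / x\<^sup>2 \<le> 1 / x"
  shows "\<exists>p k L R N. 2 \<le> p \<and> n \<le> k * p \<and> L = 8 * (1 + (k + 1) ^ k) + 16 \<and> R = ramsey4 L \<and> L \<le> R \<and> n \<le> N \<and>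
    R * (2 * R ^ L * ((p + n) choose p) ^ 256) \<le> N \<and> real N \<le> exp (1281 * real n / x)"
proof -
  \<comment> \<open>The square brings \<open>ln k / k\<close> below \<open>1 / x\<close>; a
    \<open>k\<close> of order \<open>x\<close> would leave a factor \<open>ln x\<close>.\<close>
  define k where "k = nat \<lceil>x\<^sup>2\<rceil>"
  define p where "p = n div k + 1"
  define L where "L = 8 * (1 + (k + 1) ^ k) + 16"
  define R where "R = ramsey4 L"
  define c where "c = (p + n) choose p"
  define V where "V = R * (2 * R ^ L * c ^ 256)"
  have n0: "0 < real n" using e5 by (smt (verit) zero_le_power2)
  have x2: "4 \<le> x\<^sup>2" using power_mono[OF x, of 2] by simp
  have kr: "real k = of_int \<lceil>x\<^sup>2\<rceil>" unfolding k_def using x2 by (simp add: of_nat_nat)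
  have k: "x\<^sup>2 \<le> real k" "real k \<le> x\<^sup>2 + 1" unfolding kr by linarith+
  have k4: "4 \<le> real k" using k x2 by linarith
  then have kpos: "1 \<le> k" by simp
  have kn: "k \<le> n" using k e5 by simp
  have "1 \<le> n div k" using kn kpos by (simp add: div_greater_zero_iff Suc_le_eq)
  then have p2: "2 \<le> p" unfolding p_def by simp
  have "n = k * (n div k) + n mod k" by simp
  moreover have "n mod k < k" using kpos by simp
  moreover have "k * p = k * (n div k) + k" unfolding p_def by simp
  ultimately have nkp: "n \<le> k * p" by linarith
  have LL: "real L \<le> sqrt (ln (ln (real n)))"
  proof -
    have "real ((k + 1) ^ k) = (real k + 1) powr real k" using kpos by (simp add: powr_realpow add.commute)
    also have "\<dots> \<le> (x\<^sup>2 + 2) powr real k" by (rule powr_mono2) (use k in auto)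
    also have "\<dots> \<le> (x\<^sup>2 + 2) powr (x\<^sup>2 + 1)" by (rule powr_mono) (use k x2 in auto)
    finally have "real ((k + 1) ^ k) \<le> (x\<^sup>2 + 2) powr (x\<^sup>2 + 1)" .
    moreover have "real L = 24 + 8 * real ((k + 1) ^ k)" unfolding L_def by simp
    ultimately show ?thesis using e2 by linarith
  qed
  have R0: "0 < R" unfolding R_def ramsey4_def by simp
  have lnR0: "0 \<le> ln (real R)" using R0 by simp
  have lnR: "ln (real R) \<le> 2 * sqrt (real n)"
  proof -
    have "ln (real R) \<le> 2 * exp (6 * exp (8 * real L))" unfolding R_def by (rule ln_ramsey4_le)
    also have "\<dots> \<le> 2 * exp (6 * exp (8 * sqrt (ln (ln (real n)))))" using LL by simp
    also have "\<dots> \<le> 2 * exp (ln (real n) / 2)" using e3 by simp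
    also have "exp (ln (real n) / 2) = sqrt (real n)" using n0 by (simp add: ln_sqrt[symmetric])
    finally show ?thesis .
  qed
  have c0: "0 < c" unfolding c_def by simp
  have xk: "1 / real k \<le> 1 / x"
  proof -
    have "x * 1 \<le> x * x" by (rule mult_left_mono) (use x in auto)
    then have "x \<le> real k" using k(1) by (simp add: power2_eq_square)
    then show ?thesis using x by (simp add: frac_le)
  qed
  have lnk: "ln (real k) / real k \<le> 1 / x"
  proof -
    have "ln (real k) / real k \<le> ln (x\<^sup>2 + 1) / x\<^sup>2"
      by (rule frac_le) (use k k4 x2 in auto)
    then show ?thesis using e7 by linarith
  qed
  have pr: "real p \<le> 2 * (real n / real k)"
  proof -
    have "real (n div k) \<le> real n / real k" by (rule of_nat_div_le_of_nat)
    moreover have "1 \<le> real n / real k" using kn kpos by simp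
    ultimately show ?thesis unfolding p_def by simp
  qed
  \<comment> \<open>The factor 5 is 2 + 3: \<open>p\<close> is at most \<open>2 * n / k\<close>, and
    \<open>p + n\<close> is at most \<open>3 * n\<close>.\<close>
  have lnc: "ln (real c) \<le> 5 * (real n / x)"
  proof -
    have "real c \<le> real k ^ p * exp (real (p + n) / real k)" unfolding c_def by (rule binomial_le_exp[OF kpos])
    then have "ln (real c) \<le> ln (real k ^ p * exp (real (p + n) / real k))" using c0 by (subst ln_le_cancel_iff) (use k4 in auto)
    also have "\<dots> = real p * ln (real k) + real (p + n) / real k"
      using k4 by (simp add: ln_mult ln_realpow)
    finally have 1: "ln (real c) \<le> real p * ln (real k) + real (p + n) / real k" .
    have "real p * ln (real k) \<le> 2 * (real n / real k) * ln (real k)" by (rule mult_right_mono[OF pr]) (use k4 in auto)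
    also have "\<dots> = 2 * real n * (ln (real k) / real k)" by simp
    also have "\<dots> \<le> 2 * real n * (1 / x)" by (rule mult_left_mono[OF lnk]) simp
    finally have 2: "real p * ln (real k) \<le> 2 * (real n / x)" by simp
    have "real n / real k \<le> real n / 1" by (rule divide_left_mono) (use k4 in auto)
    then have "real (p + n) \<le> 3 * real n" using pr by simp
    then have "real (p + n) / real k \<le> 3 * real n / real k" by (rule divide_right_mono) simp
    also have "\<dots> = 3 * real n * (1 / real k)" by simp
    also have "\<dots> \<le> 3 * real n * (1 / x)" by (rule mult_left_mono[OF xk]) simp
    finally have "real (p + n) / real k \<le> 3 * (real n / x)" by simp
    then show ?thesis using 1 2 by linarith
  qed
  have V: "real V \<le> exp (1281 * real n / x)"
  proof -
    have "ln (real V) = ln (real R) + (ln 2 + (real L * ln (real R) + 256 * ln (real c)))"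
      unfolding V_def using R0 c0 by (simp add: ln_mult ln_realpow)
    also have "\<dots> = (real L + 1) * ln (real R) + ln 2 + 256 * ln (real c)" by (simp add: algebra_simps)
    also have "\<dots> \<le> (sqrt (ln (ln (real n))) + 1) * (2 * sqrt (real n)) + 1 + 256 * (5 * (real n / x))"
    proof (intro add_mono mult_left_mono lnc)
      show "(real L + 1) * ln (real R) \<le> (sqrt (ln (ln (real n))) + 1) * (2 * sqrt (real n))"
        by (rule mult_mono) (use LL lnR lnR0 in auto)
    qed (use ln_2_less_1 in auto)
    \<comment> \<open>1281 = 256 * 5 + 1, the last unit by \<open>e4\<close>.\<close>
    also have "\<dots> \<le> 1281 * real n / x" using e4 by simp
    finally have "ln (real V) \<le> 1281 * real n / x" .
    moreover have "0 < real V" unfolding V_def using R0 c0 by simp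
    ultimately show ?thesis by (metis exp_le_cancel_iff exp_ln)
  qed
  have "real n \<le> exp (1281 * real n / x)"
  proof -
    have "ln (real n) \<le> 1281 * real n / x" using e6 n0 x by (smt (verit) divide_right_mono)
    then show ?thesis using n0 by (metis exp_le_cancel_iff exp_ln)
  qed
  then have N: "real (max n V) \<le> exp (1281 * real n / x)" using V by simp
  have LR: "L \<le> R" unfolding R_def by (rule le_ramsey4)
  have "R * (2 * R ^ L * ((p + n) choose p) ^ 256) \<le> max n V" unfolding V_def c_def by (rule max.cobounded2)
  with p2 nkp L_def R_def LR max.cobounded1[of n V] show ?thesis using N
    by (intro exI[of _ p] exI[of _ k] exI[of _ L] exI[of _ R] exI[of _ "max n V"] conjI)
qed

lemma iterated_log_4: "iterated_log 4 y = ln (ln (ln (ln y)))"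
  unfolding iterated_log_def by (simp add: numeral_eq_Suc)

lemma parameters_eventually:
  "\<forall>\<^sub>F n :: nat in at_top. 2 \<le> iterated_log 4 (real n) \<and> (\<exists>p k L R N. 2 \<le> p \<and> n \<le> k * p \<and>
    L = 8 * (1 + (k + 1) ^ k) + 16 \<and> R = ramsey4 L \<and> L \<le> R \<and> n \<le> N \<and>
    R * (2 * R ^ L * ((p + n) choose p) ^ 256) \<le> N \<and> real N \<le> exp (1281 * real n / iterated_log 4 (real n)))"
proof -
  have e1: "\<forall>\<^sub>F n :: nat in at_top. 2 \<le> ln (ln (ln (ln (real n))))" by real_asymp
  have e3: "\<forall>\<^sub>F n :: nat in at_top. 6 * exp (8 * sqrt (ln (ln (real n)))) \<le> ln (real n) / 2" by real_asymp
  have e4: "\<forall>\<^sub>F n :: nat in at_top. (sqrt (ln (ln (real n))) + 1) * (2 * sqrt (real n)) + 1 \<le>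
    real n / ln (ln (ln (ln (real n))))" by real_asymp
  have e5: "\<forall>\<^sub>F n :: nat in at_top. (ln (ln (ln (ln (real n)))))\<^sup>2 + 1 \<le> real n" by real_asymp
  have e6: "\<forall>\<^sub>F n :: nat in at_top. ln (real n) \<le> real n / ln (ln (ln (ln (real n))))" by real_asymp
  have e7: "\<forall>\<^sub>F n :: nat in at_top. ln ((ln (ln (ln (ln (real n)))))\<^sup>2 + 1) / (ln (ln (ln (ln (real n)))))\<^sup>2 \<le>
    1 / ln (ln (ln (ln (real n))))" by real_asymp
  have e2: "\<forall>\<^sub>F n :: nat in at_top. 24 + 8 * ((ln (ln (ln (ln (real n)))))\<^sup>2 + 2) powr ((ln (ln (ln (ln (real n)))))\<^sup>2 + 1) \<le>
    sqrt (ln (ln (real n)))" by real_asymp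
  show ?thesis
    using e1 e2 e3 e4 e5 e6 e7
    by eventually_elim (use parameters in \<open>simp add: iterated_log_4\<close>)
qed

theorem theorem1:
  shows "\<exists>C::real. \<exists>n\<^sub>0::nat. C > 0 \<and>
    (\<forall>d l n :: nat. 3 \<le> d \<longrightarrow> d < l \<longrightarrow> d < n \<longrightarrow> n\<^sub>0 \<le> n \<longrightarrow>
       ereal_of_enat (ES d l n)
         \<le> ereal ((real l - real d) / fact d *
                  2 powr (C * real d * real n / iterated_log 4 (real n))))"
proof -
  obtain n\<^sub>0 where n0: "\<And>n. n\<^sub>0 \<le> n \<Longrightarrow> 2 \<le> iterated_log 4 (real n) \<and> (\<exists>p k L R N. 2 \<le> p \<and> n \<le> k * p \<and>
    L = 8 * (1 + (k + 1) ^ k) + 16 \<and> R = ramsey4 L \<and> L \<le> R \<and> n \<le> N \<and>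
    R * (2 * R ^ L * ((p + n) choose p) ^ 256) \<le> N \<and> real N \<le> exp (1281 * real n / iterated_log 4 (real n)))"
    using parameters_eventually unfolding eventually_at_top_linorder by blast
  \<comment> \<open>The divisor \<open>ln 2\<close> converts from base \<open>exp 1\<close> to base
    2.\<close>
  have "ereal_of_enat (ES d l n) \<le> ereal ((real l - real d) / fact d *
      2 powr (1281 / ln 2 * real d * real n / iterated_log 4 (real n)))"
    if d: "3 \<le> d" "d < l" "d < n" and n: "n\<^sub>0 \<le> n" for d l n
  proof -
    obtain p k L R N where *: "2 \<le> p" "n \<le> k * p" "L = 8 * (1 + (k + 1) ^ k) + 16" "R = ramsey4 L" "L \<le> R"
      "n \<le> N" "R * (2 * R ^ L * ((p + n) choose p) ^ 256) \<le> N"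
      "real N \<le> exp (1281 * real n / iterated_log 4 (real n))"
      using n0[OF n] by (elim conjE exE)
    have "ereal_of_enat (ES d l n) \<le> ereal ((real l - real d) / fact d * real N ^ d)"
      by (rule ES_le[OF ES_property_bound[OF d *(1-7)] d(2)])
    also have "\<dots> \<le> ereal ((real l - real d) / fact d * 2 powr (1281 / ln 2 * real d * real n / iterated_log 4 (real n)))"
    proof -
      have "real N ^ d \<le> exp (1281 * real n / iterated_log 4 (real n)) ^ d" by (rule power_mono[OF *(8)]) simp
      also have "\<dots> = exp (real d * (1281 * real n / iterated_log 4 (real n)))" by (rule exp_of_nat_mult[symmetric])
      also have "\<dots> = 2 powr (1281 / ln 2 * real d * real n / iterated_log 4 (real n))"
        by (simp add: powr_def algebra_simps)
      finally have "real N ^ d \<le> 2 powr (1281 / ln 2 * real d * real n / iterated_log 4 (real n))" .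
      then show ?thesis unfolding ereal_less_eq by (rule mult_left_mono) (use d in simp)
    qed
    finally show ?thesis .
  qed
  then show ?thesis by (intro exI[of _ "1281 / ln 2"] exI[of _ n\<^sub>0]) simp
qed

end
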